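(* Each of the graphic matroids $M(K_{3,5})$, $M(G_1)$, and $M(G_2)$ lies in the class $\mathcal{M}_5$, where $G_1$ and $G_2$ are the explicit graphs defined in the context and $M(G)$ denotes the graphic (cycle) matroid of $G$.
   Context: **Class $\mathcal{M}_\ell$.** Let $\ell$ be a prime. Let $R$ be a regular matroid of rank $g$ on a finite ground set $S$, and choose a totally unimodular matrix $A\in\mathbb{Z}^{g\times|S|}$ of rank $g$ (columns indexed by $S$, of the form $(I_g\mid D)$ after ordering $S$) realizing $R$. Let $U=U(R)\subset\mathbb{Z}^S$ be the lattice spanned by the rows of $A$ (for a graphic matroid $M(G)$, $U$ is the cut lattice of $G$), and let $\bar U\subset\mathbb{F}_\ell^S$ be its reduction mod $\ell$, of dimension $g$. The notions below do not depend on the choice of $A$. The Albanese graph $\mathrm{Alb}_\ell(R)$ is the oriented $S$-colored graph with vertex set $V=\mathbb{F}_\ell^S/\bar U$ and, for each $[v]\in V$ and $s\in S$, exactly one oriented edge of color $s$ from $[v]$ to $[v+e_s]$, where $e_s$ is the standard basis vector. A 1-chain is an $\mathbb{F}_\ell$-linear combination of oriented edges; the boundary $\partial$ sends an edge from $[v]$ to $[w]$ to $[w]-[v]$; a 1-chain is closed if its boundary is $0$. The color profile is the linear map $\lambda$ from 1-chains to $\mathbb{F}_\ell^S$ sending each edge of color $s$ to $e_s$; $\lambda_s(b)$ is the $s$-component of $\lambda(b)$. A $\mathbb{Z}/\ell$-solution of $R$ in $\mathrm{Alb}_\ell(R)$ is a family $(b_s)_{s\in S}$ of 1-chains over $\mathbb{F}_\ell$,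 with $b_s$ supported on the edges of color $s$, such that $\sum_{s}c_s b_s$ is closed whenever $\sum_s c_s e_s\in\bar U$. $\mathcal{M}_\ell$ is the class of regular matroids $R$ admitting a $\mathbb{Z}/\ell$-solution in $\mathrm{Alb}_\ell(R)$ for which there is $c\in(\mathbb{Z}/\ell)^\times$ with $\lambda_s(b_s)=c$ for all $s\in S$. **Graphs.** $ij$ denotes the edge between vertices $i$ and $j$. $G_1$: vertex set $\{1,\dots,9\}$, edges $15,25,35,16,26,46,17,37,47,28,38,48,19,29,39,49$. $G_2$: the graph obtained from $K_4$ by subdividing each of its six edges once and adding a new vertex joined to the six subdivision vertices (11 vertices, 18 edges). $K_{3,5}$ is the complete bipartite graph. *)

theory Defs
  imports
    "Jordan_Normal_Form.Determinant"
    "HOL-Library.Numeral_Type"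
    "HOL-Computational_Algebra.Primes"
begin

section \<open>Regular matroids\<close>

text \<open>A matroid is the pair of its ground set and its family of independent sets.\<close>

type_synonym 's matroid = "'s set \<times> 's set set"

definition is_matroid :: "'s matroid \<Rightarrow> bool" where
  "is_matroid M \<longleftrightarrow> (case M of (S, \<I>) \<Rightarrow>
     finite S \<and> (\<forall>I\<in>\<I>. I \<subseteq> S) \<and> {} \<in> \<I> \<and>
     (\<forall>I\<in>\<I>. \<forall>J. J \<subseteq> I \<longrightarrow> J \<in> \<I>) \<and>
     (\<forall>I\<in>\<I>. \<forall>J\<in>\<I>. card I < card J \<longrightarrow> (\<exists>x\<in>J - I. insert x I \<in> \<I>)))"

text \<open>
  An integer matrix with \<open>g\<close> rows and columns indexed by \<open>S\<close> is a function \<open>A\<close>, of which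
  only the entries \<open>A i s\<close> with \<open>i < g\<close> and \<open>s \<in> S\<close> matter.
\<close>

definition totally_unimodular :: "nat \<Rightarrow> 's set \<Rightarrow> (nat \<Rightarrow> 's \<Rightarrow> int) \<Rightarrow> bool" where
  "totally_unimodular g S A \<longleftrightarrow>
     (\<forall>k r c. r ` {..<k} \<subseteq> {..<g} \<longrightarrow> inj_on r {..<k} \<longrightarrow>
              c ` {..<k} \<subseteq> S \<longrightarrow> inj_on c {..<k} \<longrightarrow>
              det (mat k k (\<lambda>(i, j). A (r i) (c j))) \<in> {-1, 0, 1})"

text \<open>
  The matrix has the form \<open>(I\<^sub>g | D)\<close> once the columns \<open>\<beta> 0, \<dots>, \<beta> (g - 1)\<close> are put in
  front. In particular it has rank \<open>g\<close>.
\<close>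

definition standard_form :: "nat \<Rightarrow> 's set \<Rightarrow> (nat \<Rightarrow> 's \<Rightarrow> int) \<Rightarrow> bool" where
  "standard_form g S A \<longleftrightarrow>
     (\<exists>\<beta>. \<beta> ` {..<g} \<subseteq> S \<and> inj_on \<beta> {..<g} \<and>
          (\<forall>i<g. \<forall>j<g. A i (\<beta> j) = (if i = j then 1 else 0)))"

text \<open>
  Linear independence over the rationals of the family (not the set) of columns with indices
  in \<open>J\<close>, so that two equal columns with different indices are dependent.
\<close>

definition columns_independent :: "nat \<Rightarrow> (nat \<Rightarrow> 's \<Rightarrow> int) \<Rightarrow> 's set \<Rightarrow> bool" where
  "columns_independent g A J \<longleftrightarrow>
     (\<forall>c :: 's \<Rightarrow> rat. (\<forall>i<g. (\<Sum>s\<in>J. c s * of_int (A i s)) = 0) \<longrightarrow> (\<forall>s\<in>J. c s = 0))"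

definition realizes :: "nat \<Rightarrow> (nat \<Rightarrow> 's \<Rightarrow> int) \<Rightarrow> 's matroid \<Rightarrow> bool" where
  "realizes g A M \<longleftrightarrow> (case M of (S, \<I>) \<Rightarrow> \<I> = {J. J \<subseteq> S \<and> columns_independent g A J})"

text \<open>The number \<open>g\<close> of rows of such a realization is necessarily the rank of the matroid.\<close>

definition TU_realization :: "nat \<Rightarrow> (nat \<Rightarrow> 's \<Rightarrow> int) \<Rightarrow> 's matroid \<Rightarrow> bool" where
  "TU_realization g A M \<longleftrightarrow>
     totally_unimodular g (fst M) A \<and> standard_form g (fst M) A \<and> realizes g A M"

definition regular_matroid :: "'s matroid \<Rightarrow> bool" where
  "regular_matroid M \<longleftrightarrow> is_matroid M \<and> (\<exists>g A. TU_realization g A M)"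


section \<open>The Albanese graph\<close>

text \<open>
  Vectors indexed by \<open>S\<close> are functions vanishing outside \<open>S\<close>. The field of \<open>\<ell>\<close> elements is
  a finite commutative ring type \<open>'k\<close> with \<open>CARD('k) = \<ell>\<close>; primality of \<open>CARD('k)\<close> is imposed
  in the definition of the class below. For \<open>\<ell> = 5\<close> the numeral type \<open>5\<close> can be used.
\<close>

definition vectors :: "'s set \<Rightarrow> ('s \<Rightarrow> 'k :: comm_ring_1) set" where
  "vectors S = {v. \<forall>s. s \<notin> S \<longrightarrow> v s = 0}"

definition std_basis :: "'s \<Rightarrow> 's \<Rightarrow> 'k :: comm_ring_1" where
  "std_basis s = (\<lambda>t. if t = s then 1 else 0)"

definition row_lattice :: "nat \<Rightarrow> (nat \<Rightarrow> 's \<Rightarrow> int) \<Rightarrow> 's set \<Rightarrow> ('s \<Rightarrow> int) set" where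
  "row_lattice g A S = {\<lambda>s. if s \<in> S then (\<Sum>i<g. n i * A i s) else 0 | n :: nat \<Rightarrow> int. True}"

definition reduction :: "('s \<Rightarrow> int) set \<Rightarrow> ('s \<Rightarrow> 'k :: comm_ring_1) set" where
  "reduction U = (\<lambda>u s. of_int (u s)) ` U"

definition translate :: "('s \<Rightarrow> 'k :: comm_ring_1) \<Rightarrow> ('s \<Rightarrow> 'k) set \<Rightarrow> ('s \<Rightarrow> 'k) set" where
  "translate v X = (\<lambda>u s. v s + u s) ` X"

text \<open>
  In the following, \<open>W\<close> is the reduced lattice. The class \<open>[v]\<close> is the coset \<open>translate v W\<close>.
  The edge of color \<open>s\<close> leaving the vertex \<open>x\<close> is the pair \<open>(x, s)\<close>; if \<open>x = [v]\<close> then its head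
  \<open>translate (std_basis s) x\<close> is \<open>[v + e\<^sub>s]\<close>.
\<close>

type_synonym ('s, 'k) vertex = "('s \<Rightarrow> 'k) set"
type_synonym ('s, 'k) edge = "('s, 'k) vertex \<times> 's"
type_synonym ('s, 'k) chain = "('s, 'k) edge \<Rightarrow> 'k"

definition alb_vertices :: "'s set \<Rightarrow> ('s \<Rightarrow> 'k :: comm_ring_1) set \<Rightarrow> ('s, 'k) vertex set" where
  "alb_vertices S W = {translate v W | v. v \<in> vectors S}"

definition alb_edges :: "'s set \<Rightarrow> ('s \<Rightarrow> 'k :: comm_ring_1) set \<Rightarrow> ('s, 'k) edge set" where
  "alb_edges S W = alb_vertices S W \<times> S"

definition tail :: "('s, 'k :: comm_ring_1) edge \<Rightarrow> ('s, 'k) vertex" where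
  "tail e = fst e"

definition color :: "('s, 'k :: comm_ring_1) edge \<Rightarrow> 's" where
  "color e = snd e"

definition head :: "('s, 'k :: comm_ring_1) edge \<Rightarrow> ('s, 'k) vertex" where
  "head e = translate (std_basis (color e)) (tail e)"

definition one_chains :: "'s set \<Rightarrow> ('s \<Rightarrow> 'k :: comm_ring_1) set \<Rightarrow> ('s, 'k) chain set" where
  "one_chains S W = {b. \<forall>e. e \<notin> alb_edges S W \<longrightarrow> b e = 0}"

definition boundary ::
  "'s set \<Rightarrow> ('s \<Rightarrow> 'k :: comm_ring_1) set \<Rightarrow> ('s, 'k) chain \<Rightarrow> ('s, 'k) vertex \<Rightarrow> 'k" where
  "boundary S W b x = (\<Sum>e\<in>alb_edges S W. b e * (of_bool (head e = x) - of_bool (tail e = x)))"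

definition closed_chain ::
  "'s set \<Rightarrow> ('s \<Rightarrow> 'k :: comm_ring_1) set \<Rightarrow> ('s, 'k) chain \<Rightarrow> bool" where
  "closed_chain S W b \<longleftrightarrow> (\<forall>x\<in>alb_vertices S W. boundary S W b x = 0)"

definition color_profile ::
  "'s set \<Rightarrow> ('s \<Rightarrow> 'k :: comm_ring_1) set \<Rightarrow> ('s, 'k) chain \<Rightarrow> 's \<Rightarrow> 'k" where
  "color_profile S W b t = (\<Sum>e\<in>alb_edges S W. b e * std_basis (color e) t)"

definition is_solution ::
  "'s set \<Rightarrow> ('s \<Rightarrow> 'k :: comm_ring_1) set \<Rightarrow> ('s \<Rightarrow> ('s, 'k) chain) \<Rightarrow> bool" where
  "is_solution S W b \<longleftrightarrow>
     (\<forall>s\<in>S. b s \<in> one_chains S W \<and> (\<forall>e. color e \<noteq> s \<longrightarrow> b s e = 0)) \<and>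
     (\<forall>c\<in>W. closed_chain S W (\<lambda>e. \<Sum>s\<in>S. c s * b s e))"

text \<open>
  The class of matroids for the prime \<open>CARD('k)\<close>. The condition does not depend on the chosen
  realization \<open>A\<close>, because the reduced lattice is determined by the matroid up to changing the
  signs of coordinates.
\<close>

definition matroid_class :: "'k :: {comm_ring_1, finite} itself \<Rightarrow> 's matroid set" where
  "matroid_class TYPE('k) = {M. prime CARD('k) \<and> regular_matroid M \<and>
     (\<exists>g A. TU_realization g A M \<and>
       (let S = fst M; W = reduction (row_lattice g A S) :: ('s \<Rightarrow> 'k) set in
        \<exists>b. is_solution S W b \<and>
            (\<exists>c. c dvd 1 \<and> (\<forall>s\<in>S. color_profile S W (b s) s = c))))}"


section \<open>Graphs and their cycle matroids\<close>

text \<open>A finite simple graph is the pair of its vertex set and its set of two-element edges.\<close>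

type_synonym 'v graph = "'v set \<times> 'v set set"

definition is_cycle :: "'v set set \<Rightarrow> 'v list \<Rightarrow> bool" where
  "is_cycle F vs \<longleftrightarrow> 3 \<le> length vs \<and> distinct vs \<and>
     (\<forall>i<length vs. {vs ! i, vs ! (Suc i mod length vs)} \<in> F)"

definition cycle_matroid :: "'v graph \<Rightarrow> 'v set matroid" where
  "cycle_matroid G = (snd G, {F. F \<subseteq> snd G \<and> (\<nexists>vs. is_cycle F vs)})"

definition complete_bipartite :: "nat \<Rightarrow> nat \<Rightarrow> (nat + nat) graph" where
  "complete_bipartite m n =
     (Inl ` {..<m} \<union> Inr ` {..<n}, {{Inl i, Inr j} | i j. i < m \<and> j < n})"

definition complete_graph :: "nat \<Rightarrow> nat graph" where
  "complete_graph n = ({..<n}, {{i, j} | i j. i < n \<and> j < n \<and> i \<noteq> j})"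

definition G\<^sub>1 :: "nat graph" where
  "G\<^sub>1 = ({1..9},
     {{1,5}, {2,5}, {3,5},
      {1,6}, {2,6}, {4,6},
      {1,7}, {3,7}, {4,7},
      {2,8}, {3,8}, {4,8},
      {1,9}, {2,9}, {3,9}, {4,9}})"

datatype 'v subdivision_vertex = Old 'v | Mid "'v set" | Apex

text \<open>
  Subdivide every edge \<open>e\<close> of \<open>G\<close> once, by the vertex \<open>Mid e\<close>, and join a new vertex \<open>Apex\<close>
  to all subdivision vertices.
\<close>

definition subdivide_and_join :: "'v graph \<Rightarrow> 'v subdivision_vertex graph" where
  "subdivide_and_join G =
     (Old ` fst G \<union> Mid ` snd G \<union> {Apex},
      {{Old v, Mid e} | v e. e \<in> snd G \<and> v \<in> e} \<union> {{Apex, Mid e} | e. e \<in> snd G})"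

definition G\<^sub>2 :: "nat subdivision_vertex graph" where
  "G\<^sub>2 = subdivide_and_join (complete_graph 4)"

end

(*
  Let R be the group ring over F_5 of V = F_5^S / U. Chains of color s are elements f_s of R, and
  taking boundaries multiplies them by x_s - 1, where x_s is the group element e_s. So a solution
  is an additive flow on the graph with values in R whose value at s is (x_s - 1) f_s; the color
  profile is the augmentation of f_s.

  As an algebra, R is F_5[y_1, ..., y_b] / (y_i^5), with b the first Betti number. Let z_s be the
  tautological additive flow of linear forms. It suffices to find a multiplicative flow x in
  R with x_s - 1 equal to z_s times a unit congruent to a nonzero constant. Truncated exponentials
  of z_s fail to be a multiplicative flow only by the Witt carries (sum of z_s^5) / 5 at the
  vertices. These can be absorbed as soon as there are quartic forms h_s such that
  c z_s^5 + 5 z_s h_s is again an additive flow, i.e. if Frobenius lifts modulo 25 to the space of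
  flows compatibly with the hyperplanes z_s = 0. The forms h_s are given explicitly.
*)

theory Submission
  imports
    Defs
    "HOL-Library.Poly_Mapping"
    "HOL-Library.Multiset"
    "HOL-Number_Theory.Cong"
begin

section \<open>Matroids of columns\<close>

text \<open>Dividing by 5 forces integral lifts: the carry at a vertex is determined by five times
  itself only where 5 is not a zero divisor. So each \<open>z s\<close> is accompanied by a linear
  form \<open>l s\<close> with integer coefficients, and the required identity is one between
  integer polynomials. The factor c, prime to 5, makes room for denominators: over the integers
  localized at 5, cofactors h for c amount to cofactors h / c for 1. The correction at an edge has
  the form z_s h_s, rather than being an arbitrary quintic, because its exponential must be 1 plus a
  multiple of z_s. No inverse of the unit u_s = c + n_s is computed: u_s^5 is the constant c^5 by
  Frobenius, so f_s = u_s^4 yields the additive flow c^5 z_s. For the color profiles, the sum over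
  all vertices produces the socle element of R, which reduces every unit to its constant term; all
  profiles are therefore the same power of c. The three graphs are bipartite. Orienting every edge
  towards the same side makes conservation at a vertex an unsigned sum or product over its
  edges.\<close>

abbreviation rat_scale :: "rat \<Rightarrow> (nat \<Rightarrow>\<^sub>0 rat) \<Rightarrow> nat \<Rightarrow>\<^sub>0 rat" where
  "rat_scale r f \<equiv> Poly_Mapping.single 0 r * f"

text \<open>Columns are encoded as rational polynomials, i.e. finitely supported functions on
  \<open>nat\<close>, with multiplication by constants as scalar multiplication; this gives access
  to the span and dimension theory of \<open>vector_space\<close>.\<close>

interpretation rat_poly: vector_space rat_scale
proof
  fix a b :: rat and x y :: "nat \<Rightarrow>\<^sub>0 rat"
  show "rat_scale a (x + y) = rat_scale a x + rat_scale a y"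
    by (rule distrib_left)
  show "rat_scale (a + b) x = rat_scale a x + rat_scale b x"
    by (simp only: single_add distrib_right)
  show "rat_scale a (rat_scale b x) = rat_scale (a * b) x"
    by (simp only: mult.assoc[symmetric] mult_single add_0)
  show "rat_scale 1 x = x" by simp
qed

definition rat_column :: "nat \<Rightarrow> (nat \<Rightarrow> 's \<Rightarrow> int) \<Rightarrow> 's \<Rightarrow> nat \<Rightarrow>\<^sub>0 rat" where
  "rat_column g A s = (\<Sum>i<g. Poly_Mapping.single i (of_int (A i s)))"

lemma scale_rat_column:
  "rat_scale r (rat_column g A s) = (\<Sum>i<g. Poly_Mapping.single i (r * of_int (A i s)))"
  by (simp add: rat_column_def sum_distrib_left mult_single)

lemma lookup_sum_single:
  "Poly_Mapping.lookup (\<Sum>i<g. Poly_Mapping.single i (f i :: rat)) (i::nat) = (if i < g then f i else 0)"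
  by (cases "i < g") (auto simp: lookup_sum lookup_single when_def)

lemma columns_independent_iff:
  "columns_independent g A J \<longleftrightarrow>
     (\<forall>c. (\<Sum>s\<in>J. rat_scale (c s) (rat_column g A s)) = 0 \<longrightarrow> (\<forall>s\<in>J. c s = 0))"
proof -
  have "Poly_Mapping.lookup (\<Sum>s\<in>J. rat_scale (c s) (rat_column g A s)) i
      = (if i < g then \<Sum>s\<in>J. c s * of_int (A i s) else 0)" for c :: "'a \<Rightarrow> rat" and i
    by (cases "i < g") (simp_all add: scale_rat_column lookup_sum[of _ J] lookup_sum_single)
  then have "(\<Sum>s\<in>J. rat_scale (c s) (rat_column g A s)) = 0 \<longleftrightarrow> (\<forall>i<g. (\<Sum>s\<in>J. c s * of_int (A i s)) = 0)"
    for c :: "'a \<Rightarrow> rat"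
    unfolding poly_mapping_eq_iff fun_eq_iff by auto
  then show ?thesis by (simp add: columns_independent_def)
qed

lemma columns_independent_mono:
  assumes "columns_independent g A J" "I \<subseteq> J" "finite J"
  shows "columns_independent g A I"
  unfolding columns_independent_def
proof (intro allI impI ballI)
  fix c :: "'a \<Rightarrow> rat" and s
  assume c: "\<forall>i<g. (\<Sum>s\<in>I. c s * of_int (A i s)) = 0" and s: "s \<in> I"
  define d where "d t = (if t \<in> I then c t else 0)" for t
  have "(\<Sum>s\<in>J. d s * of_int (A i s)) = (\<Sum>s\<in>I. c s * of_int (A i s))" for i
    by (rule sum.mono_neutral_cong_right) (use assms in \<open>auto simp: d_def\<close>)
  then have "d s = 0"
    using assms c s by (auto simp: columns_independent_def)
  then show "c s = 0" using s by (simp add: d_def)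
qed

text \<open>\<open>columns_independent\<close> speaks of families, the vector space theory of sets.
  Nothing is lost in the passage: two equal columns would satisfy the relation with coefficients 1
  and -1.\<close>

lemma columns_independent_imp:
  assumes "columns_independent g A J" "finite J"
  shows "inj_on (rat_column g A) J" and "rat_poly.independent (rat_column g A ` J)"
proof -
  show inj: "inj_on (rat_column g A) J"
  proof (rule inj_onI, rule ccontr)
    fix s t assume st: "s \<in> J" "t \<in> J" "rat_column g A s = rat_column g A t" "s \<noteq> t"
    define c :: "'a \<Rightarrow> rat" where "c = (\<lambda>u. if u = s then 1 else if u = t then -1 else 0)"
    have "(\<Sum>u\<in>J. rat_scale (c u) (rat_column g A u)) = (\<Sum>u\<in>{s,t}. rat_scale (c u) (rat_column g A u))"
      by (rule sum.mono_neutral_right) (use assms st in \<open>auto simp: c_def\<close>)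
    also have "\<dots> = 0" using st by (simp add: c_def single_uminus)
    finally have "c s = 0"
      using assms st(1) by (auto simp: columns_independent_iff)
    then show False by (simp add: c_def)
  qed
  show "rat_poly.independent (rat_column g A ` J)"
  proof
    assume "rat_poly.dependent (rat_column g A ` J)"
    then obtain u v where v: "v \<in> rat_column g A ` J" "u v \<noteq> 0"
      and "(\<Sum>v\<in>rat_column g A ` J. rat_scale (u v) v) = 0"
      using rat_poly.dependent_finite[of "rat_column g A ` J"] assms by auto
    then have "(\<Sum>s\<in>J. rat_scale (u (rat_column g A s)) (rat_column g A s)) = 0"
      by (simp add: sum.reindex[OF inj])
    then have "\<forall>s\<in>J. u (rat_column g A s) = 0"
      using assms(1)[unfolded columns_independent_iff, THEN spec, of "\<lambda>s. u (rat_column g A s)"] by simp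
    then show False using v by auto
  qed
qed

text \<open>Steinitz: if no column of J could be added, all of them would lie in the span of the
  columns of I, and an independent set is no larger than a spanning one.\<close>

lemma columns_exchange:
  assumes I: "columns_independent g A I" "finite I" and J: "columns_independent g A J" "finite J"
    and less: "card I < card J"
  shows "\<exists>x\<in>J - I. columns_independent g A (insert x I)"
proof (rule ccontr)
  assume neg: "\<not> ?thesis"
  have "rat_column g A x \<in> rat_poly.span (rat_column g A ` I)" if x: "x \<in> J" for x
  proof (cases "x \<in> I")
    case True
    then show ?thesis by (auto intro: rat_poly.span_base)
  next
    case False
    then have "\<not> columns_independent g A (insert x I)" using x neg by auto
    then obtain c s where c: "(\<Sum>t\<in>insert x I. rat_scale (c t) (rat_column g A t)) = 0"
      and s: "s \<in> insert x I" "c s \<noteq> 0"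
      unfolding columns_independent_iff by blast
    define R where "R = (\<Sum>t\<in>I. rat_scale (c t) (rat_column g A t))"
    have e: "rat_scale (c x) (rat_column g A x) + R = 0"
      using c I False by (simp add: R_def)
    have cx: "c x \<noteq> 0"
    proof
      assume "c x = 0"
      then have "R = 0" using e by simp
      then show False
        using I(1) s \<open>c x = 0\<close> unfolding columns_independent_iff R_def by blast
    qed
    have "R \<in> rat_poly.span (rat_column g A ` I)"
      unfolding R_def by (intro rat_poly.span_sum rat_poly.span_scale rat_poly.span_base) auto
    then have "rat_scale (1 / c x) (- R) \<in> rat_poly.span (rat_column g A ` I)"
      by (intro rat_poly.span_scale rat_poly.span_neg)
    moreover have "- R = rat_scale (c x) (rat_column g A x)"
      using e by (simp add: add_eq_0_iff)
    ultimately show ?thesis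
      using cx by (simp add: mult.assoc[symmetric] mult_single)
  qed
  then have "card (rat_column g A ` J) \<le> card (rat_column g A ` I)"
    using rat_poly.independent_span_bound[of "rat_column g A ` I" "rat_column g A ` J"]
      columns_independent_imp[OF J] I by auto
  then have "card J \<le> card I"
    using columns_independent_imp(1)[OF J] card_image_le[OF I(2), of "rat_column g A"]
    by (simp add: card_image)
  then show False using less by simp
qed

lemma realizes_is_matroid:
  assumes fin: "finite S" and "realizes g A (S, \<I>)"
  shows "is_matroid (S, \<I>)"
proof -
  have I: "J \<in> \<I> \<longleftrightarrow> J \<subseteq> S \<and> columns_independent g A J" for J
    using assms(2) by (auto simp: realizes_def)
  have sub: "J \<subseteq> S" "finite J" if "J \<in> \<I>" for J
    using that fin finite_subset by (auto simp: I)
  have "J \<in> \<I>" if K: "K \<in> \<I>" "J \<subseteq> K" for J K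
    using columns_independent_mono[of g A K J] K sub[OF K(1)] unfolding I by blast
  moreover have "\<exists>x\<in>K - J. insert x J \<in> \<I>" if JK: "J \<in> \<I>" "K \<in> \<I>" "card J < card K" for J K
  proof -
    have "columns_independent g A J" "columns_independent g A K"
      using JK unfolding I by blast+
    then obtain x where "x \<in> K - J" "columns_independent g A (insert x J)"
      using columns_exchange[of g A J K] JK(3) sub(2)[OF JK(1)] sub(2)[OF JK(2)] by blast
    then show ?thesis using sub(1)[OF JK(1)] sub(1)[OF JK(2)] unfolding I by blast
  qed
  moreover have "{} \<in> \<I>" unfolding I by (simp add: columns_independent_def)
  ultimately show ?thesis
    unfolding is_matroid_def prod.case using fin sub(1) by (intro conjI ballI allI impI) 
qed

section \<open>Cut matrices of graphs\<close>

text \<open>\<open>v 0\<close> is the root of a spanning tree and \<open>par k\<close> is the number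
  of the parent of \<open>v (Suc k)\<close>. Since parents have smaller numbers, induction on
  numbers replaces arguments about tree paths. The number g of tree edges will be the rank.\<close>

locale numbered_tree =
  fixes E :: "'v set set" and dst src :: "'v set \<Rightarrow> 'v"
    and v :: "nat \<Rightarrow> 'v" and g :: nat and par :: "nat \<Rightarrow> nat"
  assumes mem_edge: "s \<in> E \<Longrightarrow> x \<in> s \<longleftrightarrow> x = dst s \<or> x = src s"
    and dst_neq_src: "s \<in> E \<Longrightarrow> dst s \<noteq> src s"
    and edge_vertex: "s \<in> E \<Longrightarrow> x \<in> s \<Longrightarrow> x \<in> v ` {..g}"
    and v_inj: "inj_on v {..g}"
    and par: "k < g \<Longrightarrow> par k \<le> k \<and> {v (Suc k), v (par k)} \<in> E"
begin

lemma edge_eq: "s \<in> E \<Longrightarrow> s = {dst s, src s}"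
  using mem_edge by blast

lemma finite_E: "finite E"
  by (rule finite_subset[of _ "Pow (v ` {..g})"]) (use edge_vertex in auto)

lemma edge_pair:
  assumes "{x, y} \<in> E"
  shows "x \<noteq> y" and "dst {x, y} = x \<and> src {x, y} = y \<or> dst {x, y} = y \<and> src {x, y} = x"
proof -
  define d s where "d = dst {x, y}" and "s = src {x, y}"
  have "{x, y} = {d, s}" "d \<noteq> s"
    using edge_eq[OF assms] dst_neq_src[OF assms] unfolding d_def s_def .
  then have "x \<noteq> y" and "d = x \<and> s = y \<or> d = y \<and> s = x"
    by (auto simp: doubleton_eq_iff)
  then show "x \<noteq> y" and "dst {x, y} = x \<and> src {x, y} = y \<or> dst {x, y} = y \<and> src {x, y} = x"
    by (simp_all add: d_def s_def)
qed

section \<open>Signed tree paths and fundamental cuts\<close>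

definition num :: "'v \<Rightarrow> nat" where
  "num = the_inv_into {..g} v"

lemma num_v [simp]: "k \<le> g \<Longrightarrow> num (v k) = k"
  unfolding num_def by (rule the_inv_into_f_f[OF v_inj]) simp

lemma v_num: "x \<in> v ` {..g} \<Longrightarrow> v (num x) = x \<and> num x \<le> g"
  by auto

definition tree_edge :: "nat \<Rightarrow> 'v set" where
  "tree_edge k = {v (Suc k), v (par k)}"

definition tree_sign :: "nat \<Rightarrow> int" where
  "tree_sign k = (if dst (tree_edge k) = v (Suc k) then 1 else -1)"

lemma tree_edge_E: "k < g \<Longrightarrow> tree_edge k \<in> E"
  using par by (simp add: tree_edge_def)

lemma tree_edge_diff:
  fixes \<chi> :: "'v \<Rightarrow> 'r::comm_ring_1"
  assumes "k < g"
  shows "\<chi> (dst (tree_edge k)) - \<chi> (src (tree_edge k))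
    = of_int (tree_sign k) * (\<chi> (v (Suc k)) - \<chi> (v (par k)))"
  using edge_pair[of "v (Suc k)" "v (par k)"] par[OF assms]
  by (auto simp: tree_sign_def tree_edge_def)

text \<open>The value at k is the signed incidence vector of the tree path from the root to
  \<open>v k\<close>, which extends the path to the parent by one tree edge. As \<open>par\<close>
  is controlled only below g, the recursion is carried out up to a bound n.\<close>

lemma potential_exists:
  "\<exists>P. P 0 = (\<lambda>i. 0) \<and> (\<forall>k<g. P (Suc k) = (P (par k))(k := tree_sign k))"
proof -
  have "n \<le> g \<Longrightarrow> \<exists>P. P 0 = (\<lambda>i. 0) \<and> (\<forall>k<n. P (Suc k) = (P (par k))(k := tree_sign k))" for n
  proof (induction n)
    case 0
    show ?case by auto
  next
    case (Suc n)
    have "\<exists>P. P 0 = (\<lambda>i. 0) \<and> (\<forall>k<n. P (Suc k) = (P (par k))(k := tree_sign k))"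
      by (rule Suc.IH) (use Suc.prems in simp)
    then obtain P where P: "P 0 = (\<lambda>i. 0)" "\<forall>k<n. P (Suc k) = (P (par k))(k := tree_sign k)"
      by blast
    define Q where "Q = P(Suc n := (P (par n))(n := tree_sign n))"
    have "Q (Suc k) = (Q (par k))(k := tree_sign k)" if "k < Suc n" for k
    proof -
      have "par k \<le> k" using par[of k] that Suc.prems by simp
      then have "Q (par k) = P (par k)" using that by (simp add: Q_def)
      then show ?thesis using P(2)[rule_format, of k] that by (cases "k = n") (simp_all add: Q_def)
    qed
    moreover have "Q 0 = (\<lambda>i. 0)" by (simp add: Q_def P(1))
    ultimately show ?case by blast
  qed
  then show ?thesis by blast
qed

definition pot :: "nat \<Rightarrow> nat \<Rightarrow> int" where
  "pot = (SOME P. P 0 = (\<lambda>i. 0) \<and> (\<forall>k<g. P (Suc k) = (P (par k))(k := tree_sign k)))"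

lemma pot_0: "pot 0 = (\<lambda>i. 0)"
  and pot_Suc: "k < g \<Longrightarrow> pot (Suc k) = (pot (par k))(k := tree_sign k)"
  using someI_ex[OF potential_exists] unfolding pot_def[symmetric] by auto

text \<open>Tree edge i leads to \<open>v (Suc i)\<close>, and numbers increase along a path from
  the root.\<close>

lemma pot_eq_0: "k \<le> g \<Longrightarrow> k \<le> i \<Longrightarrow> pot k i = 0"
proof (induction k rule: less_induct)
  case (less k)
  show ?case
  proof (cases k)
    case 0
    then show ?thesis by (simp add: pot_0)
  next
    case (Suc j)
    then show ?thesis using less par[of j] by (simp add: pot_Suc)
  qed
qed

text \<open>Column s is the signed tree path from \<open>src s\<close> to \<open>dst s\<close>;
  equivalently, row i is the signed fundamental cut of the tree edge i.\<close>

definition cut_matrix :: "nat \<Rightarrow> 'v set \<Rightarrow> int" where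
  "cut_matrix i s = pot (num (dst s)) i - pot (num (src s)) i"

lemma cut_matrix_tree_edge:
  assumes "j < g"
  shows "cut_matrix i (tree_edge j) = (if i = j then 1 else 0)"
proof -
  have p: "par j \<le> j" using par[OF assms] by simp
  have "cut_matrix i (tree_edge j) = tree_sign j * (pot (Suc j) i - pot (par j) i)"
    unfolding cut_matrix_def using tree_edge_diff[OF assms, of "\<lambda>x. pot (num x) i"] assms p by simp
  then show ?thesis
    using assms p pot_eq_0[of "par j" j] by (auto simp: pot_Suc tree_sign_def)
qed

text \<open>The differences of \<chi> telescope along the tree path to \<open>v k\<close>; the signs
  in \<open>pot\<close> compensate the orientations of the tree edges.\<close>

lemma potential_diff:
  fixes \<chi> :: "'v \<Rightarrow> 'r::comm_ring_1"
  assumes "k \<le> g"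
  shows "(\<Sum>i<g. of_int (pot k i) * (\<chi> (dst (tree_edge i)) - \<chi> (src (tree_edge i)))) = \<chi> (v k) - \<chi> (v 0)"
  using assms
proof (induction k rule: less_induct)
  case (less k)
  show ?case
  proof (cases k)
    case 0
    then show ?thesis by (simp add: pot_0)
  next
    case (Suc j)
    define D where "D i = \<chi> (dst (tree_edge i)) - \<chi> (src (tree_edge i))" for i
    have j: "j < g" "par j \<le> j" using Suc less.prems par by auto
    have "(\<Sum>i<g. of_int (pot k i) * D i)
        = (\<Sum>i<g. of_int (pot (par j) i) * D i + (if i = j then of_int (tree_sign j) * D j else 0))"
      using j pot_eq_0[of "par j" j] by (intro sum.cong) (auto simp: Suc pot_Suc)
    also have "\<dots> = \<chi> (v (par j)) - \<chi> (v 0) + of_int (tree_sign j) * D j"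
      using less.IH[of "par j"] j Suc by (simp add: sum.distrib D_def)
    also have "of_int (tree_sign j) * D j = \<chi> (v (Suc j)) - \<chi> (v (par j))"
      unfolding D_def tree_edge_diff[OF j(1)] by (auto simp: tree_sign_def)
    finally show ?thesis by (simp add: D_def Suc)
  qed
qed

text \<open>So the coboundary of a vertex function is the combination of the rows whose coefficients
  are its values on the tree edges. Conversely row i is the coboundary of a potential, so later
  arguments can replace rows by arbitrary test functions \<chi> and forget the tree.\<close>

lemma cut_matrix_diff:
  fixes \<chi> :: "'v \<Rightarrow> 'r::comm_ring_1"
  assumes "s \<in> E"
  shows "(\<Sum>i<g. of_int (cut_matrix i s) * (\<chi> (dst (tree_edge i)) - \<chi> (src (tree_edge i))))
    = \<chi> (dst s) - \<chi> (src s)"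
proof -
  have "dst s \<in> v ` {..g}" "src s \<in> v ` {..g}"
    using edge_vertex[OF assms] mem_edge[OF assms] by blast+
  then show ?thesis
    using potential_diff[of "num (dst s)" \<chi>] potential_diff[of "num (src s)" \<chi>] v_num
    by (simp add: cut_matrix_def left_diff_distrib sum_subtractf)
qed

lemma tree_edge_inj: "inj_on tree_edge {..<g}"
proof (rule inj_onI)
  fix i j assume "i \<in> {..<g}" "j \<in> {..<g}" "tree_edge i = tree_edge j"
  then show "i = j"
    using cut_matrix_tree_edge[of i i] cut_matrix_tree_edge[of j i] by (auto split: if_splits)
qed

lemma standard_form_cut_matrix: "standard_form g E cut_matrix"
  unfolding standard_form_def
proof (intro exI conjI allI impI)
  show "tree_edge ` {..<g} \<subseteq> E" using tree_edge_E by auto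
  show "inj_on tree_edge {..<g}" by (rule tree_edge_inj)
qed (simp add: cut_matrix_tree_edge)

text \<open>The coefficients form an integral chain on F with boundary y - x, collecting one signed
  edge for each step of the walk.\<close>

lemma walk_combination:
  assumes "(x, y) \<in> {(x, y). {x, y} \<in> F}\<^sup>*" "F \<subseteq> E"
  shows "\<exists>c :: 'v set \<Rightarrow> int. \<forall>\<chi> :: 'v \<Rightarrow> int. \<chi> y - \<chi> x = (\<Sum>s\<in>F. c s * (\<chi> (dst s) - \<chi> (src s)))"
  using assms(1)
proof (induction rule: rtrancl_induct)
  case base
  show ?case by (rule exI[of _ "\<lambda>_. 0"]) simp
next
  case (step y z)
  then obtain c :: "'v set \<Rightarrow> int" where
    c: "\<And>\<chi> :: 'v \<Rightarrow> int. \<chi> y - \<chi> x = (\<Sum>s\<in>F. c s * (\<chi> (dst s) - \<chi> (src s)))" by auto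
  define t where "t = {y, z}"
  have t: "t \<in> F" "t \<in> E" using step assms(2) by (auto simp: t_def)
  have "finite F" using finite_E assms(2) finite_subset by auto
  define e :: int where "e = (if dst t = z then 1 else -1)"
  have "\<chi> z = \<chi> y + e * (\<chi> (dst t) - \<chi> (src t))" for \<chi> :: "'v \<Rightarrow> int"
    using edge_pair[of y z] t(2) by (auto simp: e_def t_def)
  moreover have "(\<Sum>s\<in>F. (c s + (if s = t then e else 0)) * d s) = (\<Sum>s\<in>F. c s * d s) + e * d t" for d
    using t \<open>finite F\<close> by (simp add: distrib_right sum.distrib if_distrib[of "\<lambda>x. x * _"] cong: if_cong)
  ultimately show ?case
    by (intro exI[of _ "\<lambda>s. c s + (if s = t then e else 0)"] allI) (simp flip: c)
qed

text \<open>A nonsingular square submatrix M is shown to have an integral inverse, which forces its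
  determinant to be 1 or -1. Column j of the inverse has to express the unit vector of row
  \<open>r j\<close>, which is the column of a tree edge, through the chosen columns; a walk between
  the ends of that tree edge supplies integer coefficients.\<close>

lemma totally_unimodular_cut_matrix: "totally_unimodular g E cut_matrix"
  unfolding totally_unimodular_def
proof (intro allI impI)
  fix k and r :: "nat \<Rightarrow> nat" and c
  assume r: "r ` {..<k} \<subseteq> {..<g}" "inj_on r {..<k}" and c: "c ` {..<k} \<subseteq> E" "inj_on c {..<k}"
  define M where "M = mat k k (\<lambda>(i, j). cut_matrix (r i) (c j))"
  have M: "M \<in> carrier_mat k k" by (simp add: M_def)
  \<comment> \<open>The columns of the tree edges with unselected rows vanish on the selected rows,
    so walks may use these edges freely.\<close>
  define F where "F = c ` {..<k} \<union> tree_edge ` ({..<g} - r ` {..<k})"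
  have F: "F \<subseteq> E" using c tree_edge_E by (auto simp: F_def)
  then have finF: "finite F" using finite_E finite_subset by auto
  have "\<exists>Y\<in>carrier_mat k k. M * Y = 1\<^sub>m k" if det: "det M \<noteq> 0"
  proof -
    have "\<exists>x. \<forall>i<k. (\<Sum>t<k. cut_matrix (r i) (c t) * x t) = (if i = j then 1 else 0)" if j: "j < k" for j
    proof -
      let ?R = "{(x, y). {x, y} \<in> F}\<^sup>*" and ?e = "tree_edge (r j)"
      have rj: "r j < g" using r j by auto
      have "(src ?e, dst ?e) \<in> ?R"
      proof (rule ccontr)
        assume n: "(src ?e, dst ?e) \<notin> ?R"
        \<comment> \<open>The indicator of the component of \<open>src ?e\<close> is constant along
          F, so its differences on the selected tree edges form a vector in the left kernel of M.
          Its entry at j is nonzero if the ends of \<open>?e\<close> are not connected.\<close>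
        define \<chi> :: "'v \<Rightarrow> int" where "\<chi> x = of_bool ((src ?e, x) \<in> ?R)" for x
        define a where "a i = \<chi> (dst (tree_edge i)) - \<chi> (src (tree_edge i))" for i
        have F0: "\<chi> (dst s) - \<chi> (src s) = 0" if "s \<in> F" for s
        proof -
          have "s = {dst s, src s}" using edge_eq that F by (simp add: subset_iff)
          then have "{dst s, src s} \<in> F" "{src s, dst s} \<in> F"
            using that by (metis insert_commute)+
          then have "(src ?e, dst s) \<in> ?R \<longleftrightarrow> (src ?e, src s) \<in> ?R"
            by (auto intro: rtrancl_into_rtrancl)
          then show ?thesis by (simp add: \<chi>_def)
        qed
        have "(\<Sum>t<k. cut_matrix (r t) (c u) * a (r t)) = 0" if u: "u < k" for u
        proof -
          have cu: "c u \<in> F" "c u \<in> E" using u c by (auto simp: F_def)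
          have "(\<Sum>t<k. cut_matrix (r t) (c u) * a (r t)) = (\<Sum>i\<in>r ` {..<k}. cut_matrix i (c u) * a i)"
            by (simp add: sum.reindex[OF r(2)])
          also have "\<dots> = (\<Sum>i<g. cut_matrix i (c u) * a i)"
            by (rule sum.mono_neutral_left) (use r F0 in \<open>auto simp: F_def a_def\<close>)
          also have "\<dots> = 0"
            using cut_matrix_diff[OF cu(2), of \<chi>] F0[OF cu(1)] by (simp add: a_def)
          finally show ?thesis .
        qed
        then have "transpose_mat M *\<^sub>v vec k (\<lambda>t. a (r t)) = 0\<^sub>v k"
          by (intro eq_vecI) (auto simp: M_def scalar_prod_def atLeast0LessThan)
        moreover have "vec k (\<lambda>t. a (r t)) \<noteq> 0\<^sub>v k"
        proof
          assume "vec k (\<lambda>t. a (r t)) = 0\<^sub>v k"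
          then have "vec k (\<lambda>t. a (r t)) $ j = 0" using j by simp
          then show False using j n by (simp add: a_def \<chi>_def)
        qed
        ultimately have "det (transpose_mat M) = 0"
          using det_0_iff_vec_prod_zero[of "transpose_mat M" k] M
          by (metis transpose_carrier_mat vec_carrier)
        then show False using det det_transpose[OF M] by simp
      qed
      then obtain y :: "'v set \<Rightarrow> int" where
        y: "\<And>\<chi> :: 'v \<Rightarrow> int. \<chi> (dst ?e) - \<chi> (src ?e) = (\<Sum>s\<in>F. y s * (\<chi> (dst s) - \<chi> (src s)))"
        using walk_combination[OF _ F] by blast
      have "(\<Sum>t<k. cut_matrix (r i) (c t) * y (c t)) = (if i = j then 1 else 0)" if i: "i < k" for i
      proof -
        have "(\<Sum>t<k. cut_matrix (r i) (c t) * y (c t)) = (\<Sum>s\<in>c ` {..<k}. y s * cut_matrix (r i) s)"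
          by (simp add: sum.reindex[OF c(2)] mult.commute)
        also have "\<dots> = (\<Sum>s\<in>F. y s * cut_matrix (r i) s)"
          by (rule sum.mono_neutral_left) (use finF i in \<open>auto simp: F_def cut_matrix_tree_edge
              split: if_splits\<close>)
        also have "\<dots> = cut_matrix (r i) ?e"
          using y[of "\<lambda>x. pot (num x) (r i)"] by (simp add: cut_matrix_def)
        also have "\<dots> = (if i = j then 1 else 0)"
          using cut_matrix_tree_edge[OF rj, of "r i"] r i j by (auto simp: inj_on_def)
        finally show ?thesis .
      qed
      then show ?thesis by (intro exI[of _ "\<lambda>t. y (c t)"]) auto
    qed
    then obtain x where x: "\<And>i j. i < k \<Longrightarrow> j < k \<Longrightarrow>
        (\<Sum>t<k. cut_matrix (r i) (c t) * x j t) = (if i = j then 1 else 0)" by metis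
    show ?thesis
      by (rule bexI[of _ "mat k k (\<lambda>(t, j). x j t)"])
        (auto intro!: eq_matI simp: M_def scalar_prod_def atLeast0LessThan x)
  qed
  then have "det M \<noteq> 0 \<Longrightarrow> \<exists>d. det M * d = 1"
    using det_mult[OF M] by (metis det_one)
  then show "det M \<in> {-1, 0, 1}"
    by (auto simp: zmult_eq_1_iff)
qed

text \<open>Relations between the columns of J are the rational circulations supported on J: pairing
  to 0 with every \<chi> means that the net flow at each vertex vanishes.\<close>

lemma columns_independent_cut_matrix:
  assumes "J \<subseteq> E"
  shows "columns_independent g cut_matrix J \<longleftrightarrow>
    (\<forall>c. (\<forall>\<chi> :: 'v \<Rightarrow> rat. (\<Sum>s\<in>J. c s * (\<chi> (dst s) - \<chi> (src s))) = 0) \<longrightarrow> (\<forall>s\<in>J. c s = 0))"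
proof -
  have "(\<forall>i<g. (\<Sum>s\<in>J. c s * of_int (cut_matrix i s)) = 0) \<longleftrightarrow>
    (\<forall>\<chi> :: 'v \<Rightarrow> rat. (\<Sum>s\<in>J. c s * (\<chi> (dst s) - \<chi> (src s))) = 0)" (is "?l = ?r") for c :: "'v set \<Rightarrow> rat"
  proof
    assume l: ?l
    show ?r
    proof
      fix \<chi> :: "'v \<Rightarrow> rat"
      define D where "D i = \<chi> (dst (tree_edge i)) - \<chi> (src (tree_edge i))" for i
      have "(\<Sum>s\<in>J. c s * (\<chi> (dst s) - \<chi> (src s))) = (\<Sum>s\<in>J. \<Sum>i<g. c s * (of_int (cut_matrix i s) * D i))"
        using assms by (intro sum.cong) (auto simp: D_def sum_distrib_left[symmetric]
            cut_matrix_diff subset_iff)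
      also have "\<dots> = (\<Sum>i<g. (\<Sum>s\<in>J. c s * of_int (cut_matrix i s)) * D i)"
        by (subst sum.swap) (simp add: sum_distrib_right mult.assoc)
      also have "\<dots> = 0" using l by simp
      finally show "(\<Sum>s\<in>J. c s * (\<chi> (dst s) - \<chi> (src s))) = 0" .
    qed
  next
    assume r: ?r
    show ?l
    proof (intro allI impI)
      fix i assume "i < g"
      show "(\<Sum>s\<in>J. c s * of_int (cut_matrix i s)) = 0"
        using r[rule_format, of "\<lambda>x. of_int (pot (num x) i)"] by (simp add: cut_matrix_def)
    qed
  qed
  then show ?thesis by (simp add: columns_independent_def)
qed

text \<open>Going once around the cycle, with signs for the orientations, gives a
  circulation.\<close>

lemma cycle_dependent:
  assumes "J \<subseteq> E" "is_cycle J vs"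
  shows "\<not> columns_independent g cut_matrix J"
proof -
  define n where "n = length vs"
  define e where "e i = {vs ! i, vs ! (Suc i mod n)}" for i
  define \<sigma> :: "nat \<Rightarrow> rat" where "\<sigma> i = (if dst (e i) = vs ! (Suc i mod n) then 1 else -1)" for i
  define c where "c s = (\<Sum>i<n. if s = e i then \<sigma> i else 0)" for s
  have n: "n \<ge> 3" and d: "distinct vs" and eJ: "\<And>i. i < n \<Longrightarrow> e i \<in> J"
    using assms(2) by (auto simp: is_cycle_def n_def e_def)
  have vs: "vs \<noteq> []" using n by (auto simp: n_def)
  have finJ: "finite J" using assms(1) finite_E finite_subset by auto
  have "(\<Sum>s\<in>J. c s * (\<chi> (dst s) - \<chi> (src s))) = 0" for \<chi> :: "'v \<Rightarrow> rat"
  proof -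
    have "(\<Sum>s\<in>J. c s * (\<chi> (dst s) - \<chi> (src s)))
        = (\<Sum>i<n. \<Sum>s\<in>J. (if s = e i then \<sigma> i else 0) * (\<chi> (dst s) - \<chi> (src s)))"
      unfolding c_def sum_distrib_right by (rule sum.swap)
    also have "\<dots> = (\<Sum>i<n. \<sigma> i * (\<chi> (dst (e i)) - \<chi> (src (e i))))"
      using finJ eJ by (intro sum.cong) (auto simp: if_distrib[of "\<lambda>x. x * _"] cong: if_cong)
    also have "\<dots> = (\<Sum>i<n. \<chi> (vs ! (Suc i mod n)) - \<chi> (vs ! i))"
    proof (intro sum.cong refl)
      fix i assume "i \<in> {..<n}"
      then have "e i \<in> E" using eJ assms(1) by auto
      then show "\<sigma> i * (\<chi> (dst (e i)) - \<chi> (src (e i))) = \<chi> (vs ! (Suc i mod n)) - \<chi> (vs ! i)"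
        using edge_pair[of "vs ! i" "vs ! (Suc i mod n)"] unfolding \<sigma>_def by (auto simp: e_def)
    qed
    also have "\<dots> = 0"
    proof -
      obtain m where m: "n = Suc m" using n by (cases n) auto
      have "(\<Sum>i<n. \<chi> (vs ! (Suc i mod n))) = (\<Sum>i<m. \<chi> (vs ! Suc i)) + \<chi> (vs ! 0)"
        unfolding m by (simp)
      also have "\<dots> = (\<Sum>i<n. \<chi> (vs ! i))"
        unfolding m by (simp only: sum.lessThan_Suc_shift add.commute)
      finally show ?thesis by (simp add: sum_subtractf)
    qed
    finally show ?thesis .
  qed
  moreover have "c (e 0) \<noteq> 0"
  proof -
    \<comment> \<open>No cancellation can occur at \<open>e 0\<close>: another occurrence would have
      to be the next edge, traversed backwards, so the closed walk would have length 2, which n >= 3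
      excludes.\<close>
    have ne: "e i \<noteq> e 0" if "i < n" "i \<noteq> 0" for i
    proof
      assume "e i = e 0"
      moreover have "vs ! i \<noteq> vs ! 0"
        using that d n nth_eq_iff_index_eq[of vs i 0] by (cases vs) (auto simp: n_def)
      ultimately have "vs ! i = vs ! (Suc 0 mod n) \<and> vs ! (Suc i mod n) = vs ! 0"
        unfolding e_def doubleton_eq_iff by blast
      moreover have "Suc 0 mod n < length vs" "Suc i mod n < length vs" "0 < length vs" "i < length vs"
        using vs that(1) by (simp_all add: n_def)
      ultimately have "i = Suc 0 mod n" "Suc i mod n = 0"
        using nth_eq_iff_index_eq[OF d] by blast+
      moreover have "Suc 0 mod n = Suc 0" using n by (intro mod_less) linarith
      moreover have "Suc (Suc 0) mod n = Suc (Suc 0)" using n by (intro mod_less) linarith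
      ultimately show False by simp
    qed
    have "c (e 0) = (\<Sum>i\<in>{0}. if e 0 = e i then \<sigma> i else 0)"
      unfolding c_def
    proof (rule sum.mono_neutral_right)
      show "{0} \<subseteq> {..<n}" using n by simp
      show "\<forall>i\<in>{..<n} - {0}. (if e 0 = e i then \<sigma> i else 0) = 0"
      proof
        fix i assume "i \<in> {..<n} - {0}"
        then have "e 0 \<noteq> e i" using ne[of i] by simp
        then show "(if e 0 = e i then \<sigma> i else 0) = 0" by (rule if_not_P)
      qed
    qed simp
    then show ?thesis by (simp add: \<sigma>_def)
  qed
  ultimately show ?thesis
    using eJ[of 0] n unfolding columns_independent_cut_matrix[OF assms(1)] by (auto intro!: exI[of _ c])
qed

text \<open>The support K of a nonzero circulation has no vertex of degree 1. So the first vertex of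
  a longest path in K has a second edge in K; by maximality this edge leads back to the path and
  closes a cycle.\<close>

lemma dependent_cycle:
  assumes "J \<subseteq> E" "\<not> columns_independent g cut_matrix J"
  shows "\<exists>vs. is_cycle J vs"
proof -
  obtain c :: "'v set \<Rightarrow> rat" and s0 where
    c: "\<And>\<chi> :: 'v \<Rightarrow> rat. (\<Sum>s\<in>J. c s * (\<chi> (dst s) - \<chi> (src s))) = 0" and s0: "s0 \<in> J" "c s0 \<noteq> 0"
    using assms unfolding columns_independent_cut_matrix[OF assms(1)] by blast
  define K where "K = {s \<in> J. c s \<noteq> 0}"
  have KE: "K \<subseteq> E" using assms(1) by (auto simp: K_def)
  have finJ: "finite J" using assms(1) finite_E finite_subset by auto
  have other: "\<exists>t\<in>K. x \<in> t \<and> t \<noteq> s" if s: "s \<in> K" "x \<in> s" for s x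
  proof (rule ccontr)
    assume n: "\<not> ?thesis"
    \<comment> \<open>The net flow at x would consist of the single nonzero contribution of
      s.\<close>
    define \<chi> :: "'v \<Rightarrow> rat" where "\<chi> y = of_bool (y = x)" for y
    have "(\<Sum>t\<in>J. c t * (\<chi> (dst t) - \<chi> (src t))) = (\<Sum>t\<in>{s}. c t * (\<chi> (dst t) - \<chi> (src t)))"
    proof (rule sum.mono_neutral_right[OF finJ])
      show "{s} \<subseteq> J" using s by (auto simp: K_def)
      show "\<forall>t\<in>J - {s}. c t * (\<chi> (dst t) - \<chi> (src t)) = 0"
      proof
        fix t assume t: "t \<in> J - {s}"
        show "c t * (\<chi> (dst t) - \<chi> (src t)) = 0"
        proof (cases "c t = 0")
          case False
          then have "x \<notin> t" using t n by (auto simp: K_def)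
          then show ?thesis using mem_edge[of t x] t assms(1) by (auto simp: \<chi>_def)
        qed simp
      qed
    qed
    then have "c s * (\<chi> (dst s) - \<chi> (src s)) = 0" using c by simp
    moreover have "\<chi> (dst s) - \<chi> (src s) \<noteq> 0"
      using mem_edge[of s x] dst_neq_src[of s] s KE by (auto simp: \<chi>_def)
    ultimately show False using s by (simp add: K_def)
  qed
  define path where "path xs \<longleftrightarrow> length xs \<ge> 2 \<and> distinct xs \<and>
    (\<forall>i. Suc i < length xs \<longrightarrow> {xs ! i, xs ! Suc i} \<in> K)" for xs
  have s0K: "s0 \<in> K" using s0 by (simp add: K_def)
  then have s0E: "s0 \<in> E" using KE by auto
  have "{dst s0, src s0} \<in> K"
    by (subst edge_eq[OF s0E, symmetric]) (rule s0K)
  then have "path [dst s0, src s0]"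
    using dst_neq_src[OF s0E] unfolding path_def by (simp add: less_Suc_eq)
  moreover have "length xs < Suc (Suc g)" if "path xs" for xs
  proof -
    have "x \<in> v ` {..g}" if x: "x \<in> set xs" for x
    proof -
      obtain i where i: "i < length xs" "x = xs ! i" using x by (auto simp: in_set_conv_nth)
      have "\<exists>s\<in>K. x \<in> s"
      proof (cases "Suc i < length xs")
        case True
        then show ?thesis using \<open>path xs\<close> i by (auto simp: path_def)
      next
        case False
        then obtain j where "i = Suc j" using i \<open>path xs\<close> by (cases i) (auto simp: path_def)
        then show ?thesis using \<open>path xs\<close> i by (auto simp: path_def)
      qed
      then show ?thesis using edge_vertex KE by blast
    qed
    then have "card (set xs) \<le> card (v ` {..g})" by (intro card_mono) auto
    also have "\<dots> \<le> Suc g" using card_image_le[of "{..g}" v] by simp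
    finally show ?thesis using \<open>path xs\<close> by (simp add: path_def distinct_card less_Suc_eq_le)
  qed
  ultimately obtain xs where xs: "path xs" and max: "\<And>ys. path ys \<Longrightarrow> length ys \<le> length xs"
    using ex_has_greatest_nat[of path "[dst s0, src s0]" length "Suc (Suc g)"]
    by blast
  have len: "length xs \<ge> 2" and dist: "distinct xs"
    and step: "\<And>i. Suc i < length xs \<Longrightarrow> {xs ! i, xs ! Suc i} \<in> K"
    using xs by (auto simp: path_def)
  obtain t where t: "t \<in> K" "xs ! 0 \<in> t" "t \<noteq> {xs ! 0, xs ! Suc 0}"
    using other[of "{xs ! 0, xs ! Suc 0}" "xs ! 0"] step[of 0] len by auto
  then have tE: "t \<in> E" using KE by auto
  then consider "xs ! 0 = dst t" | "xs ! 0 = src t" using t(2) mem_edge by auto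
  then have "\<exists>w. t = {xs ! 0, w} \<and> w \<noteq> xs ! 0"
  proof cases
    case 1
    show ?thesis unfolding 1
      by (rule exI, rule conjI, rule edge_eq[OF tE], rule dst_neq_src[OF tE, symmetric])
  next
    case 2
    show ?thesis unfolding 2
      by (rule exI, rule conjI, rule trans[OF edge_eq[OF tE] insert_commute], rule dst_neq_src[OF tE])
  qed
  then obtain w where w: "t = {xs ! 0, w}" "w \<noteq> xs ! 0" by blast
  then have w': "w \<noteq> xs ! Suc 0" using t(3) by auto
  have "w \<in> set xs"
  proof (rule ccontr)
    assume "w \<notin> set xs"
    then have "path (w # xs)"
      using len dist step t(1) w(1) unfolding path_def
      by (auto simp: nth_Cons insert_commute split: nat.splits)
    then show False using max by fastforce
  qed
  then obtain m where m: "m < length xs" "w = xs ! m" by (auto simp: in_set_conv_nth)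
  \<comment> \<open>Position 0 is excluded because t is not a loop, position 1 because t is not the
    first edge of the path; so the cycle has at least three vertices.\<close>
  have "m \<noteq> 0" "m \<noteq> Suc 0" using w(2) w' m(2) by metis+
  then have m2: "m \<ge> 2" by simp
  have "is_cycle J (take (Suc m) xs)"
    unfolding is_cycle_def
  proof (intro conjI allI impI)
    show "3 \<le> length (take (Suc m) xs)" using m m2 by simp
    show "distinct (take (Suc m) xs)" using dist by simp
    fix i assume i: "i < length (take (Suc m) xs)"
    show "{take (Suc m) xs ! i, take (Suc m) xs ! (Suc i mod length (take (Suc m) xs))} \<in> J"
    proof (cases "i = m")
      case True
      then show ?thesis using m t(1) w(1) by (auto simp: K_def insert_commute)
    next
      case False
      then show ?thesis using i m step[of i] by (auto simp: K_def)
    qed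
  qed
  then show ?thesis by blast
qed

theorem TU_realization_cycle_matroid: "TU_realization g cut_matrix (cycle_matroid (V, E))"
proof -
  have "columns_independent g cut_matrix F \<longleftrightarrow> (\<nexists>vs. is_cycle F vs)" if "F \<subseteq> E" for F
    using cycle_dependent[OF that] dependent_cycle[OF that] by blast
  then have "realizes g cut_matrix (cycle_matroid (V, E))"
    by (auto simp: cycle_matroid_def realizes_def)
  then show ?thesis
    using totally_unimodular_cut_matrix standard_form_cut_matrix
    by (simp add: TU_realization_def cycle_matroid_def)
qed

theorem regular_cycle_matroid: "regular_matroid (cycle_matroid (V, E))"
  using TU_realization_cycle_matroid[of V] realizes_is_matroid[of E g cut_matrix] finite_E
  by (auto simp: regular_matroid_def TU_realization_def cycle_matroid_def)

end

section \<open>Truncated exponentials in characteristic 5\<close>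

text \<open>
  In characteristic 5 the coefficients \<open>1/2\<close>, \<open>1/6\<close>, \<open>1/24\<close> of the exponential series are
  \<open>3\<close>, \<open>1\<close>, \<open>4\<close>.
\<close>

definition texp :: "'a::comm_ring_1 \<Rightarrow> 'a" where
  "texp a = 1 + a + 3 * a^2 + a^3 + 4 * a^4"

lemma texp_0 [simp]: "texp 0 = 1"
  by (simp add: texp_def)

lemma frobenius5:
  fixes a b :: "'a::comm_ring_1"
  assumes "(5::'a) = 0"
  shows "(a + b)^5 = a^5 + b^5"
proof -
  have "(a + b)^5 = a^5 + b^5 + 5 * (a^4*b + 2*a^3*b^2 + 2*a^2*b^3 + a*b^4)"
    by (simp add: algebra_simps power_numeral_reduce)
  then show ?thesis using assms by simp
qed

text \<open>With a common factor w, all terms of degree at least 5 in the two arguments are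
  divisible by w^5, so no carry survives; the terms of lower degree agree modulo 5.\<close>

lemma texp_scale_add:
  fixes w a b :: "'a::comm_ring_1"
  assumes five: "(5::'a) = 0" and "w^5 = 0"
  shows "texp (w * a) * texp (w * b) = texp (w * (a + b))"
proof -
  have "texp (w * a) * texp (w * b) - texp (w * (a + b)) =
     5 * (-(w*a*(w*b)) - 3*((w*a)^3*(w*b) + (w*a)^2*(w*b)^2 + (w*a)*(w*b)^3))
     + w^5 * (4*a^4*b + 3*a^3*b^2 + 3*a^2*b^3 + 4*a*b^4
        + w*(12*a^4*b^2 + a^3*b^3 + 12*a^2*b^4) + w^2*(4*a^4*b^3 + 4*a^3*b^4)
        + 16*w^3*a^4*b^4)"
    unfolding texp_def by (simp add: algebra_simps power_numeral_reduce)
  then show ?thesis using assms by simp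
qed

text \<open>
  The last factor is the exponential of the first Witt carry
  \<open>(a\<^sup>5 + b\<^sup>5 - (a + b)\<^sup>5) / 5\<close>; its powers vanish because \<open>a\<^sup>5 = b\<^sup>5 = 0\<close>.
\<close>

lemma texp_mult_carry:
  fixes a b :: "'a::comm_ring_1"
  assumes five: "(5::'a) = 0" and a5: "a^5 = 0" and b5: "b^5 = 0"
  shows "texp a * texp b = texp (a + b) *
    (texp (- (a^4 * b)) * texp (- (2 * (a^3 * b^2))) * texp (- (2 * (a^2 * b^3))) * texp (- (a * b^4)))"
proof -
  \<comment> \<open>The carry is split into its four monomials, each of which becomes a product of
    linear forms in \<open>prod_texp_lin\<close> and is then handled by
    \<open>mexp_prod_lin'\<close>.\<close>
  define w1 w2 w3 w4 where w: "w1 = - (a^4 * b)" "w2 = - (2 * (a^3 * b^2))"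
    "w3 = - (2 * (a^2 * b^3))" "w4 = - (a * b^4)"
  have ab: "a^i * b^j = 0" if "i \<ge> 5 \<or> j \<ge> 5" for i j
  proof -
    have "a^i = 0 \<or> b^j = 0"
      using that a5 b5 by (metis le_iff_add mult_zero_left power_add)
    then show ?thesis by auto
  qed
  \<comment> \<open>A product of two carry monomials has degree 10 in a and b, so one of the
    exponents is at least 5.\<close>
  have sq: "w1 * w1 = 0" "w2 * w2 = 0" "w3 * w3 = 0" "w4 * w4 = 0"
    and pr: "w1 * w2 = 0" "w1 * w3 = 0" "w1 * w4 = 0" "w2 * w3 = 0" "w2 * w4 = 0" "w3 * w4 = 0"
  proof -
    have "w1 * w1 = a^8 * b^2" "w2 * w2 = 4 * (a^6 * b^4)" "w3 * w3 = 4 * (a^4 * b^6)"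
      "w4 * w4 = a^2 * b^8" "w1 * w2 = 2 * (a^7 * b^3)" "w1 * w3 = 2 * (a^6 * b^4)"
      "w1 * w4 = a^5 * b^5" "w2 * w3 = 4 * (a^5 * b^5)" "w2 * w4 = 2 * (a^4 * b^6)"
      "w3 * w4 = 2 * (a^3 * b^7)"
      unfolding w by (simp_all add: algebra_simps power_numeral_reduce)
    then show "w1 * w1 = 0" "w2 * w2 = 0" "w3 * w3 = 0" "w4 * w4 = 0"
      "w1 * w2 = 0" "w1 * w3 = 0" "w1 * w4 = 0" "w2 * w3 = 0" "w2 * w4 = 0" "w3 * w4 = 0"
      by (simp_all add: ab)
  qed
  have t: "texp v = 1 + v" if "v * v = 0" for v :: 'a
  proof -
    have "texp v = 1 + v + v * v * (3 + v + 4 * (v * v))"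
      unfolding texp_def by (simp add: algebra_simps power_numeral_reduce)
    then show ?thesis using that by simp
  qed
  have "(1 + w1) * (1 + w2) * (1 + w3) * (1 + w4) = 1 + w1 + w2 + w3 + w4
     + w1*w2 * (1 + w3) * (1 + w4) + w1*w3 * (1 + w4) + w2*w3 * (1 + w4) + w1*w4 + w2*w4 + w3*w4"
    by (simp add: algebra_simps power_numeral_reduce)
  then have P: "texp w1 * texp w2 * texp w3 * texp w4 = 1 + w1 + w2 + w3 + w4"
    by (simp add: t sq pr)
  have "texp a * texp b - texp (a + b) * (1 + w1 + w2 + w3 + w4) =
     5 * ((-1)*a*b + (-3)*a*b^3 + a*b^4 + (-3)*a^2*b^2 + a^2*b^3 + 3*a^2*b^4 + (-3)*a^3*b + a^3*b^2
       + a^3*b^3 + 5*a^3*b^4 + a^4*b + 3*a^4*b^2 + 5*a^4*b^3 + 6*a^4*b^4)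
     + a^5 * (b + 12*b^2 + 11*b^3 + 100*b^4 + 3*a*b + 5*a*b^2 + 64*a*b^3 + a^2*b + 24*a^2*b^2 + 4*a^3*b)
     + b^5 * (a + 3*a*b + a*b^2 + 4*a*b^3 + 12*a^2 + 5*a^2*b + 24*a^2*b^2 + 11*a^3 + 64*a^3*b + 100*a^4)"
    unfolding texp_def w by (simp add: algebra_simps power_numeral_reduce)
  then have "texp a * texp b = texp (a + b) * (1 + w1 + w2 + w3 + w4)"
    using assms by simp
  then show ?thesis unfolding P[symmetric] unfolding w .
qed

text \<open>The model is F_5[y_1, ..., y_b] / (y_i^5) with \<open>top\<close> the product of all
  y_i^4, which spans the socle. Multiplying by \<open>top\<close> reads off constant terms. The set
  \<open>nilp\<close> below stands for the augmentation ideal through the two properties that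
  matter: vanishing fifth powers and annihilation of \<open>top\<close>.\<close>

locale truncated =
  fixes y :: "nat \<Rightarrow> 'a::comm_ring_1" and top :: 'a
  assumes five: "(5::'a) = 0" and y5: "y i ^ 5 = 0" and y_top: "y i * top = 0"
begin

definition nilp :: "'a set" where
  "nilp = {n. n^5 = 0 \<and> n * top = 0}"

lemma nilp_0 [simp]: "0 \<in> nilp"
  by (simp add: nilp_def)

lemma nilp_y [simp]: "y i \<in> nilp"
  by (simp add: nilp_def y5 y_top)

lemma nilp_add: "m \<in> nilp \<Longrightarrow> n \<in> nilp \<Longrightarrow> m + n \<in> nilp"
  by (simp add: nilp_def frobenius5[OF five] distrib_right)

lemma nilp_mult: "n \<in> nilp \<Longrightarrow> r * n \<in> nilp"
  by (simp add: nilp_def power_mult_distrib mult.assoc)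

lemma nilp_mult2: "n \<in> nilp \<Longrightarrow> n * r \<in> nilp"
  using nilp_mult[of n r] by (simp add: mult.commute)

definition mono :: "nat multiset \<Rightarrow> 'a" where
  "mono M = \<Prod>\<^sub># (image_mset y M)"

lemma mono_simps: "mono {#} = 1" "mono (add_mset i M) = y i * mono M"
  by (simp_all add: mono_def)

lemma mono_nil: "M \<noteq> {#} \<Longrightarrow> mono M \<in> nilp"
  by (cases M) (simp_all add: mono_simps nilp_mult2)

text \<open>
  A single truncated exponential is not multiplicative on sums of monomials, but the product of
  the exponentials of the separate terms is a homomorphism from the additive group of integer
  polynomials: two terms with the same monomial \<open>m\<close> only involve powers \<open>m\<^sup>k\<close> with \<open>k < 5\<close>.
  A polynomial is an element of the monoid ring of the multisets; its constant term is ignored.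
\<close>

definition mexp :: "(nat multiset \<Rightarrow>\<^sub>0 int) \<Rightarrow> 'a" where
  "mexp T = (\<Prod>M\<in>Poly_Mapping.keys T - {{#}}. texp (of_int (Poly_Mapping.lookup T M) * mono M))"

lemma mexp_superset:
  assumes "finite K" "Poly_Mapping.keys T \<subseteq> K"
  shows "mexp T = (\<Prod>M\<in>K - {{#}}. texp (of_int (Poly_Mapping.lookup T M) * mono M))"
  unfolding mexp_def
  by (rule prod.mono_neutral_left) (use assms in \<open>auto simp: in_keys_iff\<close>)

lemma mexp_add: "mexp (S + T) = mexp S * mexp T"
proof -
  let ?K = "Poly_Mapping.keys S \<union> Poly_Mapping.keys T"
  have "mexp S * mexp T = (\<Prod>M\<in>?K - {{#}}. texp (of_int (Poly_Mapping.lookup S M) * mono M) * texp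
      (of_int (Poly_Mapping.lookup T M) * mono M))"
    by (simp add: mexp_superset[of ?K] prod.distrib)
  also have "\<dots> = (\<Prod>M\<in>?K - {{#}}. texp (of_int (Poly_Mapping.lookup (S + T) M) * mono M))"
  proof (rule prod.cong)
    fix M assume "M \<in> ?K - {{#}}"
    then have "mono M ^ 5 = 0"
      using mono_nil by (auto simp: nilp_def)
    then show "texp (of_int (Poly_Mapping.lookup S M) * mono M) * texp (of_int (Poly_Mapping.lookup
        T M) * mono M)
        = texp (of_int (Poly_Mapping.lookup (S + T) M) * mono M)"
      using texp_scale_add[OF five, of "mono M" "of_int (Poly_Mapping.lookup S M)" "of_int
          (Poly_Mapping.lookup T M)"]
      by (simp add: lookup_add mult.commute)
  qed simp
  also have "\<dots> = mexp (S + T)"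
    using Poly_Mapping.keys_add[of S T] by (intro mexp_superset[symmetric]) auto
  finally show ?thesis ..
qed

lemma mexp_0 [simp]: "mexp 0 = 1"
  by (simp add: mexp_def)

lemma mexp_single: "M \<noteq> {#} \<Longrightarrow> mexp (Poly_Mapping.single M c) = texp (of_int c * mono M)"
  by (cases "c = 0") (auto simp: mexp_def)

text \<open>z is the value at y of the linear form l. The form is kept over the integers because the
  carries are obtained by dividing by 5, which the value in characteristic 5 does not allow.\<close>

inductive lin :: "(nat multiset \<Rightarrow>\<^sub>0 int) \<Rightarrow> 'a \<Rightarrow> bool" where
  lin_0: "lin 0 0"
| lin_step: "lin l z \<Longrightarrow> lin (l + Poly_Mapping.single {#i#} c) (z + of_int c * y i)"

lemma lin_add:
  assumes "lin l z" "lin l' z'"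
  shows "lin (l + l') (z + z')"
  using assms(2,1)
  by (induction) (auto simp flip: add.assoc intro: lin_step)

lemma lin_nil: "lin l z \<Longrightarrow> z \<in> nilp"
  by (induction rule: lin.induct) (auto intro!: nilp_add nilp_mult)

lemma lin_pow5: "lin l z \<Longrightarrow> z ^ 5 = 0"
  using lin_nil by (auto simp: nilp_def)

lemma lin_lookup: "lin l z \<Longrightarrow> Poly_Mapping.lookup l {#} = 0"
  by (induction rule: lin.induct) (auto simp: lookup_add lookup_single)

lemma lin_sum: "finite A \<Longrightarrow> (\<And>s. s \<in> A \<Longrightarrow> lin (l s) (z s)) \<Longrightarrow> lin (sum l A) (sum z A)"
  by (induction A rule: finite_induct) (auto intro: lin_0 lin_add)

lemma lin_single: "lin (Poly_Mapping.single {#i#} c) (of_int c * y i)"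
  using lin_step[OF lin_0, of i c] by simp

lemma lin_scale: "lin l z \<Longrightarrow> lin (of_int c * l) (of_int c * z)"
proof (induction rule: lin.induct)
  case (lin_step l z i d)
  have "Poly_Mapping.single {#i#} (c * d) = of_int c * Poly_Mapping.single {#i#} d"
    by (simp flip: single_of_int add: mult_single)
  then show ?case
    using lin_add[OF lin_step.IH lin_single[of i "c * d"]]
    by (simp add: algebra_simps)
qed (auto intro: lin_0)

lemma prod_list_pow5:
  "list_all2 lin ls zs \<Longrightarrow> ls \<noteq> [] \<Longrightarrow> prod_list zs ^ 5 = 0"
  by (cases ls; cases zs) (auto simp: power_mult_distrib lin_pow5)

text \<open>The linear forms are expanded one at a time while the rest of the product, w, is the
  common factor in \<open>texp_scale_add\<close>. At least two factors are required so that
  something with w^5 = 0 remains; a single linear form would produce a carry.\<close>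

lemma mexp_prod_lin:
  assumes "list_all2 lin ls zs" "size M + length ls \<ge> 2"
  shows "mexp (Poly_Mapping.single M c * prod_list ls) = texp (of_int c * mono M * prod_list zs)"
  using assms
proof (induction ls arbitrary: M c zs)
  case Nil
  then have "M \<noteq> {#}" by auto
  with Nil show ?case by (simp add: mexp_single)
next
  case (Cons l ls)
  then obtain z zs' where zs: "zs = z # zs'" and l: "lin l z" and ls: "list_all2 lin ls zs'"
    by (auto simp: list_all2_Cons1)
  define w where "w = of_int c * mono M * prod_list zs'"
  have w5: "w ^ 5 = 0"
  proof (cases "M = {#}")
    case True
    then have "ls \<noteq> []" using Cons.prems by auto
    then show ?thesis
      using prod_list_pow5[OF ls] by (simp add: w_def power_mult_distrib)
  next
    case False
    then show ?thesis
      using mono_nil[OF False] by (simp add: w_def power_mult_distrib nilp_def)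
  qed
  have "mexp (Poly_Mapping.single M c * (l * prod_list ls)) = texp (w * z)"
    using l
  proof (induction rule: lin.induct)
    case lin_0
    then show ?case by simp
  next
    case (lin_step l z i d)
    have e: "Poly_Mapping.single M c * ((l + Poly_Mapping.single {#i#} d) * prod_list ls)
       = Poly_Mapping.single M c * (l * prod_list ls) + Poly_Mapping.single (M + {#i#}) (c * d) *
           prod_list ls"
      by (simp only: mult_single[symmetric]) (simp add: algebra_simps)
    have "mexp (Poly_Mapping.single (M + {#i#}) (c * d) * prod_list ls)
        = texp (of_int (c * d) * mono (M + {#i#}) * prod_list zs')"
      using Cons.prems by (intro Cons.IH ls) auto
    also have "of_int (c * d) * mono (M + {#i#}) * prod_list zs' = w * (of_int d * y i)"
      by (simp add: w_def mono_simps algebra_simps)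
    finally show ?case
      unfolding e mexp_add lin_step.IH
      using texp_scale_add[OF five w5] by simp
  qed
  then show ?case by (simp add: zs w_def algebra_simps)
qed

lemma mexp_prod_lin':
  assumes "list_all2 lin ls zs" "length ls \<ge> 2"
  shows "mexp (of_int c * prod_list ls) = texp (of_int c * prod_list zs)"
  using mexp_prod_lin[of ls zs "{#}" c] assms by (simp add: mono_simps flip: single_of_int)

text \<open>The carries of successive additions accumulate in P because \<open>mexp\<close> is a
  homomorphism. Specifying P through 5 * P hides its expansion: this multiple is a difference of
  fifth powers and determines P over the integers.\<close>

lemma prod_texp_lin:
  assumes "finite A" "\<And>s. s \<in> A \<Longrightarrow> lin (l s) (z s)"
  shows "\<exists>P. (\<Prod>s\<in>A. texp (z s)) = texp (\<Sum>s\<in>A. z s) * mexp P \<and>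
             5 * P = (\<Sum>s\<in>A. l s ^ 5) - (\<Sum>s\<in>A. l s) ^ 5"
  using assms
proof (induction A rule: finite_induct)
  case empty
  show ?case by (auto intro: exI[of _ 0])
next
  case (insert s A)
  then obtain P where P: "(\<Prod>s\<in>A. texp (z s)) = texp (\<Sum>s\<in>A. z s) * mexp P"
    "5 * P = (\<Sum>s\<in>A. l s ^ 5) - (\<Sum>s\<in>A. l s) ^ 5" by auto
  define L Z m b where d: "L = sum l A" "Z = sum z A" "m = l s" "b = z s"
  have L: "lin L Z" and m: "lin m b"
    unfolding d using insert by (auto intro: lin_sum)
  \<comment> \<open>The coefficients 1, 2, 2, 1 are the binomials (5 choose k) / 5 for k = 1, ...,
    4.\<close>
  define C where "C = (- (m^4 * L)) + (- (2 * (m^3 * L^2))) + (- (2 * (m^2 * L^3))) + (- (m * L^4))"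
  have "mexp (of_int (-1) * prod_list [m,m,m,m,L]) = texp (of_int (-1) * prod_list [b,b,b,b,Z])"
    "mexp (of_int (-2) * prod_list [m,m,m,L,L]) = texp (of_int (-2) * prod_list [b,b,b,Z,Z])"
    "mexp (of_int (-2) * prod_list [m,m,L,L,L]) = texp (of_int (-2) * prod_list [b,b,Z,Z,Z])"
    "mexp (of_int (-1) * prod_list [m,L,L,L,L]) = texp (of_int (-1) * prod_list [b,Z,Z,Z,Z])"
    using L m by (intro mexp_prod_lin'; simp)+
  then have C: "mexp C = texp (- (b^4 * Z)) * texp (- (2 * (b^3 * Z^2))) * texp (- (2 * (b^2 *
      Z^3))) * texp (- (b * Z^4))"
    unfolding C_def mexp_add by (simp add: power_numeral_reduce numeral_eq_Suc mult.assoc)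
  have "(\<Prod>s\<in>insert s A. texp (z s)) = texp b * texp Z * mexp P"
    using insert P by (simp add: d mult.assoc)
  also have "\<dots> = texp (b + Z) * mexp (C + P)"
    unfolding mexp_add C using texp_mult_carry[OF five lin_pow5[OF m] lin_pow5[OF L]] by (simp add:
        mult.assoc)
  finally have 1: "(\<Prod>s\<in>insert s A. texp (z s)) = texp (\<Sum>s\<in>insert s A. z s) * mexp (C + P)"
    using insert by (simp add: d)
  have "5 * C = m^5 + L^5 - (m + L)^5"
    unfolding C_def by (simp add: algebra_simps power_numeral_reduce)
  then have "5 * (C + P) = (\<Sum>s\<in>insert s A. l s ^ 5) - (\<Sum>s\<in>insert s A. l s) ^ 5"
    using insert P(2) by (simp add: d distrib_left)
  with 1 show ?case by blast
qed

section \<open>From integral corrections to multiplicative flows\<close>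

lemma one_plus_mult_nil:
  assumes "m \<in> nilp" "n \<in> nilp"
  shows "\<exists>k\<in>nilp. (1 + z * (a + m)) * (1 + z * (b + n)) = 1 + z * (a + b + (k + z * a * b))"
\<comment> \<open>The term \<open>z * a * b\<close> is kept apart, since z is not assumed to lie in
  \<open>nilp\<close>; callers absorb it where they know more.\<close>
proof (rule bexI)
  show "(1 + z * (a + m)) * (1 + z * (b + n)) =
      1 + z * (a + b + ((m + n + z * (a * n + b * m + m * n)) + z * a * b))"
    by (simp add: algebra_simps)
  show "m + n + z * (a * n + b * m + m * n) \<in> nilp"
    by (intro nilp_add nilp_mult assms)
qed

text \<open>Each monomial of g contributes a factor of the form 1 + z * n, since z divides its
  exponent. As g has no constant term, n is nilpotent, so the correction does not change the
  constant term of the cofactor of z.\<close>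

lemma mexp_lin_mult:
  assumes l: "lin l z" and g: "Poly_Mapping.lookup g {#} = 0"
  shows "\<exists>n\<in>nilp. mexp (l * g) = 1 + z * n"
proof -
  have *: "\<exists>n\<in>nilp. mexp (l * (\<Sum>M\<in>K. Poly_Mapping.single M (Poly_Mapping.lookup g M))) = 1 + z * n"
    if "finite K" "{#} \<notin> K" for K
    using that
  proof (induction K rule: finite_induct)
    case empty
    show ?case by (auto intro: bexI[of _ 0])
  next
    case (insert M K)
    then obtain n where n: "n \<in> nilp" "mexp (l * (\<Sum>M\<in>K. Poly_Mapping.single M (Poly_Mapping.lookup g
        M))) = 1 + z * n"
      by auto
    define c where "c = Poly_Mapping.lookup g M"
    define w where "w = of_int c * mono M"
    have w: "w \<in> nilp" using insert by (auto simp: w_def intro!: nilp_mult mono_nil)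
    have "M \<noteq> {#}" using insert.prems by auto
    \<comment> \<open>Together with l this gives the two factors that \<open>mexp_prod_lin\<close>
      requires.\<close>
    then have "size M \<ge> 1" by (simp add: Suc_leI nonempty_has_size)
    then have "mexp (Poly_Mapping.single M c * prod_list [l]) = texp (of_int c * mono M * prod_list [z])"
      using l by (intro mexp_prod_lin) simp_all
    also have "\<dots> = 1 + z * (w * (1 + 3 * (w * z) + (w * z)^2 + 4 * (w * z)^3))"
      unfolding texp_def w_def by (simp add: algebra_simps power_numeral_reduce)
    finally have s: "mexp (l * Poly_Mapping.single M c) = 1 + z * (w * (1 + 3 * (w * z) + (w * z)^2
        + 4 * (w * z)^3))"
      by (simp add: mult.commute)
    define n' where "n' = w * (1 + 3 * (w * z) + (w * z)^2 + 4 * (w * z)^3)"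
    have n': "n' \<in> nilp" unfolding n'_def by (rule nilp_mult2[OF w])
    have "mexp (l * (\<Sum>M\<in>insert M K. Poly_Mapping.single M (Poly_Mapping.lookup g M))) = (1 + z * n')
        * (1 + z * n)"
      using insert n s by (simp add: distrib_left mexp_add n'_def c_def)
    also have "\<dots> = 1 + z * (n' + n + z * n' * n)" by (simp add: algebra_simps power_numeral_reduce)
    finally show ?case
      using n' n(1) by (auto intro!: bexI[of _ "n' + n + z * n' * n"] nilp_add nilp_mult)
  qed
  have "g = (\<Sum>M\<in>Poly_Mapping.keys g. Poly_Mapping.single M (Poly_Mapping.lookup g M))"
    by (rule poly_mapping_eqI) (auto simp: lookup_sum lookup_single when_def in_keys_iff)
  moreover have "{#} \<notin> Poly_Mapping.keys g" using g by (simp add: in_keys_iff)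
  ultimately show ?thesis using *[of "Poly_Mapping.keys g"] by auto
qed

lemma torsion_free5:
  fixes T :: "nat multiset \<Rightarrow>\<^sub>0 int"
  assumes "5 * T = 0"
  shows "T = 0"
proof (rule poly_mapping_eqI)
  fix M
  have "5 * T = T + T + T + T + T" by (simp add: algebra_simps power_numeral_reduce)
  then have "Poly_Mapping.lookup (T + T + T + T + T) M = 0" using assms by simp
  then show "Poly_Mapping.lookup T M = Poly_Mapping.lookup 0 M" unfolding lookup_add by simp
qed

text \<open>With \<open>x s\<close> the c-th power of \<open>texp (z s)\<close> times
  \<open>mexp (l s * g s)\<close>, the product over A is \<open>mexp\<close> of c times the total
  carry plus the sum of the corrections. Five times this exponent is the left side of the assumed
  identity, so it vanishes by \<open>torsion_free5\<close>.\<close>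

theorem multiplicative_flow:
  fixes l g :: "'e \<Rightarrow> nat multiset \<Rightarrow>\<^sub>0 int" and c :: nat
  assumes lin: "\<And>s. s \<in> E \<Longrightarrow> lin (l s) (z s)" and g: "\<And>s. s \<in> E \<Longrightarrow> Poly_Mapping.lookup (g s) {#} = 0"
  obtains x n where
    "\<And>s. s \<in> E \<Longrightarrow> n s \<in> nilp \<and> x s = 1 + z s * (of_nat c + n s)"
    "\<And>A. finite A \<Longrightarrow> A \<subseteq> E \<Longrightarrow> (\<Sum>s\<in>A. l s) = 0 \<Longrightarrow> (\<Sum>s\<in>A. z s) = 0 \<Longrightarrow>
       (\<Sum>s\<in>A. of_nat c * l s ^ 5 + 5 * (l s * g s)) = 0 \<Longrightarrow> (\<Prod>s\<in>A. x s) = 1"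
proof -
  define x where "x s = texp (z s) ^ c * mexp (l s * g s)" for s
  have "\<exists>n\<in>nilp. x s = 1 + z s * (of_nat c + n)" if s: "s \<in> E" for s
  proof -
    have z: "z s \<in> nilp" using lin[OF s] by (rule lin_nil)
    have "\<exists>n\<in>nilp. texp (z s) ^ k = 1 + z s * (of_nat k + n)" for k
    proof (induction k)
      case 0
      show ?case by (auto intro: bexI[of _ 0])
    next
      case (Suc k)
      then obtain n where n: "n \<in> nilp" "texp (z s) ^ k = 1 + z s * (of_nat k + n)" by auto
      define m where "m = z s * (3 + z s + 4 * z s ^ 2)"
      have m: "m \<in> nilp" unfolding m_def by (rule nilp_mult2[OF z])
      have t: "texp (z s) = 1 + z s * (1 + m)"
        unfolding texp_def m_def by (simp add: algebra_simps power_numeral_reduce)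
      have "texp (z s) ^ Suc k = (1 + z s * (1 + m)) * (1 + z s * (of_nat k + n))"
        by (simp add: n(2)) (simp add: t)
      then obtain j where j: "j \<in> nilp" "texp (z s) ^ Suc k = 1 + z s * (1 + of_nat k + (j + z s * 1
          * of_nat k))"
        using one_plus_mult_nil[OF m n(1), of "z s" 1 "of_nat k"] by metis
      show ?case
      proof (rule bexI)
        show "texp (z s) ^ Suc k = 1 + z s * (of_nat (Suc k) + (j + of_nat k * z s))"
          unfolding j(2) by (simp add: algebra_simps)
        show "j + of_nat k * z s \<in> nilp"
          by (intro nilp_add nilp_mult j z)
      qed
    qed
    then obtain m where m: "m \<in> nilp" "texp (z s) ^ c = 1 + z s * (of_nat c + m)" by auto
    obtain n where n: "n \<in> nilp" "mexp (l s * g s) = 1 + z s * n"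
      using mexp_lin_mult[OF lin[OF s] g[OF s]] by auto
    obtain j where "j \<in> nilp" "x s = 1 + z s * (of_nat c + 0 + (j + z s * of_nat c * 0))"
      using one_plus_mult_nil[OF m(1) n(1), of "z s" "of_nat c" 0]
      unfolding x_def m(2) n(2) by auto
    then show ?thesis by auto
  qed
  then obtain n where n: "\<And>s. s \<in> E \<Longrightarrow> n s \<in> nilp \<and> x s = 1 + z s * (of_nat c + n s)"
    by metis
  show ?thesis
  proof (rule that[OF n])
    fix A assume A: "finite A" "A \<subseteq> E" "(\<Sum>s\<in>A. l s) = 0" "(\<Sum>s\<in>A. z s) = 0"
      "(\<Sum>s\<in>A. of_nat c * l s ^ 5 + 5 * (l s * g s)) = 0"
    obtain P where P: "(\<Prod>s\<in>A. texp (z s)) = mexp P" "5 * P = (\<Sum>s\<in>A. l s ^ 5)"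
      using prod_texp_lin[OF A(1), of l z] lin A(2,3,4) by (auto simp: subset_iff)
    have mexp_pow: "mexp P ^ k = mexp (of_nat k * P)" for k
      by (induction k) (simp_all add: mexp_add distrib_right)
    have mexp_sum: "(\<Prod>s\<in>A. mexp (l s * g s)) = mexp (\<Sum>s\<in>A. l s * g s)"
      using A(1) by (induction A rule: finite_induct) (simp_all add: mexp_add)
    have "5 * (of_nat c * P + (\<Sum>s\<in>A. l s * g s)) = of_nat c * (5 * P) + 5 * (\<Sum>s\<in>A. l s * g s)"
      by (simp add: algebra_simps)
    also have "\<dots> = 0"
      using A(5) by (simp add: P(2) sum.distrib sum_distrib_left)
    finally have 0: "of_nat c * P + (\<Sum>s\<in>A. l s * g s) = 0"
      by (rule torsion_free5)
    have "(\<Prod>s\<in>A. x s) = mexp P ^ c * mexp (\<Sum>s\<in>A. l s * g s)"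
      unfolding x_def prod.distrib by (simp add: mexp_sum flip: P(1) prod_power_distrib)
    then show "(\<Prod>s\<in>A. x s) = 1"
      unfolding mexp_pow by (simp add: 0 flip: mexp_add)
  qed
qed

end

section \<open>The group ring\<close>

lemma of_nat_5_eq_iff: "(of_nat m :: 5) = of_nat n \<longleftrightarrow> m mod 5 = n mod 5"
  by (simp add: of_nat_eq_iff_cong_CHAR cong_def)

lemma of_nat_5_surj: "\<exists>n<5. (k::5) = of_nat n"
proof (cases k)
  case (of_int z)
  then show ?thesis by (intro exI[of _ "nat z"]) auto
qed

lemma UNIV_5: "(UNIV :: 5 set) = of_nat ` {..<5}"
  using of_nat_5_surj by auto

text \<open>Serves to raise fifth roots of unity to coordinates of vectors over the field of 5
  elements; \<open>LEAST\<close> picks the lift below 5.\<close>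

definition pow5 :: "'a::comm_ring_1 \<Rightarrow> 5 \<Rightarrow> 'a" where
  "pow5 a k = a ^ (LEAST n. of_nat n = k)"

lemma power_mod_5:
  fixes a :: "'a::comm_ring_1"
  assumes "a ^ 5 = 1"
  shows "a ^ (n mod 5) = a ^ n"
proof -
  have "a ^ n = a ^ (5 * (n div 5) + n mod 5)" by simp
  also have "\<dots> = a ^ (n mod 5)" unfolding power_add power_mult assms by simp
  finally show ?thesis ..
qed

lemma pow5_of_nat:
  assumes "a ^ 5 = 1"
  shows "pow5 a (of_nat n) = a ^ n"
proof -
  define m where "m = (LEAST m. of_nat m = (of_nat n :: 5))"
  have "of_nat m = (of_nat n :: 5)" unfolding m_def by (rule LeastI) simp
  then have "m mod 5 = n mod 5" by (simp add: of_nat_5_eq_iff)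
  then show ?thesis
    using power_mod_5[OF assms, of m] power_mod_5[OF assms, of n] by (simp add: pow5_def m_def)
qed

lemma pow5_0 [simp]: "pow5 a 0 = 1"
  by (simp add: pow5_def)

lemma pow5_1: "a ^ 5 = 1 \<Longrightarrow> pow5 a 1 = a"
  using pow5_of_nat[of a 1] by simp

lemma pow5_one [simp]: "pow5 1 k = 1"
  by (simp add: pow5_def)

lemma pow5_add:
  assumes "a ^ 5 = 1"
  shows "pow5 a (j + k) = pow5 a j * pow5 a k"
proof -
  obtain m n where mn: "j = of_nat m" "k = of_nat n" using of_nat_5_surj by blast
  have "pow5 a (j + k) = pow5 a (of_nat (m + n))" by (simp add: mn)
  then show ?thesis unfolding pow5_of_nat[OF assms] by (simp add: mn pow5_of_nat[OF assms] power_add)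
qed

lemma pow5_prod:
  assumes "\<And>s. s \<in> A \<Longrightarrow> x s ^ 5 = 1"
  shows "(\<Prod>s\<in>A. pow5 (x s) k) = pow5 (\<Prod>s\<in>A. x s) k"
proof -
  obtain n where n: "k = of_nat n" using of_nat_5_surj by blast
  have "(\<Prod>s\<in>A. x s) ^ 5 = 1" by (simp add: prod_power_distrib assms)
  then show ?thesis
    unfolding n using assms by (simp add: pow5_of_nat prod_power_distrib)
qed

text \<open>In characteristic 5 all coefficients (-1)^k (4 choose k) of (a - 1)^4 are 1.\<close>

lemma geometric_sum_5:
  fixes a :: "'a::comm_ring_1"
  assumes "(5::'a) = 0"
  shows "(\<Sum>n<5. a ^ n) = (a - 1) ^ 4"
proof -
  have "(\<Sum>n<5. a ^ n) = (a - 1) ^ 4 + 5 * (a - a^2 + a^3)"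
    by (simp add: eval_nat_numeral algebra_simps)
  then show ?thesis using assms by simp
qed

lemma sum_pow5:
  fixes a :: "'a::comm_ring_1"
  assumes "a ^ 5 = 1" "(5::'a) = 0"
  shows "(\<Sum>k\<in>UNIV. pow5 a (- k)) = (a - 1) ^ 4"
proof -
  have "(\<Sum>k\<in>UNIV. pow5 a (- k)) = (\<Sum>k\<in>UNIV. pow5 a k)"
    by (rule sum.reindex_bij_witness[of _ uminus uminus]) auto
  also have "\<dots> = (\<Sum>n<5. pow5 a (of_nat n))"
    unfolding UNIV_5 by (rule sum.reindex_cong[of of_nat]) (auto simp: inj_on_def of_nat_5_eq_iff)
  also have "\<dots> = (a - 1) ^ 4"
    unfolding pow5_of_nat[OF assms(1)] by (rule geometric_sum_5[OF assms(2)])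
  finally show ?thesis .
qed

section \<open>The group algebra of an elementary abelian 5-group and its socle element\<close>

type_synonym 's group_ring = "('s \<Rightarrow>\<^sub>0 5) \<Rightarrow>\<^sub>0 5"

definition coeff0 :: "'s group_ring \<Rightarrow> 5" where
  "coeff0 a = Poly_Mapping.lookup a 0"

lemma coeff0_add: "coeff0 (a + b) = coeff0 a + coeff0 b"
  by (simp add: coeff0_def lookup_add)

lemma coeff0_0 [simp]: "coeff0 0 = 0"
  by (simp add: coeff0_def)

lemma coeff0_diff: "coeff0 (a - b) = coeff0 a - coeff0 b"
  by (simp add: coeff0_def lookup_minus)

lemma coeff0_sum: "coeff0 (\<Sum>s\<in>A. f s) = (\<Sum>s\<in>A. coeff0 (f s))"
  by (simp add: coeff0_def lookup_sum)

lemma coeff0_of_nat_mult: "coeff0 (of_nat k * a) = of_nat k * coeff0 a"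
  by (induction k) (simp_all add: distrib_right coeff0_add)

lemma five_group_ring: "(5 :: 's group_ring) = 0"
proof -
  have "(5 :: 's group_ring) = Poly_Mapping.single 0 5" by simp
  also have "(5 :: 5) = 0" by simp
  finally show ?thesis by (simp del: single_numeral)
qed

definition gen :: "'s \<Rightarrow> 's group_ring" where
  "gen s = Poly_Mapping.single (Poly_Mapping.single s 1) 1"

lemma gen_power: "gen s ^ n = Poly_Mapping.single (Poly_Mapping.single s (of_nat n)) 1"
  by (induction n) (simp_all add: gen_def mult_single flip: single_add)

lemma gen_power_5: "gen s ^ 5 = 1"
proof -
  have "(of_nat 5 :: 5) = 0" by simp
  then show ?thesis unfolding gen_power by (simp del: of_nat_numeral)
qed

lemma gen_diff_power_5: "(gen s - 1) ^ 5 = 0"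
  using frobenius5[OF five_group_ring, of "gen s" "-1"] by (simp add: gen_power_5)

text \<open>By \<open>geometric_sum_5\<close> the product is the sum of all elements of the subgroup
  generated by C, each with coefficient 1.\<close>

lemma coeff0_top:
  assumes "finite C"
  shows "coeff0 (\<Prod>s\<in>C. (gen s - 1) ^ 4) = 1"
proof -
  \<comment> \<open>The bound on the support is carried along because it shows that a nontrivial
    power of a new generator moves the support away from the neutral element.\<close>
  have "coeff0 (\<Prod>s\<in>C. (gen s - 1) ^ 4) = 1 \<and>
     (\<forall>u\<in>Poly_Mapping.keys (\<Prod>s\<in>C. (gen s - 1) ^ 4). \<forall>t. t \<notin> C \<longrightarrow> Poly_Mapping.lookup u t = 0)"
    using assms
  proof (induction C rule: finite_induct)
    case empty
    show ?case by (simp add: coeff0_def)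
  next
    case (insert s C)
    define Q where "Q = (\<Prod>s\<in>C. (gen s - 1) ^ 4)"
    have e: "(\<Prod>t\<in>insert s C. (gen t - 1) ^ 4) = (\<Sum>n<5. gen s ^ n * Q)"
      unfolding Q_def sum_distrib_right[symmetric] geometric_sum_5[OF five_group_ring] using insert
          by simp
    have keys: "Poly_Mapping.lookup u t = (if t = s then of_nat n else Poly_Mapping.lookup u t)
        \<and> (t \<notin> insert s C \<longrightarrow> Poly_Mapping.lookup u t = 0)"
      if u: "u \<in> Poly_Mapping.keys (gen s ^ n * Q)" for u n t
    proof -
      have "u \<in> {a + b |a b. a \<in> Poly_Mapping.keys (gen s ^ n) \<and> b \<in> Poly_Mapping.keys Q}"
        using u keys_mult by blast
      then obtain b where b: "u = Poly_Mapping.single s (of_nat n) + b" "b \<in> Poly_Mapping.keys Q"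
        by (auto simp: gen_power)
      moreover have "Poly_Mapping.lookup b t = 0" if "t \<notin> C" for t
        using insert.IH b(2) that by (simp add: Q_def)
      ultimately show ?thesis using insert.hyps by (auto simp: lookup_add lookup_single when_def)
    qed
    have 0: "coeff0 (gen s ^ n * Q) = (if n = 0 then 1 else 0)" if "n < 5" for n
    proof (cases "n = 0")
      case True
      then show ?thesis using insert.IH by (simp add: Q_def)
    next
      case False
      then have "(of_nat n :: 5) \<noteq> of_nat 0" using that by (simp only: of_nat_5_eq_iff) simp
      then have "0 \<notin> Poly_Mapping.keys (gen s ^ n * Q)"
        using keys[of 0 n s] by auto
      then show ?thesis using False by (simp add: coeff0_def in_keys_iff)
    qed
    have "coeff0 (\<Prod>t\<in>insert s C. (gen t - 1) ^ 4) = (\<Sum>n<5::nat. if n = 0 then 1 else 0)"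
      unfolding e coeff0_sum by (rule sum.cong) (simp_all add: 0)
    moreover have "Poly_Mapping.lookup u t = 0"
      if u: "u \<in> Poly_Mapping.keys (\<Prod>t\<in>insert s C. (gen t - 1) ^ 4)" and t: "t \<notin> insert s C" for u t
    proof -
      have "(\<Sum>n<5. Poly_Mapping.lookup (gen s ^ n * Q) u) \<noteq> 0"
        using u unfolding e by (simp add: in_keys_iff lookup_sum)
      then obtain n where "Poly_Mapping.lookup (gen s ^ n * Q) u \<noteq> 0"
        by (meson sum.neutral)
      then show ?thesis using keys[of u n t] t by (simp add: in_keys_iff)
    qed
    ultimately show ?case by simp
  qed
  then show ?thesis by simp
qed

section \<open>Solutions in the Albanese graph\<close>

lemma translate_translate: "translate v (translate w W) = translate (\<lambda>s. v s + w s) W"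
  by (simp add: translate_def image_image add.assoc)

lemma translate_zero: "translate (\<lambda>s. 0) W = W"
  by (simp add: translate_def)

lemma mem_translate: "w \<in> translate v W \<longleftrightarrow> (\<lambda>s. w s - v s) \<in> W"
proof
  assume "(\<lambda>s. w s - v s) \<in> W"
  then show "w \<in> translate v W"
    unfolding translate_def by (rule rev_image_eqI) (simp add: fun_eq_iff)
qed (auto simp: translate_def)

lemma finite_vectors: "finite C \<Longrightarrow> finite (vectors C :: ('s \<Rightarrow> 'k::{comm_ring_1,finite}) set)"
  using finite_set_of_finite_funs[of C "UNIV :: 'k set" 0] by (simp add: vectors_def)

lemma prod_sum_vectors:
  fixes h :: "'s \<Rightarrow> 'k::{comm_ring_1,finite} \<Rightarrow> 'a::comm_ring_1"
  assumes "finite C"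
  shows "(\<Sum>v\<in>vectors C. \<Prod>s\<in>C. h s (v s)) = (\<Prod>s\<in>C. \<Sum>k\<in>UNIV. h s k)"
proof -
  have "(\<Prod>s\<in>C. \<Sum>k\<in>UNIV. h s k) = (\<Sum>w\<in>PiE C (\<lambda>_. UNIV). \<Prod>s\<in>C. h s (w s))"
    by (rule prod_sum_PiE) (use assms in auto)
  also have "\<dots> = (\<Sum>v\<in>vectors C. \<Prod>s\<in>C. h s (v s))"
    by (rule sum.reindex_bij_witness[of _ "\<lambda>v. restrict v C" "\<lambda>w s. if s \<in> C then w s else 0"])
      (auto simp: vectors_def fun_eq_iff PiE_def extensional_def)
  finally show ?thesis ..
qed

text \<open>All edges point into B, so the edges at a vertex have the same sign there: a flow has
  unsigned sum 0 over every star, and a multiplicative flow has product 1 without inverses.\<close>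

locale bipartite_tree = numbered_tree E dst src v g par
  for E :: "'v set set" and dst src v g par +
  fixes B :: "'v set"
  assumes bipartite: "s \<in> E \<Longrightarrow> dst s \<in> B \<and> src s \<notin> B"
begin

definition star :: "'v \<Rightarrow> 'v set set" where
  "star x = {s \<in> E. x \<in> s}"

definition sgn_v :: "'v \<Rightarrow> 'r::comm_ring_1" where
  "sgn_v x = (if x \<in> B then 1 else -1)"

lemma finite_star: "finite (star x)"
  using finite_E by (simp add: star_def)

lemma star_subset: "star x \<subseteq> E"
  by (auto simp: star_def)

lemma edge_vertices: "s \<in> E \<Longrightarrow> {x \<in> v ` {..g}. x \<in> s} = {dst s, src s}"
  using mem_edge edge_vertex by blast

lemma sum_stars:
  fixes h :: "'v \<Rightarrow> 'v set \<Rightarrow> 'a::comm_monoid_add"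
  shows "(\<Sum>x\<in>v ` {..g}. \<Sum>s\<in>star x. h x s) = (\<Sum>s\<in>E. h (dst s) s + h (src s) s)"
  unfolding star_def
  by (subst sum.swap_restrict) (auto simp: finite_E edge_vertices dst_neq_src intro!: sum.cong)

lemma prod_stars:
  fixes h :: "'v \<Rightarrow> 'v set \<Rightarrow> 'a::comm_monoid_mult"
  shows "(\<Prod>x\<in>v ` {..g}. \<Prod>s\<in>star x. h x s) = (\<Prod>s\<in>E. h (dst s) s * h (src s) s)"
  unfolding star_def
  by (subst prod.swap_restrict) (auto simp: finite_E edge_vertices dst_neq_src intro!: prod.cong)

section \<open>Flows determined by their values on the cotree\<close>

definition cotree :: "'v set set" where
  "cotree = E - tree_edge ` {..<g}"

lemma finite_cotree: "finite cotree"
  using finite_E by (simp add: cotree_def)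

definition tree_index :: "'v set \<Rightarrow> nat" where
  "tree_index = the_inv_into {..<g} tree_edge"

lemma tree_index [simp]: "i < g \<Longrightarrow> tree_index (tree_edge i) = i"
  unfolding tree_index_def by (rule the_inv_into_f_f[OF tree_edge_inj]) simp

text \<open>The fundamental cut of a tree edge consists of this edge and of cotree edges, so
  orthogonality to it forces the value there. The coefficient ring is left open because the same
  flow is needed over the integral polynomials and over the group ring.\<close>

definition flow_ext :: "('v set \<Rightarrow> 'a::comm_ring_1) \<Rightarrow> 'v set \<Rightarrow> 'a" where
  "flow_ext a s = (if s \<in> cotree then a s else
     if s \<in> E then - (\<Sum>t\<in>cotree. of_int (cut_matrix (tree_index s) t) * a t) else 0)"

lemma flow_ext_cut:
  assumes "i < g"
  shows "(\<Sum>s\<in>E. of_int (cut_matrix i s) * flow_ext a s) = 0"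
proof -
  have "(\<Sum>s\<in>E. of_int (cut_matrix i s) * flow_ext a s)
      = (\<Sum>s\<in>cotree. of_int (cut_matrix i s) * flow_ext a s)
        + (\<Sum>s\<in>tree_edge ` {..<g}. of_int (cut_matrix i s) * flow_ext a s)"
    unfolding cotree_def using tree_edge_E finite_E by (intro sum.subset_diff) auto
  also have "(\<Sum>s\<in>tree_edge ` {..<g}. of_int (cut_matrix i s) * flow_ext a s)
      = (\<Sum>j<g. if i = j then flow_ext a (tree_edge j) else 0)"
    by (simp add: sum.reindex[OF tree_edge_inj] cut_matrix_tree_edge if_distrib[of "\<lambda>c. of_int c *
        _"] cong: if_cong)
  also have "\<dots> = flow_ext a (tree_edge i)" using assms by simp
  also have "\<dots> = - (\<Sum>t\<in>cotree. of_int (cut_matrix i t) * flow_ext a t)"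
  proof -
    have "tree_edge i \<notin> cotree" using assms by (auto simp: cotree_def)
    then show ?thesis using assms tree_edge_E by (simp add: flow_ext_def)
  qed
  finally show ?thesis by simp
qed

text \<open>Orthogonality to the rows extends to all coboundaries. That of the indicator of x is, on
  the edges at x, the constant sign \<open>sgn_v x\<close>.\<close>

lemma flow_ext_star: "(\<Sum>s\<in>star x. flow_ext (a :: 'v set \<Rightarrow> 'a::comm_ring_1) s) = 0"
proof -
  define \<chi> :: "'v \<Rightarrow> 'a" where "\<chi> y = of_bool (y = x)" for y
  define D where "D i = \<chi> (dst (tree_edge i)) - \<chi> (src (tree_edge i))" for i
  have s: "\<chi> (dst s) - \<chi> (src s) = (if x \<in> s then sgn_v x else 0)" if "s \<in> E" for s
    using mem_edge[OF that, of x] dst_neq_src[OF that] bipartite[OF that] by (auto simp: \<chi>_def sgn_v_def)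
  have "sgn_v x * (\<Sum>s\<in>star x. flow_ext a s) = (\<Sum>s\<in>E. if x \<in> s then sgn_v x * flow_ext a s else 0)"
    using finite_E by (simp add: star_def sum_distrib_left sum.If_cases Int_def)
  also have "\<dots> = (\<Sum>s\<in>E. (\<Sum>i<g. of_int (cut_matrix i s) * D i) * flow_ext a s)"
    unfolding D_def using s by (intro sum.cong) (simp_all add: cut_matrix_diff)
  also have "\<dots> = (\<Sum>i<g. D i * (\<Sum>s\<in>E. of_int (cut_matrix i s) * flow_ext a s))"
    unfolding sum_distrib_right sum_distrib_left by (subst sum.swap) (simp add: mult_ac)
  also have "\<dots> = 0" by (simp add: flow_ext_cut)
  finally show ?thesis by (auto simp: sgn_v_def split: if_splits)
qed

section \<open>The reduced cut lattice and its cosets\<close>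

definition red_lattice :: "('v set \<Rightarrow> 5) set" where
  "red_lattice = reduction (row_lattice g cut_matrix E)"

lemma red_lattice_eq:
  "red_lattice = {\<lambda>s. if s \<in> E then \<Sum>i<g. of_int (n i) * of_int (cut_matrix i s) else 0 |n. True}"
proof -
  have "(\<lambda>u s. of_int (u s)) (\<lambda>s. if s \<in> E then \<Sum>i<g. n i * cut_matrix i s else 0)
      = (\<lambda>s. if s \<in> E then \<Sum>i<g. of_int (n i) * of_int (cut_matrix i s) else (0::5))" for n
    by (rule ext) simp
  then show ?thesis
    unfolding red_lattice_def reduction_def row_lattice_def setcompr_eq_image image_image by simp
qed

lemma red_lattice_diff:
  assumes "u \<in> red_lattice" "w \<in> red_lattice"
  shows "(\<lambda>s. u s - w s) \<in> red_lattice"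
proof -
  obtain m n where "u = (\<lambda>s. if s \<in> E then \<Sum>i<g. of_int (m i) * of_int (cut_matrix i s) else 0)"
    "w = (\<lambda>s. if s \<in> E then \<Sum>i<g. of_int (n i) * of_int (cut_matrix i s) else 0)"
    using assms unfolding red_lattice_eq by blast
  then have "(\<lambda>s. u s - w s) = (\<lambda>s. if s \<in> E then \<Sum>i<g. of_int (m i - n i) * of_int (cut_matrix i s)
      else 0)"
    by (auto simp: fun_eq_iff sum_subtractf left_diff_distrib)
  then show ?thesis
    unfolding red_lattice_eq by (intro CollectI exI[of _ "\<lambda>i. m i - n i"] conjI TrueI)
qed

lemma red_lattice_0: "(\<lambda>s. 0) \<in> red_lattice"
  unfolding red_lattice_eq by (rule CollectI, rule exI[of _ "\<lambda>_. 0"]) (simp add: fun_eq_iff)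

lemma red_lattice_minus: "u \<in> red_lattice \<Longrightarrow> (\<lambda>s. - u s) \<in> red_lattice"
  using red_lattice_diff[OF red_lattice_0] by simp

lemma red_lattice_add:
  assumes "u \<in> red_lattice" "w \<in> red_lattice"
  shows "(\<lambda>s. u s + w s) \<in> red_lattice"
  using red_lattice_diff[OF assms(1) red_lattice_minus[OF assms(2)]] by simp

lemma translate_eq_iff:
  "translate w red_lattice = translate w' red_lattice \<longleftrightarrow> (\<lambda>s. w s - w' s) \<in> red_lattice"
proof
  assume "translate w red_lattice = translate w' red_lattice"
  moreover have "w \<in> translate w red_lattice" by (simp add: mem_translate red_lattice_0)
  ultimately show "(\<lambda>s. w s - w' s) \<in> red_lattice" by (simp add: mem_translate)
next
  assume *: "(\<lambda>s. w s - w' s) \<in> red_lattice"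
  show "translate w red_lattice = translate w' red_lattice"
  proof (intro Set.set_eqI iffI)
    fix u assume "u \<in> translate w red_lattice"
    then show "u \<in> translate w' red_lattice"
      using red_lattice_add[OF _ *] by (fastforce simp: mem_translate)
  next
    fix u assume "u \<in> translate w' red_lattice"
    then show "u \<in> translate w red_lattice"
      using red_lattice_diff[OF _ *] by (fastforce simp: mem_translate)
  qed
qed

text \<open>Multiplying the vertex potential by \<open>sgn_v\<close> turns its difference along an
  edge into a sum over the two ends. Sums and products over E weighted by u can then be regrouped
  into stars.\<close>

lemma red_lattice_potential:
  assumes "u \<in> red_lattice"
  obtains \<eta> where "\<And>s. s \<in> E \<Longrightarrow> u s = \<eta> (dst s) + \<eta> (src s)"
proof -
  obtain n where n: "u = (\<lambda>s. if s \<in> E then \<Sum>i<g. of_int (n i) * of_int (cut_matrix i s) else 0)"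
    using assms unfolding red_lattice_eq by blast
  define \<eta> :: "'v \<Rightarrow> 5" where "\<eta> x = sgn_v x * (\<Sum>i<g. of_int (n i) * of_int (pot (num x) i))" for x
  show ?thesis
  proof (rule that)
    fix s assume s: "s \<in> E"
    show "u s = \<eta> (dst s) + \<eta> (src s)"
      using s bipartite[OF s]
      by (simp add: n \<eta>_def sgn_v_def cut_matrix_def right_diff_distrib sum_subtractf)
  qed
qed

text \<open>The tree columns of the cut matrix form an identity matrix, so exactly one lattice
  vector cancels the tree coordinates of a given vector.\<close>

lemma cotree_representatives:
  "bij_betw (\<lambda>w. translate w red_lattice) (vectors cotree) (alb_vertices E red_lattice)"
  unfolding bij_betw_def
proof
  show "inj_on (\<lambda>w. translate w red_lattice) (vectors cotree)"
  proof (rule inj_onI)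
    fix w w' :: "'v set \<Rightarrow> 5"
    assume w: "w \<in> vectors cotree" "w' \<in> vectors cotree"
      and "translate w red_lattice = translate w' red_lattice"
    then have "(\<lambda>s. w s - w' s) \<in> red_lattice" by (simp add: translate_eq_iff)
    then obtain n where n: "(\<lambda>s. w s - w' s) = (\<lambda>s. if s \<in> E then \<Sum>i<g. of_int (n i) * of_int
        (cut_matrix i s) else 0)"
      unfolding red_lattice_eq by blast
    have "(of_int (n j) :: 5) = 0" if j: "j < g" for j
    proof -
      have "tree_edge j \<notin> cotree" using j by (auto simp: cotree_def)
      then have "w (tree_edge j) - w' (tree_edge j) = 0" using w by (simp add: vectors_def)
      then have "(\<Sum>i<g. of_int (n i) * of_int (cut_matrix i (tree_edge j)) :: 5) = 0"
        using fun_cong[OF n, of "tree_edge j"] tree_edge_E[OF j] by simp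
      then show ?thesis
        using j by (simp add: cut_matrix_tree_edge if_distrib cong: if_cong)
    qed
    then have "w s - w' s = 0" for s
      using fun_cong[OF n, of s] by simp
    then show "w = w'" by (simp add: fun_eq_iff)
  qed
  show "(\<lambda>w. translate w red_lattice) ` vectors cotree = alb_vertices E red_lattice"
  proof (intro Set.set_eqI iffI)
    fix X assume "X \<in> (\<lambda>w. translate w red_lattice) ` vectors cotree"
    then show "X \<in> alb_vertices E red_lattice"
      by (auto simp: alb_vertices_def vectors_def cotree_def)
  next
    fix X assume "X \<in> alb_vertices E red_lattice"
    then obtain w where w: "w \<in> vectors E" "X = translate w red_lattice"
      by (auto simp: alb_vertices_def)
    have "\<forall>j. \<exists>n :: int. of_int n = w (tree_edge j)"
      using of_nat_5_surj by (metis of_int_of_nat_eq)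
    then obtain n :: "nat \<Rightarrow> int" where n: "\<And>j. of_int (n j) = w (tree_edge j)" by metis
    define u where "u = (\<lambda>s. if s \<in> E then \<Sum>i<g. of_int (n i) * of_int (cut_matrix i s) else (0::5))"
    have u: "u \<in> red_lattice"
      unfolding red_lattice_eq u_def by (intro CollectI exI[of _ n] conjI TrueI refl)
    define w' where "w' = (\<lambda>s. w s - u s)"
    have "w' s = 0" if "s \<notin> cotree" for s
    proof (cases "s \<in> E")
      case True
      then obtain j where j: "j < g" "s = tree_edge j"
        using \<open>s \<notin> cotree\<close> by (auto simp: cotree_def)
      have "u s = w (tree_edge j)"
        using True j by (simp add: u_def cut_matrix_tree_edge n if_distrib cong: if_cong)
      then show ?thesis by (simp add: w'_def j)
    next
      case False
      then show ?thesis using w(1) by (simp add: w'_def u_def vectors_def)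
    qed
    then have "w' \<in> vectors cotree" by (simp add: vectors_def)
    moreover have "X = translate w' red_lattice"
      unfolding w(2) translate_eq_iff using u by (simp add: w'_def)
    ultimately show "X \<in> (\<lambda>w. translate w red_lattice) ` vectors cotree" by blast
  qed
qed

lemma finite_alb_vertices: "finite (alb_vertices E red_lattice)"
  using bij_betw_finite[OF cotree_representatives] finite_vectors[OF finite_cotree, where 'k = 5] by simp

text \<open>
  The chain of color \<open>s\<close> has at the vertex \<open>[w]\<close> the coefficient of the neutral element in
  \<open>x\<^bsup>-w\<^esup> f s\<close>. Its boundary is given in the same way by \<open>(x s - 1) f s = z s\<close>, so that closedness
  is additivity of the flow \<open>z\<close>, while multiplicativity of \<open>x\<close> makes it well defined.
\<close>

lemma albanese_solution:
  fixes x z f :: "'v set \<Rightarrow> 'i group_ring"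
  assumes x5: "\<And>s. s \<in> E \<Longrightarrow> x s ^ 5 = 1"
    and x_star: "\<And>y. y \<in> v ` {..g} \<Longrightarrow> (\<Prod>s\<in>star y. x s) = 1"
    and z_star: "\<And>y. y \<in> v ` {..g} \<Longrightarrow> (\<Sum>s\<in>star y. z s) = 0"
    and xf: "\<And>s. s \<in> E \<Longrightarrow> (x s - 1) * f s = z s"
    and c: "\<And>s. s \<in> E \<Longrightarrow> coeff0 ((\<Prod>t\<in>cotree. (x t - 1) ^ 4) * f s) = c"
  shows "\<exists>b. is_solution E red_lattice b \<and> (\<forall>s\<in>E. color_profile E red_lattice (b s) s = c)"
proof -
  define AV where "AV = alb_vertices E red_lattice"
  have finAV: "finite AV" unfolding AV_def by (rule finite_alb_vertices)
  define Xp where "Xp w = (\<Prod>t\<in>E. pow5 (x t) (- w t))" for w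
  define \<Phi> where "\<Phi> w s = coeff0 (Xp w * f s)" for w s
  \<comment> \<open>Any representative of the coset will do, since \<open>Xp\<close> is constant on
    cosets.\<close>
  define \<phi> where "\<phi> Y s = \<Phi> (SOME w. w \<in> Y) s" for Y s
  define b where "b s e = (if e \<in> alb_edges E red_lattice \<and> snd e = s then \<phi> (fst e) s else 0)" for s e
  have Xp_add: "Xp (\<lambda>s. w s + w' s) = Xp w * Xp w'" for w w'
    unfolding Xp_def prod.distrib[symmetric]
    by (intro prod.cong refl) (simp add: x5 flip: pow5_add)
  \<comment> \<open>Multiplicativity of the flow enters here: with exponents attached to vertices,
    the product regroups into powers of the products over stars.\<close>
  have Xp_lattice: "Xp u = 1" if u: "u \<in> red_lattice" for u
  proof -
    obtain \<eta> where \<eta>: "\<And>s. s \<in> E \<Longrightarrow> - u s = \<eta> (dst s) + \<eta> (src s)"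
      using red_lattice_potential[OF red_lattice_minus[OF u]] by blast
    have "Xp u = (\<Prod>s\<in>E. pow5 (x s) (\<eta> (dst s)) * pow5 (x s) (\<eta> (src s)))"
      unfolding Xp_def by (intro prod.cong refl) (simp add: \<eta> pow5_add x5)
    also have "\<dots> = (\<Prod>y\<in>v ` {..g}. \<Prod>s\<in>star y. pow5 (x s) (\<eta> y))"
      by (rule prod_stars[symmetric])
    also have "\<dots> = 1"
    proof (rule prod.neutral, rule ballI)
      fix y assume y: "y \<in> v ` {..g}"
      have "(\<Prod>s\<in>star y. pow5 (x s) (\<eta> y)) = pow5 (\<Prod>s\<in>star y. x s) (\<eta> y)"
        using x5 star_subset by (intro pow5_prod) blast
      then show "(\<Prod>s\<in>star y. pow5 (x s) (\<eta> y)) = 1" by (simp add: x_star[OF y])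
    qed
    finally show ?thesis .
  qed
  have \<phi>: "\<phi> (translate w red_lattice) s = \<Phi> w s" for w s
  proof -
    define w' where "w' = (SOME w'. w' \<in> translate w red_lattice)"
    define T where "T = translate w red_lattice"
    have "w \<in> T" by (simp add: T_def mem_translate red_lattice_0)
    then have "(SOME w'. w' \<in> T) \<in> T" by (rule someI[of "\<lambda>w'. w' \<in> T" w])
    then have "w' \<in> translate w red_lattice" by (simp add: w'_def T_def)
    then have "Xp (\<lambda>s. w' s - w s) = 1" by (intro Xp_lattice) (simp add: mem_translate)
    then have "Xp w' = Xp w"
      using Xp_add[of w "\<lambda>s. w' s - w s"] by simp
    then show ?thesis by (simp add: \<phi>_def \<Phi>_def flip: w'_def)
  qed
  have b_sum: "(\<Sum>s\<in>E. u s * b s (Y, t)) = u t * \<phi> Y t" if "Y \<in> AV" "t \<in> E" for u Y t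
  proof -
    have "(\<Sum>s\<in>E. u s * b s (Y, t)) = (\<Sum>s\<in>E. if s = t then u t * \<phi> Y t else 0)"
      using that by (intro sum.cong) (auto simp: b_def alb_edges_def AV_def)
    then show ?thesis using that finite_E by simp
  qed
  have bd: "boundary E red_lattice (\<lambda>e. \<Sum>s\<in>E. u s * b s e) X = 0"
    if u: "u \<in> red_lattice" and X: "X \<in> AV" for u X
  proof -
    obtain w where w: "w \<in> vectors E" "X = translate w red_lattice"
      using X by (auto simp: AV_def alb_vertices_def)
    have step: "(\<Sum>Y\<in>AV. u t * \<phi> Y t * (of_bool (translate (std_basis t) Y = X) - of_bool (Y = X)))
        = u t * coeff0 (Xp w * z t)" if t: "t \<in> E" for t
    proof -
      define w' where "w' = (\<lambda>s. w s - std_basis t s)"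
      have "w' \<in> vectors E" using w(1) t by (auto simp: w'_def vectors_def std_basis_def)
      then have Y': "translate w' red_lattice \<in> AV" by (auto simp: AV_def alb_vertices_def)
      \<comment> \<open>The only edge of color t ending at [w] starts at [w - e_t].\<close>
      have iff: "translate (std_basis t) Y = X \<longleftrightarrow> Y = translate w' red_lattice" for Y
      proof
        assume "translate (std_basis t) Y = X"
        then have "translate (\<lambda>s. - std_basis t s) X = Y"
          by (auto simp: translate_translate translate_zero)
        then show "Y = translate w' red_lattice"
          by (auto simp: w(2) translate_translate w'_def)
      qed (simp add: w(2) translate_translate w'_def)
      have x_t: "Xp (\<lambda>s. - std_basis t s) = x t"
      proof -
        have "Xp (\<lambda>s. - std_basis t s) = (\<Prod>s\<in>E. if s = t then x t else 1)"
          unfolding Xp_def using t by (intro prod.cong refl) (auto simp: std_basis_def pow5_1 x5)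
        then show ?thesis using t finite_E by simp
      qed
      have "Xp w' = Xp w * x t"
        using Xp_add[of w "\<lambda>s. - std_basis t s"] by (simp add: w'_def x_t)
      then have "\<Phi> w' t - \<Phi> w t = coeff0 (Xp w * ((x t - 1) * f t))"
        by (simp add: \<Phi>_def algebra_simps flip: coeff0_diff)
      then have d: "\<Phi> w' t - \<Phi> w t = coeff0 (Xp w * z t)" by (simp add: xf[OF t])
      have "(\<Sum>Y\<in>AV. u t * \<phi> Y t * (of_bool (translate (std_basis t) Y = X) - of_bool (Y = X)))
          = u t * ((\<Sum>Y\<in>AV. if Y = translate w' red_lattice then \<phi> Y t else 0) - (\<Sum>Y\<in>AV. if Y = X
              then \<phi> Y t else 0))"
        unfolding iff sum_subtractf[symmetric] sum_distrib_left by (intro sum.cong) auto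
      also have "\<dots> = u t * (\<Phi> w' t - \<Phi> w t)"
        using Y' X finAV by (simp add: \<phi> w(2))
      finally show ?thesis unfolding d .
    qed
    obtain \<eta> where \<eta>: "\<And>s. s \<in> E \<Longrightarrow> u s = \<eta> (dst s) + \<eta> (src s)"
      using red_lattice_potential[OF u] by blast
    have "boundary E red_lattice (\<lambda>e. \<Sum>s\<in>E. u s * b s e) X
        = (\<Sum>(Y, t)\<in>AV \<times> E. u t * \<phi> Y t * (of_bool (translate (std_basis t) Y = X) - of_bool (Y = X)))"
      unfolding boundary_def alb_edges_def AV_def[symmetric]
    proof (intro sum.cong refl)
      fix e assume "e \<in> AV \<times> E"
      then obtain Y t where e: "e = (Y, t)" and Yt: "Y \<in> AV" "t \<in> E" by (rule SigmaE)
      show "(\<Sum>s\<in>E. u s * b s e) * (of_bool (head e = X) - of_bool (tail e = X))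
          = (case e of (Y, t) \<Rightarrow> u t * \<phi> Y t * (of_bool (translate (std_basis t) Y = X) - of_bool (Y
              = X)))"
        unfolding e b_sum[OF Yt] prod.case head_def tail_def color_def fst_conv snd_conv ..
    qed
    also have "\<dots> = (\<Sum>t\<in>E. u t * coeff0 (Xp w * z t))"
      unfolding sum.cartesian_product[symmetric] by (subst sum.swap) (intro sum.cong refl step)
    also have "\<dots> = (\<Sum>t\<in>E. \<eta> (dst t) * coeff0 (Xp w * z t) + \<eta> (src t) * coeff0 (Xp w * z t))"
      by (intro sum.cong refl) (simp add: \<eta> distrib_right)
    also have "\<dots> = (\<Sum>y\<in>v ` {..g}. \<Sum>t\<in>star y. \<eta> y * coeff0 (Xp w * z t))"
      by (rule sum_stars[symmetric])
    also have "\<dots> = (\<Sum>y\<in>v ` {..g}. \<eta> y * coeff0 (Xp w * (\<Sum>t\<in>star y. z t)))"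
      by (simp add: coeff0_sum sum_distrib_left)
    also have "\<dots> = 0" by (intro sum.neutral ballI) (simp add: z_star)
    finally show ?thesis .
  qed
  have "is_solution E red_lattice b"
    unfolding is_solution_def
  proof (intro conjI ballI allI impI)
    fix s assume "s \<in> E"
    show "b s \<in> one_chains E red_lattice" by (simp add: one_chains_def b_def)
  next
    fix s :: "'v set" and e :: "('v set, 5) edge"
    assume "color e \<noteq> s"
    then show "b s e = 0" by (simp add: b_def color_def)
  next
    fix u assume "u \<in> red_lattice"
    then show "closed_chain E red_lattice (\<lambda>e. \<Sum>s\<in>E. u s * b s e)"
      unfolding closed_chain_def AV_def[symmetric] using bd by blast
  qed
  moreover have "color_profile E red_lattice (b s) s = c" if s: "s \<in> E" for s
  proof -
    have "color_profile E red_lattice (b s) s = (\<Sum>(Y, t)\<in>AV \<times> E. if t = s then \<phi> Y s else 0)"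
      unfolding color_profile_def alb_edges_def AV_def[symmetric]
    proof (intro sum.cong refl)
      fix e assume "e \<in> AV \<times> E"
      then obtain Y t where e: "e = (Y, t)" and "Y \<in> AV" "t \<in> E" by (rule SigmaE)
      then have "e \<in> alb_edges E red_lattice" by (simp add: alb_edges_def AV_def)
      then show "b s e * std_basis (color e) s = (case e of (Y, t) \<Rightarrow> if t = s then \<phi> Y s else 0)"
        by (simp add: e b_def color_def std_basis_def)
    qed
    also have "\<dots> = (\<Sum>Y\<in>AV. \<phi> Y s)"
      unfolding sum.cartesian_product[symmetric] using s finite_E by simp
    \<comment> \<open>Representatives supported on the cotree have independent coordinates, so the
      sum over all vertices of the monomials \<open>Xp w\<close> factors into one geometric sum for
      each cotree edge.\<close>
    also have "\<dots> = (\<Sum>w\<in>vectors cotree. \<Phi> w s)"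
      unfolding AV_def sum.reindex_bij_betw[OF cotree_representatives, symmetric] by (simp add: \<phi>)
    also have "\<dots> = coeff0 ((\<Sum>w\<in>vectors cotree. Xp w) * f s)"
      by (simp add: \<Phi>_def coeff0_sum sum_distrib_right)
    also have "(\<Sum>w\<in>vectors cotree. Xp w) = (\<Sum>w\<in>vectors cotree. \<Prod>t\<in>cotree. pow5 (x t) (- w t))"
    proof (intro sum.cong refl)
      fix w :: "'v set \<Rightarrow> 5" assume w: "w \<in> vectors cotree"
      show "Xp w = (\<Prod>t\<in>cotree. pow5 (x t) (- w t))"
        unfolding Xp_def using w finite_E
        by (intro prod.mono_neutral_right) (auto simp: vectors_def cotree_def)
    qed
    also have "\<dots> = (\<Prod>t\<in>cotree. \<Sum>k\<in>UNIV. pow5 (x t) (- k))"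
      by (rule prod_sum_vectors[OF finite_cotree, of "\<lambda>t k. pow5 (x t) (- k)"])
    also have "\<dots> = (\<Prod>t\<in>cotree. (x t - 1) ^ 4)"
      by (intro prod.cong refl) (simp add: sum_pow5 five_group_ring x5 cotree_def)
    finally show ?thesis using c[OF s] by simp
  qed
  ultimately show ?thesis by blast
qed

text \<open>The hypothesis \<open>flow\<close> is applied to the universal flow, whose values on the
  cotree edges are the variables. The color profiles come out as coefficients of the neutral element
  in \<open>of_nat (c ^ e) * top\<close>, an expression free of s.\<close>

theorem cycle_matroid_in_class:
  fixes c :: nat
  assumes c: "(of_nat c :: 5) dvd 1"
    and flow: "\<And>l :: 'v set \<Rightarrow> nat multiset \<Rightarrow>\<^sub>0 int.
      (\<And>s. Poly_Mapping.lookup (l s) {#} = 0) \<Longrightarrow>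
      (\<And>y. y \<in> v ` {..g} \<Longrightarrow> (\<Sum>s\<in>star y. l s) = 0) \<Longrightarrow>
      \<exists>h. (\<forall>s\<in>E. Poly_Mapping.lookup (h s) {#} = 0) \<and>
        (\<forall>y\<in>v ` {..g}. (\<Sum>s\<in>star y. of_nat c * l s ^ 5 + 5 * (l s * h s)) = 0)"
  shows "cycle_matroid (V, E) \<in> matroid_class TYPE(5)"
proof -
  define m where "m = card cotree"
  obtain \<gamma> where "bij_betw \<gamma> {0..<m} cotree"
    using ex_bij_betw_nat_finite[OF finite_cotree] unfolding m_def by blast
  then have \<gamma>: "inj_on \<gamma> {0..<m}" "\<gamma> ` {0..<m} = cotree" by (simp_all add: bij_betw_def)
  define \<iota> where "\<iota> = the_inv_into {0..<m} \<gamma>"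
  have \<iota>: "\<iota> s < m" "\<gamma> (\<iota> s) = s" if "s \<in> cotree" for s
    using that the_inv_into_into[OF \<gamma>(1), of s "{0..<m}"] f_the_inv_into_f[OF \<gamma>(1), of s]
    unfolding \<gamma>(2) \<iota>_def by auto
  define top :: "'v set group_ring" where "top = (\<Prod>s\<in>cotree. (gen s - 1) ^ 4)"
  \<comment> \<open>There is one variable for each of the m cotree edges; the remaining terms of the
    sequence expected by \<open>truncated\<close> are set to 0.\<close>
  define y :: "nat \<Rightarrow> 'v set group_ring" where "y i = (if i < m then gen (\<gamma> i) - 1 else 0)" for i
  interpret truncated y top
  proof
    show "(5 :: 'v set group_ring) = 0" by (rule five_group_ring)
    fix i
    show "y i ^ 5 = 0" by (simp add: y_def gen_diff_power_5)
    show "y i * top = 0"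
    proof (cases "i < m")
      case True
      then have "\<gamma> i \<in> cotree" using \<gamma>(2) by auto
      then have "top = (gen (\<gamma> i) - 1) ^ 4 * (\<Prod>s\<in>cotree - {\<gamma> i}. (gen s - 1) ^ 4)"
        unfolding top_def by (rule prod.remove[OF finite_cotree])
      moreover have "(gen (\<gamma> i) - 1) * (gen (\<gamma> i) - 1) ^ 4 = (0 :: 'v set group_ring)"
        using gen_diff_power_5[of "\<gamma> i"] by (simp add: power_numeral_reduce)
      ultimately show ?thesis using True by (simp add: y_def mult.assoc[symmetric])
    qed (simp add: y_def)
  qed
  \<comment> \<open>The same flow over two rings: \<open>l\<close> over the integral polynomials and
    \<open>z\<close>, its value, in the group ring.\<close>
  define l where "l = flow_ext (\<lambda>s. Poly_Mapping.single {#\<iota> s#} (1::int))"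
  define z where "z = flow_ext (\<lambda>s. y (\<iota> s))"
  have lin_cotree: "lin (Poly_Mapping.single {#\<iota> s#} 1) (y (\<iota> s))" for s
    using lin_single[of "\<iota> s" 1] by simp
  have lin: "lin (l s) (z s)" for s
  proof -
    have "lin (of_int (-1) * (\<Sum>t\<in>cotree. of_int (cut_matrix (tree_index s) t) * Poly_Mapping.single
        {#\<iota> t#} 1))
      (of_int (-1) * (\<Sum>t\<in>cotree. of_int (cut_matrix (tree_index s) t) * y (\<iota> t)))"
      by (intro lin_scale lin_sum finite_cotree lin_cotree)
    then show ?thesis
      using lin_cotree lin_0 by (simp add: l_def z_def flow_ext_def)
  qed
  have l_star: "(\<Sum>s\<in>star x. l s) = 0" and z_star: "(\<Sum>s\<in>star x. z s) = 0" for x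
    unfolding l_def z_def by (rule flow_ext_star)+
  obtain h where h0: "\<And>s. s \<in> E \<Longrightarrow> Poly_Mapping.lookup (h s) {#} = 0"
    and h: "\<And>y. y \<in> v ` {..g} \<Longrightarrow> (\<Sum>s\<in>star y. of_nat c * l s ^ 5 + 5 * (l s * h s)) = 0"
    using flow[of l] lin_lookup[OF lin] l_star by blast
  obtain x n where xn: "\<And>s. s \<in> E \<Longrightarrow> n s \<in> nilp \<and> x s = 1 + z s * (of_nat c + n s)"
    and x_prod: "\<And>A. finite A \<Longrightarrow> A \<subseteq> E \<Longrightarrow> (\<Sum>s\<in>A. l s) = 0 \<Longrightarrow> (\<Sum>s\<in>A. z s) = 0 \<Longrightarrow>
       (\<Sum>s\<in>A. of_nat c * l s ^ 5 + 5 * (l s * h s)) = 0 \<Longrightarrow> (\<Prod>s\<in>A. x s) = 1"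
  proof (rule multiplicative_flow[of E l z h c])
    show "\<And>s. s \<in> E \<Longrightarrow> lin (l s) (z s)" by (rule lin)
    show "\<And>s. s \<in> E \<Longrightarrow> Poly_Mapping.lookup (h s) {#} = 0" by (rule h0)
  qed (rule that)
  have pow5_c: "(of_nat c + n s) ^ 5 = of_nat (c ^ 5)" if "s \<in> E" for s
    using xn[OF that] by (simp add: frobenius5[OF five] nilp_def)
  have nilp_top: "(of_nat k + r) * top = of_nat k * top" if "r \<in> nilp" for k r
    using that by (simp add: distrib_right nilp_def)
  have pow_top: "(of_nat c + r) ^ j * top = of_nat (c ^ j) * top" if "r \<in> nilp" for j r
  proof (induction j)
    case (Suc j)
    have "(of_nat c + r) ^ Suc j * top = (of_nat c + r) * (of_nat (c ^ j) * top)"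
      using Suc by (simp add: mult.assoc)
    also have "\<dots> = of_nat (c ^ j) * ((of_nat c + r) * top)" by (simp add: mult_ac)
    finally show ?case unfolding nilp_top[OF that] by (simp add: mult_ac)
  qed simp
  have prod_top: "(\<Prod>s\<in>D. (of_nat c + n s) ^ 4) * top = of_nat (c ^ (4 * card D)) * top"
    if "finite D" "D \<subseteq> E" for D
    using that
  proof (induction D rule: finite_induct)
    case (insert s D)
    have p: "(of_nat c + n s) ^ 4 * top = of_nat (c ^ 4) * top"
      using xn[of s] insert.prems by (intro pow_top) auto
    have "(\<Prod>s\<in>insert s D. (of_nat c + n s) ^ 4) * top
        = (of_nat c + n s) ^ 4 * ((\<Prod>s\<in>D. (of_nat c + n s) ^ 4) * top)"
      using insert.hyps by (simp add: mult.assoc)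
    also have "\<dots> = of_nat (c ^ (4 * card D)) * ((of_nat c + n s) ^ 4 * top)"
      using insert by (simp add: mult_ac)
    also have "\<dots> = of_nat (c ^ (4 * card (insert s D))) * top"
      unfolding p using insert by (simp add: power_add mult_ac)
    finally show ?case .
  qed simp
  define f where "f s = (of_nat c + n s) ^ 4" for s
  \<comment> \<open>The power (x - 1)^4 gives four factors c for each cotree edge, and f gives four
    more.\<close>
  define e where "e = 4 * card cotree + 4"
  have cot: "x s - 1 = (gen s - 1) * (of_nat c + n s)" if "s \<in> cotree" for s
  proof -
    have "z s = gen s - 1" using that \<iota>[OF that] by (simp add: z_def flow_ext_def y_def)
    then show ?thesis using xn[of s] that by (simp add: cotree_def)
  qed
  have "\<exists>b. is_solution E red_lattice b \<and> (\<forall>s\<in>E. color_profile E red_lattice (b s) s = of_nat (c ^ e))"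
  proof (rule albanese_solution[of x "\<lambda>s. of_nat (c ^ 5) * z s" f])
    fix s assume s: "s \<in> E"
    have z5: "z s ^ 5 = 0" using lin_pow5[OF lin] .
    show "x s ^ 5 = 1"
      using xn[OF s] by (simp add: frobenius5[OF five] power_mult_distrib z5)
    show "(x s - 1) * f s = of_nat (c ^ 5) * z s"
    proof -
      have "(x s - 1) * f s = z s * (of_nat c + n s) ^ 5"
        using xn[OF s] by (simp add: f_def power_numeral_reduce mult_ac)
      then show ?thesis by (simp add: pow5_c[OF s] mult.commute)
    qed
    have "(\<Prod>t\<in>cotree. (x t - 1) ^ 4) = top * (\<Prod>t\<in>cotree. (of_nat c + n t) ^ 4)"
      unfolding top_def prod.distrib[symmetric] by (intro prod.cong refl) (simp add: cot
          power_mult_distrib)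
    then have "(\<Prod>t\<in>cotree. (x t - 1) ^ 4) * f s
        = (of_nat c + n s) ^ 4 * ((\<Prod>t\<in>cotree. (of_nat c + n t) ^ 4) * top)"
      by (simp add: f_def mult_ac)
    also have "(\<Prod>t\<in>cotree. (of_nat c + n t) ^ 4) * top = of_nat (c ^ (4 * card cotree)) * top"
      using finite_cotree by (rule prod_top) (simp add: cotree_def)
    also have "(of_nat c + n s) ^ 4 * (of_nat (c ^ (4 * card cotree)) * top)
        = of_nat (c ^ (4 * card cotree)) * ((of_nat c + n s) ^ 4 * top)"
      by (simp only: mult_ac)
    also have "\<dots> = of_nat (c ^ e) * top"
      unfolding pow_top[OF conjunct1[OF xn[OF s]]] by (simp add: e_def power_add mult_ac)
    finally show "coeff0 ((\<Prod>t\<in>cotree. (x t - 1) ^ 4) * f s) = of_nat (c ^ e)"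
      using coeff0_top[OF finite_cotree] by (simp only: coeff0_of_nat_mult top_def mult_1_right)
  next
    fix w assume w: "w \<in> v ` {..g}"
    show "(\<Prod>s\<in>star w. x s) = 1"
      by (rule x_prod[OF finite_star star_subset l_star z_star h[OF w]])
    show "(\<Sum>s\<in>star w. of_nat (c ^ 5) * z s) = 0"
      using z_star[of w] by (simp flip: sum_distrib_left)
  qed
  moreover have "(of_nat (c ^ e) :: 5) dvd 1"
    using dvd_power_same[OF c, of e] by simp
  moreover have "prime CARD(5)" by simp
  ultimately show ?thesis
    using TU_realization_cycle_matroid[of V] regular_cycle_matroid[of V]
    unfolding matroid_class_def Let_def red_lattice_def
    by (auto simp: cycle_matroid_def)
qed

end

section \<open>Bipartite graphs in coordinates\<close>

lemma bipartite_treeI: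
  assumes edge: "\<And>s. s \<in> E \<Longrightarrow> \<exists>a b. s = {a, b} \<and> a \<in> B \<and> b \<notin> B \<and> a \<in> v ` {..g} \<and> b \<in> v ` {..g}"
    and "inj_on v {..g}" "\<And>k. k < g \<Longrightarrow> par k \<le> k \<and> {v (Suc k), v (par k)} \<in> E"
  shows "bipartite_tree E (\<lambda>s. THE x. x \<in> s \<and> x \<in> B) (\<lambda>s. THE x. x \<in> s \<and> x \<notin> B) v g par B"
proof -
  have *: "\<exists>a b. s = {a, b} \<and> a \<in> B \<and> b \<notin> B \<and> a \<in> v ` {..g} \<and> b \<in> v ` {..g} \<and>
      (THE x. x \<in> s \<and> x \<in> B) = a \<and> (THE x. x \<in> s \<and> x \<notin> B) = b" if s: "s \<in> E" for s
  proof -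
    obtain a b where ab: "s = {a, b}" "a \<in> B" "b \<notin> B" "a \<in> v ` {..g}" "b \<in> v ` {..g}"
      using edge[OF s] by blast
    moreover have "(THE x. x \<in> s \<and> x \<in> B) = a" "(THE x. x \<in> s \<and> x \<notin> B) = b"
      using ab by (auto intro!: the_equality)
    ultimately show ?thesis by blast
  qed
  show ?thesis
  proof
    fix s x assume s: "s \<in> E"
    obtain a b where ab: "s = {a, b}" "a \<in> B" "b \<notin> B" "a \<in> v ` {..g}" "b \<in> v ` {..g}"
      "(THE x. x \<in> s \<and> x \<in> B) = a" "(THE x. x \<in> s \<and> x \<notin> B) = b"
      using *[OF s] by blast
    show "(x \<in> s) = (x = (THE x. x \<in> s \<and> x \<in> B) \<or> x = (THE x. x \<in> s \<and> x \<notin> B))"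
      unfolding ab(6,7) by (simp add: ab(1))
    show "(THE x. x \<in> s \<and> x \<in> B) \<noteq> (THE x. x \<in> s \<and> x \<notin> B)"
      unfolding ab(6,7) using ab(2,3) by blast
    show "x \<in> s \<Longrightarrow> x \<in> v ` {..g}"
      using ab(1,4,5) by blast
    show "(THE x. x \<in> s \<and> x \<in> B) \<in> B \<and> (THE x. x \<in> s \<and> x \<notin> B) \<notin> B"
      unfolding ab(6,7) using ab(2,3) by blast
  qed (use assms(2,3) in auto)
qed

text \<open>Restates the criterion for edges indexed by pairs, so that a concrete graph only has to
  supply polynomial identities for its rows and columns. The list \<open>vs\<close> gives every
  vertex after the first an earlier neighbor, named by \<open>par\<close>, and so certifies a
  spanning tree.\<close>

theorem bipartite_graph_in_class:
  fixes \<alpha> \<beta> :: "nat \<Rightarrow> 'v" and I :: "(nat \<times> nat) set" and c :: nat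
  assumes \<alpha>: "inj_on \<alpha> {..<m}" and \<beta>: "inj_on \<beta> {..<n}" and disj: "\<alpha> ` {..<m} \<inter> \<beta> ` {..<n} = {}"
    and I: "I \<subseteq> {..<m} \<times> {..<n}"
    and vs: "set vs = \<alpha> ` {..<m} \<union> \<beta> ` {..<n}" "distinct vs" "length vs = Suc g"
    and par: "\<And>k. k < g \<Longrightarrow> par k \<le> k \<and> {vs ! Suc k, vs ! par k} \<in> (\<lambda>(i, j). {\<alpha> i, \<beta> j}) ` I"
    and c: "(of_nat c :: 5) dvd 1"
    and identity: "\<And>z :: nat \<Rightarrow> nat \<Rightarrow> nat multiset \<Rightarrow>\<^sub>0 int.
      (\<And>i j. Poly_Mapping.lookup (z i j) {#} = 0) \<Longrightarrow>
      (\<And>i. i < m \<Longrightarrow> (\<Sum>j | (i, j) \<in> I. z i j) = 0) \<Longrightarrow>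
      (\<And>j. j < n \<Longrightarrow> (\<Sum>i | (i, j) \<in> I. z i j) = 0) \<Longrightarrow>
      \<exists>h. (\<forall>i j. (i, j) \<in> I \<longrightarrow> Poly_Mapping.lookup (h i j) {#} = 0) \<and>
        (\<forall>i<m. (\<Sum>j | (i, j) \<in> I. of_nat c * z i j ^ 5 + 5 * (z i j * h i j)) = 0) \<and>
        (\<forall>j. Suc j < n \<longrightarrow> (\<Sum>i | (i, j) \<in> I. of_nat c * z i j ^ 5 + 5 * (z i j * h i j)) = 0)"
  shows "cycle_matroid (V, (\<lambda>(i, j). {\<alpha> i, \<beta> j}) ` I) \<in> matroid_class TYPE(5)"
proof -
  define v where "v = (!) vs"
  have v: "v ` {..g} = \<alpha> ` {..<m} \<union> \<beta> ` {..<n}" "inj_on v {..g}"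
  proof -
    have "{..g} = {..<length vs}" by (auto simp: vs(3))
    then show "v ` {..g} = \<alpha> ` {..<m} \<union> \<beta> ` {..<n}"
      unfolding v_def vs(1)[symmetric] by (auto simp: set_conv_nth)
    show "inj_on v {..g}"
      unfolding v_def by (rule inj_on_nth[OF vs(2)]) (simp add: vs(3))
  qed
  define e where "e = (\<lambda>(i, j). {\<alpha> i, \<beta> j})"
  define E where "E = e ` I"
  define B where "B = \<beta> ` {..<n}"
  have Imn: "i < m" "j < n" if "(i, j) \<in> I" for i j
    using I that by auto
  have \<alpha>B: "\<alpha> i \<notin> B" if "i < m" for i
    using disj that by (auto simp: B_def)
  have \<alpha>\<beta>: "\<alpha> i \<noteq> \<beta> j" if "i < m" "j < n" for i j
    using \<alpha>B[OF that(1)] that(2) by (auto simp: B_def)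
  have \<alpha>_eq: "\<alpha> i = \<alpha> i' \<longleftrightarrow> i = i'" if "i < m" "i' < m" for i i'
    using inj_on_eq_iff[OF \<alpha>, of i i'] that by simp
  have \<beta>_eq: "\<beta> j = \<beta> j' \<longleftrightarrow> j = j'" if "j < n" "j' < n" for j j'
    using inj_on_eq_iff[OF \<beta>, of j j'] that by simp
  have e_inj: "inj_on e I"
  proof (rule inj_onI)
    fix p q assume pq: "p \<in> I" "q \<in> I" "e p = e q"
    obtain i j i' j' where ij: "p = (i, j)" "q = (i', j')" by (cases p, cases q) auto
    then show "p = q"
      using pq Imn[of i j] Imn[of i' j'] \<alpha>_eq[of i i'] \<beta>_eq[of j j'] \<alpha>\<beta>[of i j'] \<alpha>\<beta>[of i' j]
      by (simp add: e_def doubleton_eq_iff)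
  qed
  interpret bipartite_tree E "\<lambda>s. THE x. x \<in> s \<and> x \<in> B" "\<lambda>s. THE x. x \<in> s \<and> x \<notin> B" v g par B
  proof (rule bipartite_treeI)
    fix s assume "s \<in> E"
    then obtain i j where ij: "(i, j) \<in> I" "s = {\<alpha> i, \<beta> j}" by (auto simp: E_def e_def)
    show "\<exists>a b. s = {a, b} \<and> a \<in> B \<and> b \<notin> B \<and> a \<in> v ` {..g} \<and> b \<in> v ` {..g}"
      using ij Imn[OF ij(1)] \<alpha>B unfolding v
      by (intro exI[of _ "\<beta> j"] exI[of _ "\<alpha> i"]) (auto simp: B_def)
  next
    show "\<And>k. k < g \<Longrightarrow> par k \<le> k \<and> {v (Suc k), v (par k)} \<in> E"
      using par by (simp add: E_def e_def v_def)
  qed (rule v(2))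
  have mem_\<alpha>: "\<alpha> k \<in> e (i, j) \<longleftrightarrow> k = i"
    if "(i, j) \<in> I" "k < m" for i j k
    using \<alpha>_eq[of k i] \<alpha>\<beta>[of k j] Imn[OF that(1)] that(2) by (simp_all add: e_def)
  have mem_\<beta>: "\<beta> k \<in> e (i, j) \<longleftrightarrow> k = j" if "(i, j) \<in> I" "k < n" for i j k
    using \<beta>_eq[of k j] \<alpha>\<beta>[of i k] Imn[OF that(1)] that(2) by (auto simp: e_def)
  have mem_star: "s \<in> star x \<longleftrightarrow> (\<exists>i j. (i, j) \<in> I \<and> s = e (i, j) \<and> x \<in> s)" for s x
    unfolding star_def unfolding E_def by auto
  have star_\<alpha>: "star (\<alpha> i) = (\<lambda>j. e (i, j)) ` {j. (i, j) \<in> I}" if i: "i < m" for i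
  proof (intro equalityI subsetI)
    fix s assume "s \<in> star (\<alpha> i)"
    then obtain i' j where s: "(i', j) \<in> I" "s = e (i', j)" "\<alpha> i \<in> s"
      unfolding mem_star by blast
    then have "i = i'" using i mem_\<alpha> by blast
    then show "s \<in> (\<lambda>j. e (i, j)) ` {j. (i, j) \<in> I}" using s(1,2) by simp
  next
    fix s assume "s \<in> (\<lambda>j. e (i, j)) ` {j. (i, j) \<in> I}"
    then show "s \<in> star (\<alpha> i)" unfolding mem_star by (auto simp: e_def)
  qed
  have star_\<beta>: "star (\<beta> j) = (\<lambda>i. e (i, j)) ` {i. (i, j) \<in> I}" if j: "j < n" for j
  proof (intro equalityI subsetI)
    fix s assume "s \<in> star (\<beta> j)"
    then obtain i j' where s: "(i, j') \<in> I" "s = e (i, j')" "\<beta> j \<in> s"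
      unfolding mem_star by blast
    then have "j = j'" using j mem_\<beta> by blast
    then show "s \<in> (\<lambda>i. e (i, j)) ` {i. (i, j) \<in> I}" using s(1,2) by simp
  next
    fix s assume "s \<in> (\<lambda>i. e (i, j)) ` {i. (i, j) \<in> I}"
    then show "s \<in> star (\<beta> j)" unfolding mem_star by (auto simp: e_def)
  qed
  have sum_\<alpha>: "(\<Sum>s\<in>star (\<alpha> i). f s) = (\<Sum>j | (i, j) \<in> I. f (e (i, j)))" if "i < m"
    for i and f :: "'v set \<Rightarrow> nat multiset \<Rightarrow>\<^sub>0 int"
    unfolding star_\<alpha>[OF that]
    by (rule sum.reindex_cong[of "\<lambda>j. e (i, j)"]) (use e_inj in \<open>auto simp: inj_on_def\<close>)
  have sum_\<beta>: "(\<Sum>s\<in>star (\<beta> j). f s) = (\<Sum>i | (i, j) \<in> I. f (e (i, j)))" if "j < n"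
    for j and f :: "'v set \<Rightarrow> nat multiset \<Rightarrow>\<^sub>0 int"
    unfolding star_\<beta>[OF that]
    by (rule sum.reindex_cong[of "\<lambda>i. e (i, j)"]) (use e_inj in \<open>auto simp: inj_on_def\<close>)
  define P where "P l h \<longleftrightarrow> (\<forall>s\<in>E. Poly_Mapping.lookup (h s) {#} = 0) \<and>
      (\<forall>y\<in>v ` {..g}. (\<Sum>s\<in>star y. of_nat c * l s ^ 5 + 5 * (l s * h s)) = 0)"
    for l h :: "'v set \<Rightarrow> nat multiset \<Rightarrow>\<^sub>0 int"
  have ex: "\<exists>h. P l h" if l0: "\<And>s. Poly_Mapping.lookup (l s) {#} = 0"
    and l: "\<And>y. y \<in> v ` {..g} \<Longrightarrow> (\<Sum>s\<in>star y. l s) = 0" for l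
  proof -
    define z where "z i j = l (e (i, j))" for i j
    have zs: "(\<Sum>j | (i, j) \<in> I. z i j) = 0" if "i < m" for i
      using l[of "\<alpha> i"] that unfolding z_def sum_\<alpha>[OF that, symmetric] v by blast
    have zt: "(\<Sum>i | (i, j) \<in> I. z i j) = 0" if "j < n" for j
      using l[of "\<beta> j"] that unfolding z_def sum_\<beta>[OF that, symmetric] v by blast
    obtain h where h0: "\<And>i j. (i, j) \<in> I \<Longrightarrow> Poly_Mapping.lookup (h i j) {#} = 0"
      and ha: "\<And>i. i < m \<Longrightarrow> (\<Sum>j | (i, j) \<in> I. of_nat c * z i j ^ 5 + 5 * (z i j * h i j)) = 0"
      and hb': "\<And>j. Suc j < n \<Longrightarrow> (\<Sum>i | (i, j) \<in> I. of_nat c * z i j ^ 5 + 5 * (z i j * h i j)) = 0"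
      using identity[of z] zs zt l0 unfolding z_def by blast
    define F where "F i j = of_nat c * z i j ^ 5 + 5 * (z i j * h i j)" for i j
    have hb: "(\<Sum>i | (i, j) \<in> I. of_nat c * z i j ^ 5 + 5 * (z i j * h i j)) = 0" if j: "j < n" for j
    proof (cases "Suc j < n")
      case False
      then have n: "n = Suc j" using j by simp
      \<comment> \<open>Row sums and column sums of F have the same total, so the last column sum
        vanishes with all the others.\<close>
      have "(\<Sum>j'<n. \<Sum>i | i \<in> {..<m} \<and> (i, j') \<in> I. F i j') = (\<Sum>i<m. \<Sum>j' | j' \<in> {..<n} \<and> (i, j') \<in> I.
          F i j')"
        by (rule sum.swap_restrict) auto
      also have "\<dots> = (\<Sum>i<m. \<Sum>j' | (i, j') \<in> I. F i j')"
        using Imn by (intro sum.cong refl) auto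
      also have "\<dots> = 0" using ha by (simp add: F_def)
      also have "(\<Sum>j'<n. \<Sum>i | i \<in> {..<m} \<and> (i, j') \<in> I. F i j') = (\<Sum>j'<n. \<Sum>i | (i, j') \<in> I. F i j')"
        using Imn by (intro sum.cong refl) auto
      also have "\<dots> = (\<Sum>i | (i, j) \<in> I. F i j)"
        using hb' by (simp add: n F_def)
      finally show ?thesis by (simp add: F_def)
    qed (rule hb')
    define H where "H s = (case inv_into I e s of (i, j) \<Rightarrow> h i j)" for s
    have H: "H (e (i, j)) = h i j" if "(i, j) \<in> I" for i j
      by (simp add: H_def inv_into_f_f[OF e_inj that])
    have "P l H"
      unfolding P_def
    proof (intro conjI ballI)
      fix s assume "s \<in> E"
      then obtain i j where "(i, j) \<in> I" "s = e (i, j)" unfolding E_def by auto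
      then show "Poly_Mapping.lookup (H s) {#} = 0" by (simp add: H h0)
    next
      fix y assume "y \<in> v ` {..g}"
      then consider i where "i < m" "y = \<alpha> i" | j where "j < n" "y = \<beta> j" unfolding v by auto
      then show "(\<Sum>s\<in>star y. of_nat c * l s ^ 5 + 5 * (l s * H s)) = 0"
      proof cases
        case 1
        have "(\<Sum>s\<in>star y. of_nat c * l s ^ 5 + 5 * (l s * H s))
            = (\<Sum>j | (i, j) \<in> I. of_nat c * z i j ^ 5 + 5 * (z i j * h i j))"
          unfolding 1(2) sum_\<alpha>[OF 1(1)] by (intro sum.cong refl) (simp add: z_def H)
        then show ?thesis by (simp only: ha[OF 1(1)])
      next
        case 2
        have "(\<Sum>s\<in>star y. of_nat c * l s ^ 5 + 5 * (l s * H s))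
            = (\<Sum>i | (i, j) \<in> I. of_nat c * z i j ^ 5 + 5 * (z i j * h i j))"
          unfolding 2(2) sum_\<beta>[OF 2(1)] by (intro sum.cong refl) (simp add: z_def H)
        then show ?thesis by (simp only: hb[OF 2(1)])
      qed
    qed
    then show ?thesis by (rule exI[of "P l" H])
  qed
  have "cycle_matroid (V, E) \<in> matroid_class TYPE(5)"
    by (rule cycle_matroid_in_class[OF c]) (use ex in \<open>auto simp: P_def\<close>)
  then show ?thesis by (simp only: E_def e_def)
qed

section \<open>Frobenius lifts on the flows of the three graphs\<close>

text \<open>
  The cofactors below were found by linear algebra over the rationals, imposing equivariance under
  the automorphisms of the graph (fixing one vertex of degree 3 for \<open>K\<^bsub>3,5\<^esub>\<close>) and searching for
  sparse solutions. The functions ending in \<open>h\<close> belong to the edges at the last vertex, whose own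
  equation then follows from the others.
\<close>

definition k35_g :: "(nat \<Rightarrow> 'a::comm_ring_1) \<Rightarrow> (nat \<Rightarrow> 'a) \<Rightarrow> (nat \<Rightarrow> 'a) \<Rightarrow> nat \<Rightarrow> nat \<Rightarrow> nat \<Rightarrow> nat \<Rightarrow> 'a"
    where
  "k35_g a b c j k l m = 6 * (b j * c k * c l * c m + c j * b k * b l * b m) - a j^2 * b j * c j
     + (\<Sum>(x, y, w)\<leftarrow>[(k, l, m), (l, k, m), (m, k, l)].
         4 * a x * (b j * c y * c w + c j * b y * b w) - 2 * a x * (b x * c y * c w + c x * b y * b w)
         + 3 * a x^2 * b j * c j - 2 * a y * a w * b x * c x - 2 * a j^2 * a x^2 + 2 * a j^2 * b x *
             c x)"

definition k35_h :: "(nat \<Rightarrow> 'a::comm_ring_1) \<Rightarrow> (nat \<Rightarrow> 'a) \<Rightarrow> (nat \<Rightarrow> 'a) \<Rightarrow> 'a \<Rightarrow> nat \<Rightarrow> nat \<Rightarrow> nat \<Rightarrow> nat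
    \<Rightarrow> 'a" where
  "k35_h a b c r j k l m =
     (\<Sum>x\<leftarrow>[j, k, l, m]. 3 * a x * r * b x * c x + 2 * r^2 * b x * c x)
     + (\<Sum>(x, y, u, w)\<leftarrow>[(j, k, l, m), (j, l, k, m), (j, m, k, l), (k, l, j, m), (k, m, j, l), (l, m,
         j, k)].
         2 * a x * a y * (a x + a y) * r - 2 * b x * b y * c u * c w
         - 6 * a x * a y * (b u * c u + b w * c w))
     - 12 * a j * a k * a l * a m"

definition g1_g :: "(nat \<Rightarrow> nat \<Rightarrow> 'a::comm_ring_1) \<Rightarrow> nat \<Rightarrow> nat \<Rightarrow> nat \<Rightarrow> nat \<Rightarrow> 'a" where
  "g1_g z i j k l =
     3 * z i j * z j i * z k j * z l j + 2 * z i j^2 * z k i * z l i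
     + 3 * (z i k * z j i * z k j * z l j + z i l * z j i * z k j * z l j)
     + 6 * (z j k * z k j * z k l * z l k + z j l * z k l * z l j * z l k)
     + 3 * (z i j * z j k * z k j * z l j + z i j * z j l * z k j * z l j)
     + 3 * (z k j * z k l^2 * z l j + z k j * z l j * z l k^2) + 2 * (z i j^2 * z i k * z l k
     + z i j^2 * z i l * z k l) - 2 * z i j^2 * z j i^2 - 3 * (z j k * z k j * z k l * z l j
     + z j l * z k j * z l j * z l k) - 6 * (z i k * z j i * z j k * z k i
     + z i l * z j i * z j l * z l i) - 6 * (z i k * z j i * z k i * z l j
     + z i l * z j i * z k j * z l i) - 3 * (z j k * z k j * z l j * z l k
     + z j l * z k j * z k l * z l j) - 6 * z j k * z j l * z k l * z l k - z i j^2 * z k j * z l j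
     - 2 * (z i j^2 * z j k^2 + z i j^2 * z j l^2)"

definition g2_g :: "(nat \<Rightarrow> nat \<Rightarrow> 'a::comm_ring_1) \<Rightarrow> nat \<Rightarrow> nat \<Rightarrow> nat \<Rightarrow> nat \<Rightarrow> 'a" where
  "g2_g z i j k l =
     9 * (z i k * z i l * z j k^2 + z i k * z i l * z j l^2) + 9 * z i k * z i l * z j i^2
     + 6 * (z i j^2 * z k j * z k l + z i j^2 * z l j * z l k) - 6 * (z i j^2 * z j k^2
     + z i j^2 * z j l^2) - 6 * (z i j^2 * z k i^2 + z i j^2 * z l i^2) - 4 * (z i j * z i k^3
     + z i j * z i l^3) - 6 * z i j^2 * z j k * z j l"

definition g1_h :: "(nat \<Rightarrow> nat \<Rightarrow> 'a::comm_ring_1) \<Rightarrow> nat \<Rightarrow> nat \<Rightarrow> nat \<Rightarrow> nat \<Rightarrow> 'a" where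
  "g1_h z i j k l =
     2 * (z i j^2 * z i k * z i 4 + z i j^2 * z i l * z i 4 + z i j * z i k^2 * z i 4
     + z i j * z i l^2 * z i 4 + z i k^2 * z i l * z i 4 + z i k * z i l^2 * z i 4)
     + 3 * (z i j^2 * z j k * z l k + z i j^2 * z j l * z k l + z i k^2 * z j l * z k l
     + z i k^2 * z k j * z l j + z i l^2 * z j k * z l k + z i l^2 * z k j * z l j)
     + 6 * (z i j * z i k * z l i^2 + z i j * z i l * z k i^2 + z i k * z i l * z j i^2)
     + 6 * (z j k * z j l * z k j * z l j + z j k * z k j * z k l * z l k
     + z j l * z k l * z l j * z l k) + 3 * (z i j * z j i * z k j * z l j
     + z i k * z j k * z k i * z l k + z i l * z j l * z k l * z l i) - (z i 4^2 * z j k * z l k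
     + z i 4^2 * z j l * z k l + z i 4^2 * z k j * z l j) - 6 * (z j k * z j l * z k l * z l k
     + z j k * z k j * z l j * z l k + z j l * z k j * z k l * z l j)
     - 3 * (z i j * z k j * z k l * z l j + z i j * z k j * z l j * z l k
     + z i k * z j k * z j l * z l k + z i k * z j k * z l j * z l k + z i l * z j k * z j l * z k l
     + z i l * z j l * z k j * z k l) - (z i 4^2 * z j i^2 + z i 4^2 * z k i^2 + z i 4^2 * z l i^2)"

definition g2_h :: "'a \<Rightarrow> (nat \<Rightarrow> nat \<Rightarrow> 'a::comm_ring_1) \<Rightarrow> nat \<Rightarrow> nat \<Rightarrow> nat \<Rightarrow> nat \<Rightarrow> 'a" where
  "g2_h r z i j k l =
     2 * (r * z i j^3 + r * z j i^3) + 9 * (z i j^2 * z i k^2 + z i j^2 * z i l^2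
     + z j i^2 * z j k^2 + z j i^2 * z j l^2) + 6 * (r^2 * z k i * z k j + r^2 * z l i * z l j)
     + 18 * (z i j * z j i * z k l^2 + z i j * z j i * z l k^2) - 18 * z i k * z i l * z j k * z j l
     - 3 * (r^2 * z i k^2 + r^2 * z i l^2 + r^2 * z j k^2 + r^2 * z j l^2) - 6 * (r^2 * z k l^2
     + r^2 * z l k^2) - 18 * (z i j * z j i * z k i * z k j + z i j * z j i * z l i * z l j)"

text \<open>The first argument of \<open>k35_g\<close> is the row of the edge and j its column; the
  other arguments are the remaining rows and the remaining columns below 4. Eliminating the row c
  leaves a polynomial identity in a and b, and by equivariance it serves all four columns.\<close>

lemma k35_column:
  fixes a b c :: "nat \<Rightarrow> 'a::comm_ring_1"
  assumes "c j = - a j - b j" "c k = - a k - b k" "c l = - a l - b l" "c m = - a m - b m"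
  shows "(2 * a j^5 + 5 * (a j * k35_g a b c j k l m)) + (2 * b j^5 + 5 * (b j * k35_g b a c j k l m))
    + (2 * c j^5 + 5 * (c j * k35_g c a b j k l m)) = 0"
  unfolding k35_g_def list.map sum_list.Cons sum_list.Nil prod.case assms
  by (simp add: algebra_simps power_numeral_reduce)

text \<open>r is the entry in the last column, so \<open>k35_h\<close> has to balance the four
  cofactors that already satisfy the column identities.\<close>

lemma k35_row:
  fixes a b c :: "nat \<Rightarrow> 'a::comm_ring_1"
  assumes "c j = - a j - b j" "c k = - a k - b k" "c l = - a l - b l" "c m = - a m - b m"
    "r = - (a j + a k + a l + a m)"
  shows "(2 * a j^5 + 5 * (a j * k35_g a b c j k l m)) + (2 * a k^5 + 5 * (a k * k35_g a b c k j l m))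
    + (2 * a l^5 + 5 * (a l * k35_g a b c l j k m)) + (2 * a m^5 + 5 * (a m * k35_g a b c m j k l))
    + (2 * r^5 + 5 * (r * k35_h a b c r j k l m)) = 0"
  unfolding k35_g_def k35_h_def list.map sum_list.Cons sum_list.Nil prod.case assms
  by (simp add: algebra_simps power_numeral_reduce)

text \<open>In the applications i, j, k, l are the indices 0 to 3 in some order, and the diagonal
  entries of z correspond to missing edges. Each hypothesis solves one of the four column equations
  for one unknown, which leaves eight free variables; \<open>g1_row\<close> adds the entry in column
  4.\<close>

lemma g1_column:
  fixes z :: "nat \<Rightarrow> nat \<Rightarrow> 'a::comm_ring_1"
  assumes "z l i = - (z j i + z k i)" "z l j = - (z i j + z k j)" "z l k = - (z i k + z j k)" "z k l
      = - (z i l + z j l)"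
  shows "(2 * z i j^5 + 5 * (z i j * g1_g z i j k l)) + (2 * z k j^5 + 5 * (z k j * g1_g z k j i l))
    + (2 * z l j^5 + 5 * (z l j * g1_g z l j i k)) = 0"
  unfolding g1_g_def assms
  by (simp add: algebra_simps power_numeral_reduce)

lemma g1_row:
  fixes z :: "nat \<Rightarrow> nat \<Rightarrow> 'a::comm_ring_1"
  assumes "z l i = - (z j i + z k i)" "z l j = - (z i j + z k j)" "z l k = - (z i k + z j k)" "z k l
      = - (z i l + z j l)"
    "z i 4 = - (z i j + z i k + z i l)"
  shows "(2 * z i j^5 + 5 * (z i j * g1_g z i j k l)) + (2 * z i k^5 + 5 * (z i k * g1_g z i k j l))
    + (2 * z i l^5 + 5 * (z i l * g1_g z i l j k)) + (2 * z i 4^5 + 5 * (z i 4 * g1_h z i j k l)) = 0"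
  unfolding g1_g_def g1_h_def assms
  by (simp add: algebra_simps power_numeral_reduce)

text \<open>Here \<open>z u v\<close> is the flow on the edge from \<open>Old u\<close> to
  \<open>Mid {u, v}\<close>, so the row i of z is the star of \<open>Old i\<close>.\<close>

lemma g2_row:
  fixes z :: "nat \<Rightarrow> nat \<Rightarrow> 'a::comm_ring_1"
  assumes "z i l = - (z i j + z i k)" "z j l = - (z j i + z j k)" "z k l = - (z k i + z k j)" "z l k
      = - (z l i + z l j)"
  shows "(4 * z i j^5 + 5 * (z i j * g2_g z i j k l)) + (4 * z i k^5 + 5 * (z i k * g2_g z i k j l))
    + (4 * z i l^5 + 5 * (z i l * g2_g z i l j k)) = 0"
  unfolding g2_g_def assms
  by (simp add: algebra_simps power_numeral_reduce)

text \<open>This is the equation at \<open>Mid {i, j}\<close>, whose third edge leads to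
  \<open>Apex\<close> and carries r.\<close>

lemma g2_pair:
  fixes z :: "nat \<Rightarrow> nat \<Rightarrow> 'a::comm_ring_1"
  assumes "z i l = - (z i j + z i k)" "z j l = - (z j i + z j k)" "z k l = - (z k i + z k j)" "z l k
      = - (z l i + z l j)"
    "r = - (z i j + z j i)"
  shows "(4 * z i j^5 + 5 * (z i j * g2_g z i j k l)) + (4 * z j i^5 + 5 * (z j i * g2_g z j i k l))
    + (4 * r^5 + 5 * (r * g2_h r z i j k l)) = 0"
  unfolding g2_g_def g2_h_def assms
  by (simp add: algebra_simps power_numeral_reduce)

section \<open>The three graphs\<close>

text \<open>A sum of multisets is empty only if both summands are, so a factor without constant term
  yields a product without constant term; the constant of f is split off to use this.\<close>

lemma lookup_mult_empty:
  fixes f h :: "nat multiset \<Rightarrow>\<^sub>0 int"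
  shows "Poly_Mapping.lookup (f * h) {#} = Poly_Mapping.lookup f {#} * Poly_Mapping.lookup h {#}"
proof -
  define s where "s = Poly_Mapping.lookup f {#}"
  define f' where "f' = f - Poly_Mapping.single 0 s"
  have "{#} \<notin> Poly_Mapping.keys (f' * h)"
  proof
    assume "{#} \<in> Poly_Mapping.keys (f' * h)"
    then obtain a b where "a \<in> Poly_Mapping.keys f'" "{#} = a + b"
      using keys_mult[of f' h] by blast
    then show False by (simp add: in_keys_iff f'_def s_def lookup_minus)
  qed
  then have "Poly_Mapping.lookup (f' * h) {#} = 0" by (simp add: in_keys_iff)
  moreover have "f * h = Poly_Mapping.single 0 s * h + f' * h"
    by (simp add: f'_def algebra_simps)
  moreover have "Poly_Mapping.lookup (Poly_Mapping.single 0 s * h) {#} = s * Poly_Mapping.lookup h {#}"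
    by (simp add: map.rep_eq when_def flip: mult_map_scale_conv_mult)
  ultimately show ?thesis by (simp add: lookup_add s_def)
qed

lemma lookup_power_empty:
  fixes f :: "nat multiset \<Rightarrow>\<^sub>0 int"
  shows "Poly_Mapping.lookup (f ^ k) {#} = Poly_Mapping.lookup f {#} ^ k"
  by (induction k) (simp_all add: lookup_mult_empty lookup_one)

lemmas lookup_empty_simps = lookup_add lookup_minus lookup_mult_empty lookup_power_empty

lemma const_k35_g:
  fixes a b c :: "nat \<Rightarrow> nat multiset \<Rightarrow>\<^sub>0 int"
  assumes "\<And>t. Poly_Mapping.lookup (a t) {#} = 0" "\<And>t. Poly_Mapping.lookup (b t) {#} = 0"
    "\<And>t. Poly_Mapping.lookup (c t) {#} = 0"
  shows "Poly_Mapping.lookup (k35_g a b c j k l m) {#} = 0"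
  unfolding k35_g_def list.map sum_list.Cons sum_list.Nil prod.case lookup_empty_simps assms by simp

lemma const_k35_h:
  fixes a b c :: "nat \<Rightarrow> nat multiset \<Rightarrow>\<^sub>0 int"
  assumes "\<And>t. Poly_Mapping.lookup (a t) {#} = 0" "\<And>t. Poly_Mapping.lookup (b t) {#} = 0"
    "\<And>t. Poly_Mapping.lookup (c t) {#} = 0" "Poly_Mapping.lookup r {#} = 0"
  shows "Poly_Mapping.lookup (k35_h a b c r j k l m) {#} = 0"
  unfolding k35_h_def list.map sum_list.Cons sum_list.Nil prod.case lookup_empty_simps assms by simp

lemma sum_zero_solve:
  fixes a b c :: "'a::comm_ring_1"
  assumes "a + b + c = 0"
  shows "a = - (b + c)" "b = - (a + c)" "c = - (a + b)"
proof -
  have "a + (b + c) = 0" "b + (a + c) = 0" "c + (a + b) = 0"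
    using assms by (simp_all only: add_ac)
  then show "a = - (b + c)" "b = - (a + c)" "c = - (a + b)"
    by (simp_all only: eq_neg_iff_add_eq_0)
qed

theorem k35_in_class: "cycle_matroid (complete_bipartite 3 5) \<in> matroid_class TYPE(5)"
proof -
  define I :: "(nat \<times> nat) set" where "I = {..<3} \<times> {..<5}"
  have row: "(\<Sum>j | (i, j) \<in> I. f j) = f 0 + f 1 + f 2 + f 3 + f 4" if "i < 3"
    for i and f :: "nat \<Rightarrow> nat multiset \<Rightarrow>\<^sub>0 int"
  proof -
    have "{j. (i, j) \<in> I} = {0, 1, 2, 3, 4}" using that by (auto simp: I_def)
    then show ?thesis by (simp add: add.assoc)
  qed
  have col: "(\<Sum>i | (i, j) \<in> I. f i) = f 0 + f 1 + f 2" if "j < 5"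
    for j and f :: "nat \<Rightarrow> nat multiset \<Rightarrow>\<^sub>0 int"
  proof -
    have "{i. (i, j) \<in> I} = {0, 1, 2}" using that by (auto simp: I_def)
    then show ?thesis by (simp add: add.assoc)
  qed
  have "cycle_matroid (fst (complete_bipartite 3 5), (\<lambda>(i, j). {Inl i, Inr j}) ` I) \<in> matroid_class
      TYPE(5)"
  \<comment> \<open>The spanning tree is the star of \<open>Inl 0\<close> together with the edges
    from \<open>Inr 0\<close> to \<open>Inl 1\<close> and \<open>Inl 2\<close>.\<close>
  proof (rule bipartite_graph_in_class[where m = 3 and n = 5 and c = 2 and g = 7
        and vs = "[Inl 0, Inr 0, Inr 1, Inr 2, Inr 3, Inr 4, Inl 1, Inl 2]"
        and par = "\<lambda>k. if k < 5 then 0 else 1"])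
    show "set [Inl 0, Inr 0, Inr 1, Inr 2, Inr 3, Inr 4, Inl 1, Inl 2] = Inl ` {..<3 :: nat} \<union> Inr `
        {..<5 :: nat}"
    proof -
      have "{..<3 :: nat} = {0, 1, 2}" "{..<5 :: nat} = {0, 1, 2, 3, 4}" by auto
      then show ?thesis by auto
    qed
    fix k :: nat assume "k < 7"
    then have "k \<in> {0, 1, 2, 3, 4, 5, 6}" by auto
    then show "(if k < 5 then 0 else 1) \<le> k \<and>
       {[Inl 0, Inr 0, Inr 1, Inr 2, Inr 3, Inr 4, Inl 1, Inl 2] ! Suc k,
        [Inl 0, Inr 0, Inr 1, Inr 2, Inr 3, Inr 4, Inl 1, Inl 2] ! (if k < 5 then 0 else 1)}
       \<in> (\<lambda>(i, j). {Inl i, Inr j}) ` I"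
      by (auto simp: I_def image_iff doubleton_eq_iff)
  next
    have "(of_nat 2 :: 5) * 3 = 1" by simp
    then show "(of_nat 2 :: 5) dvd 1" by (metis dvd_triv_left)
  next
    fix z :: "nat \<Rightarrow> nat \<Rightarrow> nat multiset \<Rightarrow>\<^sub>0 int"
    assume z0: "\<And>i j. Poly_Mapping.lookup (z i j) {#} = 0"
      and za: "\<And>i. i < 3 \<Longrightarrow> (\<Sum>j | (i, j) \<in> I. z i j) = 0"
      and zb: "\<And>j. j < 5 \<Longrightarrow> (\<Sum>i | (i, j) \<in> I. z i j) = 0"
    have r: "z i 0 + z i 1 + z i 2 + z i 3 + z i 4 = 0" if "i < 3" for i
      using za[OF that] unfolding row[OF that] .
    have c: "z 0 j + z 1 j + z 2 j = 0" if "j < 5" for j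
      using zb[OF that] unfolding col[OF that] .
    have r4: "z i 4 = - (z i 0 + z i 1 + z i 2 + z i 3)" if "i < 3" for i
      using r[OF that] by (simp only: eq_neg_iff_add_eq_0 add_ac)
    have c12: "z 2 j = - z 0 j - z 1 j" and c21: "z 2 j = - z 1 j - z 0 j"
      and c20: "z 1 j = - z 2 j - z 0 j" if "j < 5" for j
      using sum_zero_solve(2,3)[OF c[OF that]] by (simp_all only: minus_add_distrib add.commute
          diff_conv_add_uminus)
    define H where "H a b c r j = (if j = 0 then k35_g a b c 0 1 2 3 else if j = 1 then k35_g a b c
        1 0 2 3
      else if j = 2 then k35_g a b c 2 0 1 3 else if j = 3 then k35_g a b c 3 0 1 2 else k35_h a b c
          r 0 1 2 3)"
      for a b c :: "nat \<Rightarrow> nat multiset \<Rightarrow>\<^sub>0 int" and r and j :: nat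
    \<comment> \<open>The row of the edge comes first, then the other two rows in increasing order;
      this is the order in which \<open>H_row\<close> and \<open>H_col\<close> fit
      literally.\<close>
    define h where "h i j = (if i = 0 then H (z 0) (z 1) (z 2) (z 0 4) j
      else if i = 1 then H (z 1) (z 0) (z 2) (z 1 4) j else H (z 2) (z 0) (z 1) (z 2 4) j)" for i j
          :: nat
    have H: "H a b c r 0 = k35_g a b c 0 1 2 3" "H a b c r 1 = k35_g a b c 1 0 2 3"
      "H a b c r 2 = k35_g a b c 2 0 1 3" "H a b c r 3 = k35_g a b c 3 0 1 2" "H a b c r 4 = k35_h a
          b c r 0 1 2 3"
      for a b c r by (simp_all add: H_def)
    have h: "h 0 j = H (z 0) (z 1) (z 2) (z 0 4) j" "h 1 j = H (z 1) (z 0) (z 2) (z 1 4) j"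
      "h 2 j = H (z 2) (z 0) (z 1) (z 2 4) j" for j
      by (simp_all add: h_def)
    have H_row: "(2 * a 0^5 + 5 * (a 0 * H a b c r 0)) + (2 * a 1^5 + 5 * (a 1 * H a b c r 1))
        + (2 * a 2^5 + 5 * (a 2 * H a b c r 2)) + (2 * a 3^5 + 5 * (a 3 * H a b c r 3))
        + (2 * r^5 + 5 * (r * H a b c r 4)) = 0"
      if "\<And>j. j < 5 \<Longrightarrow> c j = - a j - b j" "r = - (a 0 + a 1 + a 2 + a 3)" for a b c r
      unfolding H by (rule k35_row) (use that in simp_all)
    \<comment> \<open>r, s, t stand for the entries of the three rows in the last column.\<close>
    have H_col: "(2 * a j^5 + 5 * (a j * H a b c r j)) + (2 * b j^5 + 5 * (b j * H b a c s j))
        + (2 * c j^5 + 5 * (c j * H c a b t j)) = 0"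
      if abc: "\<And>j. j < 5 \<Longrightarrow> c j = - a j - b j" and j: "Suc j < 5" for a b c r s t j
    proof -
      have "j = 0 \<or> j = 1 \<or> j = 2 \<or> j = 3" using j by auto
      then show ?thesis
      proof (elim disjE)
        assume j: "j = 0" show ?thesis unfolding j H by (rule k35_column) (simp_all add: abc)
      next
        assume j: "j = 1" show ?thesis unfolding j H by (rule k35_column) (simp_all add: abc)
      next
        assume j: "j = 2" show ?thesis unfolding j H by (rule k35_column) (simp_all add: abc)
      next
        assume j: "j = 3" show ?thesis unfolding j H by (rule k35_column) (simp_all add: abc)
      qed
    qed
    show "\<exists>h. (\<forall>i j. (i, j) \<in> I \<longrightarrow> Poly_Mapping.lookup (h i j) {#} = 0) \<and>
        (\<forall>i<3. (\<Sum>j | (i, j) \<in> I. of_nat 2 * z i j ^ 5 + 5 * (z i j * h i j)) = 0) \<and>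
        (\<forall>j. Suc j < 5 \<longrightarrow> (\<Sum>i | (i, j) \<in> I. of_nat 2 * z i j ^ 5 + 5 * (z i j * h i j)) = 0)"
    proof (intro exI[of _ h] conjI allI impI)
      fix i j
      show "Poly_Mapping.lookup (h i j) {#} = 0"
        by (simp add: h_def H_def const_k35_g const_k35_h z0)
    next
      fix i :: nat assume i: "i < 3"
      then consider "i = 0" | "i = 1" | "i = 2" by linarith
      then show "(\<Sum>j | (i, j) \<in> I. of_nat 2 * z i j ^ 5 + 5 * (z i j * h i j)) = 0"
      proof cases
        case 1
        show ?thesis
          unfolding row[OF i] unfolding 1 h of_nat_numeral
          by (rule H_row, erule c12, rule r4[OF i, unfolded 1])
      next
        case 2
        show ?thesis
          unfolding row[OF i] unfolding 2 h of_nat_numeral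
          by (rule H_row, erule c21, rule r4[OF i, unfolded 2])
      next
        case 3
        show ?thesis
          unfolding row[OF i] unfolding 3 h of_nat_numeral
          by (rule H_row, erule c20, rule r4[OF i, unfolded 3])
      qed
    next
      fix j :: nat assume j: "Suc j < 5"
      then have j5: "j < 5" by simp
      show "(\<Sum>i | (i, j) \<in> I. of_nat 2 * z i j ^ 5 + 5 * (z i j * h i j)) = 0"
        unfolding col[OF j5] h of_nat_numeral by (rule H_col, erule c12, rule j)
    qed
  qed (auto simp: inj_on_def I_def)
  moreover have "(\<lambda>(i, j). {Inl i, Inr j}) ` I = snd (complete_bipartite 3 5)"
    by (auto simp: I_def complete_bipartite_def image_iff)
  ultimately show ?thesis by simp
qed

lemma const_g1:
  fixes z :: "nat \<Rightarrow> nat \<Rightarrow> nat multiset \<Rightarrow>\<^sub>0 int"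
  assumes "\<And>i j. Poly_Mapping.lookup (z i j) {#} = 0"
  shows "Poly_Mapping.lookup (g1_g z i j k l) {#} = 0" "Poly_Mapping.lookup (g1_h z i j k l) {#} = 0"
  unfolding g1_g_def g1_h_def lookup_empty_simps assms by simp_all

lemma const_g2:
  fixes z :: "nat \<Rightarrow> nat \<Rightarrow> nat multiset \<Rightarrow>\<^sub>0 int"
  assumes "\<And>i j. Poly_Mapping.lookup (z i j) {#} = 0" "Poly_Mapping.lookup r {#} = 0"
  shows "Poly_Mapping.lookup (g2_g z i j k l) {#} = 0" "Poly_Mapping.lookup (g2_h r z i j k l) {#} = 0"
  unfolding g2_g_def g2_h_def lookup_empty_simps assms by simp_all

theorem G1_in_class: "cycle_matroid G\<^sub>1 \<in> matroid_class TYPE(5)"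
proof -
  \<comment> \<open>Column j < 4 is the vertex not adjacent to row j, and column 4 is the vertex 9.
    Thus the graph is K_{4,5} without the matching formed by the pairs (i, i), and its symmetry
    permutes the indices 0 to 3 simultaneously in rows and columns.\<close>
  define I :: "(nat \<times> nat) set" where
    "I = {(0, 3), (1, 3), (2, 3), (0, 2), (1, 2), (3, 2), (0, 1), (2, 1), (3, 1), (1, 0), (2, 0),
      (3, 0), (0, 4), (1, 4), (2, 4), (3, 4)}"
  have row_sets: "{j. (0, j) \<in> I} = {1, 2, 3, 4}" "{j. (1, j) \<in> I} = {0, 2, 3, 4}"
      "{j. (2, j) \<in> I} = {0, 1, 3, 4}" "{j. (3, j) \<in> I} = {0, 1, 2, 4}"
    unfolding I_def by auto
  have col_sets: "{i. (i, 0) \<in> I} = {1, 2, 3}" "{i. (i, 1) \<in> I} = {0, 2, 3}"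
      "{i. (i, 2) \<in> I} = {0, 1, 3}" "{i. (i, 3) \<in> I} = {0, 1, 2}"
      "{i. (i, 4) \<in> I} = {0, 1, 2, 3}"
    unfolding I_def by auto
  have rows: "(\<Sum>j | (0, j) \<in> I. f j) = f 1 + f 2 + f 3 + f 4"
      "(\<Sum>j | (1, j) \<in> I. f j) = f 0 + f 2 + f 3 + f 4"
      "(\<Sum>j | (2, j) \<in> I. f j) = f 0 + f 1 + f 3 + f 4"
      "(\<Sum>j | (3, j) \<in> I. f j) = f 0 + f 1 + f 2 + f 4"
    for f :: "nat \<Rightarrow> nat multiset \<Rightarrow>\<^sub>0 int"
    unfolding row_sets by (simp_all add: add.assoc)
  have cols: "(\<Sum>i | (i, 0) \<in> I. f i) = f 1 + f 2 + f 3"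
      "(\<Sum>i | (i, 1) \<in> I. f i) = f 0 + f 2 + f 3"
      "(\<Sum>i | (i, 2) \<in> I. f i) = f 0 + f 1 + f 3"
      "(\<Sum>i | (i, 3) \<in> I. f i) = f 0 + f 1 + f 2"
    for f :: "nat \<Rightarrow> nat multiset \<Rightarrow>\<^sub>0 int"
    unfolding col_sets by (simp_all add: add.assoc)
  \<comment> \<open>In the spanning tree, 9 is joined to 1, 2, 3, 4; the vertices 7, 6, 5 hang from
    1, and 8, not adjacent to 1, hangs from 2.\<close>
  let ?a = "\<lambda>i::nat. i + 1 :: nat" and ?b = "\<lambda>j::nat. if j = 4 then 9 else 8 - j :: nat"
    and ?vs = "[9, 1, 2, 3, 4, 8, 7, 6, 5 :: nat]"
    and ?par = "\<lambda>k::nat. if k < 4 then 0 else if k = 4 then 2 else 1 :: nat"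
  have L: "{..<4} = {0, 1, 2, 3 :: nat}" "{..<5} = {0, 1, 2, 3, 4 :: nat}" "{..<6} = {0, 1, 2, 3, 4,
      5 :: nat}"
    by auto
  have "cycle_matroid (fst G\<^sub>1, (\<lambda>(i, j). {?a i, ?b j}) ` I) \<in> matroid_class TYPE(5)"
  proof (rule bipartite_graph_in_class[where \<alpha> = "?a" and \<beta> = "?b" and m = 4 and n = 5
        and c = 2 and g = 8 and vs = "?vs" and par = "?par"])
    show "inj_on ?a {..<4}" unfolding L by (simp add: inj_on_def)
    show "inj_on ?b {..<5}" unfolding L by (simp add: inj_on_def)
    show "?a ` {..<4} \<inter> ?b ` {..<5} = {}" unfolding L by simp
    show "I \<subseteq> {..<4} \<times> {..<5}" by (simp add: I_def)
    show "set ?vs = ?a ` {..<4} \<union> ?b ` {..<5}" unfolding L by auto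
    show "distinct ?vs" by simp
    show "length ?vs = Suc 8" by simp
  next
    fix k :: nat assume "k < 8"
    then have "k \<in> {0, 1, 2, 3, 4, 5, 6, 7}" by auto
    then show "?par k \<le> k \<and> {?vs ! Suc k, ?vs ! ?par k} \<in> (\<lambda>(i, j). {?a i, ?b j}) ` I"
      unfolding I_def by (elim insertE) (simp_all add: doubleton_eq_iff)
  next
    have "(of_nat 2 :: 5) * 3 = 1" by simp
    then show "(of_nat 2 :: 5) dvd 1" by (metis dvd_triv_left)
  next
    fix w :: "nat \<Rightarrow> nat \<Rightarrow> nat multiset \<Rightarrow>\<^sub>0 int"
    assume w0: "\<And>i j. Poly_Mapping.lookup (w i j) {#} = 0"
      and wa: "\<And>i. i < 4 \<Longrightarrow> (\<Sum>j | (i, j) \<in> I. w i j) = 0"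
      and wb: "\<And>j. j < 5 \<Longrightarrow> (\<Sum>i | (i, j) \<in> I. w i j) = 0"
    have a0: "w 0 1 + w 0 2 + w 0 3 + w 0 4 = 0"
      by (rule wa[of 0, unfolded rows]) simp
    have a1: "w 1 0 + w 1 2 + w 1 3 + w 1 4 = 0"
      by (rule wa[of 1, unfolded rows]) simp
    have a2: "w 2 0 + w 2 1 + w 2 3 + w 2 4 = 0"
      by (rule wa[of 2, unfolded rows]) simp
    have a3: "w 3 0 + w 3 1 + w 3 2 + w 3 4 = 0"
      by (rule wa[of 3, unfolded rows]) simp
    have b0: "w 1 0 + w 2 0 + w 3 0 = 0"
      by (rule wb[of 0, unfolded cols]) simp
    have b1: "w 0 1 + w 2 1 + w 3 1 = 0"
      by (rule wb[of 1, unfolded cols]) simp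
    have b2: "w 0 2 + w 1 2 + w 3 2 = 0"
      by (rule wb[of 2, unfolded cols]) simp
    have b3: "w 0 3 + w 1 3 + w 2 3 = 0"
      by (rule wb[of 3, unfolded cols]) simp
    note flow = a0 a1 a2 a3 b0 b1 b2 b3
    define h where "h i j = (if i = 0 \<and> j = 1 then g1_g w 0 1 2 3 else
      if i = 0 \<and> j = 2 then g1_g w 0 2 1 3 else
      if i = 0 \<and> j = 3 then g1_g w 0 3 1 2 else
      if i = 0 \<and> j = 4 then g1_h w 0 1 2 3 else
      if i = 1 \<and> j = 0 then g1_g w 1 0 2 3 else
      if i = 1 \<and> j = 2 then g1_g w 1 2 0 3 else
      if i = 1 \<and> j = 3 then g1_g w 1 3 0 2 else
      if i = 1 \<and> j = 4 then g1_h w 1 0 2 3 else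
      if i = 2 \<and> j = 0 then g1_g w 2 0 1 3 else
      if i = 2 \<and> j = 1 then g1_g w 2 1 0 3 else
      if i = 2 \<and> j = 3 then g1_g w 2 3 0 1 else
      if i = 2 \<and> j = 4 then g1_h w 2 0 1 3 else
      if i = 3 \<and> j = 0 then g1_g w 3 0 1 2 else
      if i = 3 \<and> j = 1 then g1_g w 3 1 0 2 else
      if i = 3 \<and> j = 2 then g1_g w 3 2 0 1 else
      g1_h w 3 0 1 2)" for i j :: nat
    have h: "h 0 1 = g1_g w 0 1 2 3" "h 0 2 = g1_g w 0 2 1 3" "h 0 3 = g1_g w 0 3 1 2"
      "h 0 4 = g1_h w 0 1 2 3" "h 1 0 = g1_g w 1 0 2 3" "h 1 2 = g1_g w 1 2 0 3"
      "h 1 3 = g1_g w 1 3 0 2" "h 1 4 = g1_h w 1 0 2 3" "h 2 0 = g1_g w 2 0 1 3"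
      "h 2 1 = g1_g w 2 1 0 3" "h 2 3 = g1_g w 2 3 0 1" "h 2 4 = g1_h w 2 0 1 3"
      "h 3 0 = g1_g w 3 0 1 2" "h 3 1 = g1_g w 3 1 0 2" "h 3 2 = g1_g w 3 2 0 1"
      "h 3 4 = g1_h w 3 0 1 2"
      by (simp_all add: h_def)
    show "\<exists>h. (\<forall>i j. (i, j) \<in> I \<longrightarrow> Poly_Mapping.lookup (h i j) {#} = 0) \<and>
        (\<forall>i<4. (\<Sum>j | (i, j) \<in> I. of_nat 2 * w i j ^ 5 + 5 * (w i j * h i j)) = 0) \<and>
        (\<forall>j. Suc j < 5 \<longrightarrow> (\<Sum>i | (i, j) \<in> I. of_nat 2 * w i j ^ 5 + 5 * (w i j * h i j)) = 0)"
    proof (intro exI[of _ h] conjI allI impI)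
      fix i j
      show "Poly_Mapping.lookup (h i j) {#} = 0"
        by (simp only: h_def if_distrib[of "\<lambda>f. Poly_Mapping.lookup f {#}"] if_cancel const_g1[OF w0])
    next
      fix i :: nat assume "i < 4"
      then have "i = 0 \<or> i = 1 \<or> i = 2 \<or> i = 3" by auto
      then show "(\<Sum>j | (i, j) \<in> I. of_nat 2 * w i j ^ 5 + 5 * (w i j * h i j)) = 0"
      proof (elim disjE)
        assume i: "i = 0"
        show ?thesis
          unfolding i rows h of_nat_numeral
          \<comment> \<open>Every hypothesis is a conservation law solved for one variable; moving
            that variable back and reordering recovers a member of \<open>flow\<close>.\<close>
          by (rule g1_row) (use flow in \<open>simp_all only: eq_neg_iff_add_eq_0 add_ac\<close>)
      next
        assume i: "i = 1"
        show ?thesis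
          unfolding i rows h of_nat_numeral
          by (rule g1_row) (use flow in \<open>simp_all only: eq_neg_iff_add_eq_0 add_ac\<close>)
      next
        assume i: "i = 2"
        show ?thesis
          unfolding i rows h of_nat_numeral
          by (rule g1_row) (use flow in \<open>simp_all only: eq_neg_iff_add_eq_0 add_ac\<close>)
      next
        assume i: "i = 3"
        show ?thesis
          unfolding i rows h of_nat_numeral
          by (rule g1_row) (use flow in \<open>simp_all only: eq_neg_iff_add_eq_0 add_ac\<close>)
      qed
    next
      fix j :: nat assume "Suc j < 5"
      then have "j = 0 \<or> j = 1 \<or> j = 2 \<or> j = 3" by auto
      then show "(\<Sum>i | (i, j) \<in> I. of_nat 2 * w i j ^ 5 + 5 * (w i j * h i j)) = 0"
      proof (elim disjE)
        assume j: "j = 0"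
        show ?thesis
          unfolding j cols h of_nat_numeral
          by (rule g1_column) (use flow in \<open>simp_all only: eq_neg_iff_add_eq_0 add_ac\<close>)
      next
        assume j: "j = 1"
        show ?thesis
          unfolding j cols h of_nat_numeral
          by (rule g1_column) (use flow in \<open>simp_all only: eq_neg_iff_add_eq_0 add_ac\<close>)
      next
        assume j: "j = 2"
        show ?thesis
          unfolding j cols h of_nat_numeral
          by (rule g1_column) (use flow in \<open>simp_all only: eq_neg_iff_add_eq_0 add_ac\<close>)
      next
        assume j: "j = 3"
        show ?thesis
          unfolding j cols h of_nat_numeral
          by (rule g1_column) (use flow in \<open>simp_all only: eq_neg_iff_add_eq_0 add_ac\<close>)
      qed
    qed
  qed
  moreover have "(\<lambda>(i, j). {?a i, ?b j}) ` I = snd G\<^sub>1"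
    by (simp add: I_def G\<^sub>1_def numeral_eq_Suc)
  ultimately show ?thesis by simp
qed

theorem G2_in_class: "cycle_matroid G\<^sub>2 \<in> matroid_class TYPE(5)"
proof -
  \<comment> \<open>Rows are the six subdivision vertices in the order of \<open>ps\<close>, columns
    0 to 3 the vertices of K_4, and column 4 is \<open>Apex\<close>.\<close>
  define I :: "(nat \<times> nat) set" where
    "I = {(0, 0), (0, 1), (0, 4), (1, 0), (1, 2), (1, 4), (2, 0), (2, 3), (2, 4), (3, 1), (3, 2),
      (3, 4), (4, 1), (4, 3), (4, 4), (5, 2), (5, 3), (5, 4)}"
  define ps :: "nat set list" where "ps = [{0, 1}, {0, 2}, {0, 3}, {1, 2}, {1, 3}, {2, 3}]"
  have row_sets: "{j. (0, j) \<in> I} = {0, 1, 4}" "{j. (1, j) \<in> I} = {0, 2, 4}"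
      "{j. (2, j) \<in> I} = {0, 3, 4}" "{j. (3, j) \<in> I} = {1, 2, 4}"
      "{j. (4, j) \<in> I} = {1, 3, 4}" "{j. (5, j) \<in> I} = {2, 3, 4}"
    unfolding I_def by auto
  have col_sets: "{i. (i, 0) \<in> I} = {0, 1, 2}" "{i. (i, 1) \<in> I} = {0, 3, 4}"
      "{i. (i, 2) \<in> I} = {1, 3, 5}" "{i. (i, 3) \<in> I} = {2, 4, 5}"
      "{i. (i, 4) \<in> I} = {0, 1, 2, 3, 4, 5}"
    unfolding I_def by auto
  have rows: "(\<Sum>j | (0, j) \<in> I. f j) = f 0 + f 1 + f 4"
      "(\<Sum>j | (1, j) \<in> I. f j) = f 0 + f 2 + f 4"
      "(\<Sum>j | (2, j) \<in> I. f j) = f 0 + f 3 + f 4"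
      "(\<Sum>j | (3, j) \<in> I. f j) = f 1 + f 2 + f 4"
      "(\<Sum>j | (4, j) \<in> I. f j) = f 1 + f 3 + f 4"
      "(\<Sum>j | (5, j) \<in> I. f j) = f 2 + f 3 + f 4"
    for f :: "nat \<Rightarrow> nat multiset \<Rightarrow>\<^sub>0 int"
    unfolding row_sets by (simp_all add: add.assoc)
  have cols: "(\<Sum>i | (i, 0) \<in> I. f i) = f 0 + f 1 + f 2"
      "(\<Sum>i | (i, 1) \<in> I. f i) = f 0 + f 3 + f 4"
      "(\<Sum>i | (i, 2) \<in> I. f i) = f 1 + f 3 + f 5"
      "(\<Sum>i | (i, 3) \<in> I. f i) = f 2 + f 4 + f 5"
    for f :: "nat \<Rightarrow> nat multiset \<Rightarrow>\<^sub>0 int"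
    unfolding col_sets by (simp_all add: add.assoc)
  \<comment> \<open>In the spanning tree, \<open>Apex\<close> is joined to all subdivision vertices;
    \<open>Old 0\<close> and \<open>Old 1\<close> hang from \<open>Mid {0, 1}\<close>, and
    \<open>Old j\<close> hangs from \<open>Mid {0, j}\<close> for j = 2, 3.\<close>
  let ?a = "\<lambda>i::nat. Mid (ps ! i)" and ?b = "\<lambda>j::nat. if j < 4 then Old j else Apex"
    and ?vs = "Apex # map Mid ps @ [Old 0, Old 1, Old 2, Old 3]"
    and ?par = "\<lambda>k::nat. if k < 6 then 0 else if k = 6 then 1 else k - 6 :: nat"
  have L: "{..<4} = {0, 1, 2, 3 :: nat}" "{..<5} = {0, 1, 2, 3, 4 :: nat}" "{..<6} = {0, 1, 2, 3, 4,
      5 :: nat}"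
    by auto
  have "cycle_matroid (fst G\<^sub>2, (\<lambda>(i, j). {?a i, ?b j}) ` I) \<in> matroid_class TYPE(5)"
  proof (rule bipartite_graph_in_class[where \<alpha> = "?a" and \<beta> = "?b" and m = 6 and n = 5
        and c = 4 and g = 10 and vs = "?vs" and par = "?par"])
    show "inj_on ?a {..<6}" unfolding L by (simp add: inj_on_def ps_def doubleton_eq_iff)
    show "inj_on ?b {..<5}" unfolding L by (simp add: inj_on_def)
    show "?a ` {..<6} \<inter> ?b ` {..<5} = {}" unfolding L by (simp add: ps_def doubleton_eq_iff)
    show "I \<subseteq> {..<6} \<times> {..<5}" by (simp add: I_def)
    show "set ?vs = ?a ` {..<6} \<union> ?b ` {..<5}" unfolding L by (auto simp: ps_def)
    show "distinct ?vs" by (simp add: ps_def doubleton_eq_iff)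
    show "length ?vs = Suc 10" by (simp add: ps_def)
  next
    fix k :: nat assume "k < 10"
    then have "k \<in> {0, 1, 2, 3, 4, 5, 6, 7, 8, 9}" by auto
    then show "?par k \<le> k \<and> {?vs ! Suc k, ?vs ! ?par k} \<in> (\<lambda>(i, j). {?a i, ?b j}) ` I"
      unfolding I_def ps_def by (elim insertE) (simp_all add: doubleton_eq_iff)
  next
    have "(of_nat 4 :: 5) * 4 = 1" by simp
    then show "(of_nat 4 :: 5) dvd 1" by (metis dvd_triv_left)
  next
    fix w :: "nat \<Rightarrow> nat \<Rightarrow> nat multiset \<Rightarrow>\<^sub>0 int"
    assume w0: "\<And>i j. Poly_Mapping.lookup (w i j) {#} = 0"
      and wa: "\<And>i. i < 6 \<Longrightarrow> (\<Sum>j | (i, j) \<in> I. w i j) = 0"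
      and wb: "\<And>j. j < 5 \<Longrightarrow> (\<Sum>i | (i, j) \<in> I. w i j) = 0"
    txt \<open>The table gives the position of \<open>{u, v}\<close> in \<open>ps\<close>; its diagonal is irrelevant.\<close>
    define z where "z u v = w ([[9, 0, 1, 2], [0, 9, 3, 4], [1, 3, 9, 5], [2, 4, 5, 9]] ! u ! v) u"
        for u v :: nat
    have z0: "Poly_Mapping.lookup (z u v) {#} = 0" for u v by (simp add: z_def w0)
    have z: "w 0 0 = z 0 1" "w 0 1 = z 1 0" "w 1 0 = z 0 2" "w 1 2 = z 2 0" "w 2 0 = z 0 3"
      "w 2 3 = z 3 0" "w 3 1 = z 1 2" "w 3 2 = z 2 1" "w 4 1 = z 1 3" "w 4 3 = z 3 1"
      "w 5 2 = z 2 3" "w 5 3 = z 3 2"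
      by (simp_all add: z_def)
    have a0: "w 0 0 + w 0 1 + w 0 4 = 0"
      by (rule wa[of 0, unfolded rows]) simp
    have a1: "w 1 0 + w 1 2 + w 1 4 = 0"
      by (rule wa[of 1, unfolded rows]) simp
    have a2: "w 2 0 + w 2 3 + w 2 4 = 0"
      by (rule wa[of 2, unfolded rows]) simp
    have a3: "w 3 1 + w 3 2 + w 3 4 = 0"
      by (rule wa[of 3, unfolded rows]) simp
    have a4: "w 4 1 + w 4 3 + w 4 4 = 0"
      by (rule wa[of 4, unfolded rows]) simp
    have a5: "w 5 2 + w 5 3 + w 5 4 = 0"
      by (rule wa[of 5, unfolded rows]) simp
    have b0: "w 0 0 + w 1 0 + w 2 0 = 0"
      by (rule wb[of 0, unfolded cols]) simp
    have b1: "w 0 1 + w 3 1 + w 4 1 = 0"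
      by (rule wb[of 1, unfolded cols]) simp
    have b2: "w 1 2 + w 3 2 + w 5 2 = 0"
      by (rule wb[of 2, unfolded cols]) simp
    have b3: "w 2 3 + w 4 3 + w 5 3 = 0"
      by (rule wb[of 3, unfolded cols]) simp
    note flow' = a0 a1 a2 a3 a4 a5 b0 b1 b2 b3
    note flow = flow'[unfolded z]
    define h where "h i j = (if i = 0 \<and> j = 0 then g2_g z 0 1 2 3 else
      if i = 0 \<and> j = 1 then g2_g z 1 0 2 3 else
      if i = 0 \<and> j = 4 then g2_h (w 0 4) z 0 1 2 3 else
      if i = 1 \<and> j = 0 then g2_g z 0 2 1 3 else
      if i = 1 \<and> j = 2 then g2_g z 2 0 1 3 else
      if i = 1 \<and> j = 4 then g2_h (w 1 4) z 0 2 1 3 else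
      if i = 2 \<and> j = 0 then g2_g z 0 3 1 2 else
      if i = 2 \<and> j = 3 then g2_g z 3 0 1 2 else
      if i = 2 \<and> j = 4 then g2_h (w 2 4) z 0 3 1 2 else
      if i = 3 \<and> j = 1 then g2_g z 1 2 0 3 else
      if i = 3 \<and> j = 2 then g2_g z 2 1 0 3 else
      if i = 3 \<and> j = 4 then g2_h (w 3 4) z 1 2 0 3 else
      if i = 4 \<and> j = 1 then g2_g z 1 3 0 2 else
      if i = 4 \<and> j = 3 then g2_g z 3 1 0 2 else
      if i = 4 \<and> j = 4 then g2_h (w 4 4) z 1 3 0 2 else
      if i = 5 \<and> j = 2 then g2_g z 2 3 0 1 else
      if i = 5 \<and> j = 3 then g2_g z 3 2 0 1 else
      g2_h (w 5 4) z 2 3 0 1)" for i j :: nat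
    have h: "h 0 0 = g2_g z 0 1 2 3" "h 0 1 = g2_g z 1 0 2 3" "h 0 4 = g2_h (w 0 4) z 0 1 2 3"
      "h 1 0 = g2_g z 0 2 1 3" "h 1 2 = g2_g z 2 0 1 3" "h 1 4 = g2_h (w 1 4) z 0 2 1 3"
      "h 2 0 = g2_g z 0 3 1 2" "h 2 3 = g2_g z 3 0 1 2" "h 2 4 = g2_h (w 2 4) z 0 3 1 2"
      "h 3 1 = g2_g z 1 2 0 3" "h 3 2 = g2_g z 2 1 0 3" "h 3 4 = g2_h (w 3 4) z 1 2 0 3"
      "h 4 1 = g2_g z 1 3 0 2" "h 4 3 = g2_g z 3 1 0 2" "h 4 4 = g2_h (w 4 4) z 1 3 0 2"
      "h 5 2 = g2_g z 2 3 0 1" "h 5 3 = g2_g z 3 2 0 1" "h 5 4 = g2_h (w 5 4) z 2 3 0 1"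
      by (simp_all add: h_def)
    show "\<exists>h. (\<forall>i j. (i, j) \<in> I \<longrightarrow> Poly_Mapping.lookup (h i j) {#} = 0) \<and>
        (\<forall>i<6. (\<Sum>j | (i, j) \<in> I. of_nat 4 * w i j ^ 5 + 5 * (w i j * h i j)) = 0) \<and>
        (\<forall>j. Suc j < 5 \<longrightarrow> (\<Sum>i | (i, j) \<in> I. of_nat 4 * w i j ^ 5 + 5 * (w i j * h i j)) = 0)"
    proof (intro exI[of _ h] conjI allI impI)
      fix i j
      show "Poly_Mapping.lookup (h i j) {#} = 0"
        by (simp only: h_def if_distrib[of "\<lambda>f. Poly_Mapping.lookup f {#}"] if_cancel const_g2[of z,
            OF z0 w0])
    next
      fix i :: nat assume "i < 6"
      then have "i = 0 \<or> i = 1 \<or> i = 2 \<or> i = 3 \<or> i = 4 \<or> i = 5" by auto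
      then show "(\<Sum>j | (i, j) \<in> I. of_nat 4 * w i j ^ 5 + 5 * (w i j * h i j)) = 0"
      proof (elim disjE)
        assume i: "i = 0"
        show ?thesis
          unfolding i rows h of_nat_numeral z
          by (rule g2_pair) (use flow in \<open>simp_all only: eq_neg_iff_add_eq_0 add_ac\<close>)
      next
        assume i: "i = 1"
        show ?thesis
          unfolding i rows h of_nat_numeral z
          by (rule g2_pair) (use flow in \<open>simp_all only: eq_neg_iff_add_eq_0 add_ac\<close>)
      next
        assume i: "i = 2"
        show ?thesis
          unfolding i rows h of_nat_numeral z
          by (rule g2_pair) (use flow in \<open>simp_all only: eq_neg_iff_add_eq_0 add_ac\<close>)
      next
        assume i: "i = 3"
        show ?thesis
          unfolding i rows h of_nat_numeral z
          by (rule g2_pair) (use flow in \<open>simp_all only: eq_neg_iff_add_eq_0 add_ac\<close>)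
      next
        assume i: "i = 4"
        show ?thesis
          unfolding i rows h of_nat_numeral z
          by (rule g2_pair) (use flow in \<open>simp_all only: eq_neg_iff_add_eq_0 add_ac\<close>)
      next
        assume i: "i = 5"
        show ?thesis
          unfolding i rows h of_nat_numeral z
          by (rule g2_pair) (use flow in \<open>simp_all only: eq_neg_iff_add_eq_0 add_ac\<close>)
      qed
    next
      fix j :: nat assume "Suc j < 5"
      then have "j = 0 \<or> j = 1 \<or> j = 2 \<or> j = 3" by auto
      then show "(\<Sum>i | (i, j) \<in> I. of_nat 4 * w i j ^ 5 + 5 * (w i j * h i j)) = 0"
      proof (elim disjE)
        assume j: "j = 0"
        show ?thesis
          unfolding j cols h of_nat_numeral z
          by (rule g2_row) (use flow in \<open>simp_all only: eq_neg_iff_add_eq_0 add_ac\<close>)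
      next
        assume j: "j = 1"
        show ?thesis
          unfolding j cols h of_nat_numeral z
          by (rule g2_row) (use flow in \<open>simp_all only: eq_neg_iff_add_eq_0 add_ac\<close>)
      next
        assume j: "j = 2"
        show ?thesis
          unfolding j cols h of_nat_numeral z
          by (rule g2_row) (use flow in \<open>simp_all only: eq_neg_iff_add_eq_0 add_ac\<close>)
      next
        assume j: "j = 3"
        show ?thesis
          unfolding j cols h of_nat_numeral z
          by (rule g2_row) (use flow in \<open>simp_all only: eq_neg_iff_add_eq_0 add_ac\<close>)
      qed
    qed
  qed
  moreover have "(\<lambda>(i, j). {?a i, ?b j}) ` I = snd G\<^sub>2"
    proof -
    have edge: "{i, j} \<in> snd (complete_graph 4)" if "i < 4" "j < 4" "i \<noteq> j" for i j
      using that by (auto simp: complete_graph_def)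
    have "snd (complete_graph 4) = set ps"
    proof
      show "set ps \<subseteq> snd (complete_graph 4)" by (simp add: ps_def edge)
      show "snd (complete_graph 4) \<subseteq> set ps"
      proof
        fix s assume "s \<in> snd (complete_graph 4)"
        then obtain i j where s: "s = {i, j}" "i < 4" "j < 4" "i \<noteq> j"
          by (auto simp: complete_graph_def)
        then have "i \<in> {0, 1, 2, 3}" "j \<in> {0, 1, 2, 3}" by auto
        then show "s \<in> set ps"
          using s(4) unfolding s(1) by (elim insertE) (simp_all add: ps_def insert_commute)
      qed
    qed
    then have "snd G\<^sub>2 = (\<Union>e\<in>set ps. (\<lambda>v. {Old v, Mid e}) ` e) \<union> (\<lambda>e. {Apex, Mid e}) ` set ps"
      by (auto simp: G\<^sub>2_def subdivide_and_join_def)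
    then show ?thesis by (simp add: ps_def I_def insert_commute)
  qed
  ultimately show ?thesis by simp
qed

theorem theorem4p1:
  shows "cycle_matroid (complete_bipartite 3 5) \<in> matroid_class TYPE(5) \<and>
         cycle_matroid G\<^sub>1 \<in> matroid_class TYPE(5) \<and>
         cycle_matroid G\<^sub>2 \<in> matroid_class TYPE(5)"
  using k35_in_class G1_in_class G2_in_class by blast

end
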